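(* Let $G$ be an ample groupoid such that $G^{(0)}$ is Hausdorff and let $c:G\to\Gamma$ be a continuous cocycle into a discrete group $\Gamma$. Write $G_\gamma:=c^{-1}(\gamma)$ for $\gamma\in\Gamma$. The following are equivalent: (1) $G$ is a strongly $\Gamma$-graded groupoid in the sense that $G_\alpha G_\beta=G_{\alpha\beta}$ for all $\alpha,\beta\in\Gamma$; (2) the complex Steinberg algebra $A(G)$, with homogeneous components $A(G)_\gamma$, is a strongly $\Gamma$-graded ring; (3) the reduced $C^*$-algebra $C^*_r(G)$, with homogeneous subspaces $C^*_r(G)_\gamma=\overline{A(G)_\gamma}$, is a strongly $\Gamma$-graded $C^*$-algebra.
   Context: A topological groupoid $G$ (with unit space $G^{(0)}$, range and source maps $r,s$) is ample if it has a basis of compact open bisections, where an open bisection is an open set $B\subseteq G$ on which $r$ and $s$ restrict to homeomorphisms onto open subsets of $G^{(0)}$. $G$ itself need not be Hausdorff. A continuous cocycle $c:G\to\Gamma$ is a continuous groupoid homomorphism, i.e. $c(xy)=c(x)c(y)$ for composable $x,y$. For subsets $X,Y\subseteq G$, $XY:=\{xy:x\in X,y\in Y,\ s(x)=r(y)\}$. The complex Steinberg algebra is $A(G):=\operatorname{span}\{1_B:B\text{ is a compact open bisection}\}$, where $1_B:G\to\mathbb{C}$ is the characteristic function, with pointwise linear operations, convolution product $(fg)(x)=\sum_{yz=x}f(y)g(z)$ (so $1_B1_D=1_{BD}$) and involution $f^*(x)=\overline{f(x^{-1})}$. It is a $\Gamma$-graded ring with $A(G)_\gamma:=\{f\in A(G):\operatorname{supp}f\subseteq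 G_\gamma\}$. A ring $R$ is $\Gamma$-graded if there are additive subgroups $\{R_\gamma:\gamma\in\Gamma\}$ of $R$ with $R_\alpha R_\beta\subseteq R_{\alpha\beta}$ for all $\alpha,\beta\in\Gamma$ and $\bigoplus_{\gamma\in\Gamma}R_\gamma=R$, where $R_\alpha R_\beta$ is the set of finite sums of products $ab$ with $a\in R_\alpha,b\in R_\beta$. It is strongly $\Gamma$-graded if moreover $R_\alpha R_\beta=R_{\alpha\beta}$ for all $\alpha,\beta\in\Gamma$. $C^*_r(G)$ is the reduced groupoid $C^*$-algebra: let $C_c(G)$ be the span of functions $f:G\to\mathbb{C}$ that vanish outside some open bisection $U$ and are continuous with compact support on $U$, with the same convolution and involution; $C^*_r(G)$ is the completion of $C_c(G)$ in the norm $\|f\|_r=\sup_{u\in G^{(0)}}\|\lambda_u(f)\|$, where $\lambda_u(f)$ acts on $\ell^2(s^{-1}(u))$ by $\lambda_u(f)\delta_x=\sum_{s(y)=r(x)}f(y)\delta_{yx}$. One has $A(G)\subseteq C_c(G)\subseteq C^*_r(G)$, and $C^*_r(G)_\gamma:=\overline{A(G)_\gamma}$ is the closure in $C^*_r(G)$. A $C^*$-algebra $A$ is $\Gamma$-graded if there are linearly independent closed subspaces $\{A_\gamma:\gamma\in\Gamma\}$ of $A$ such that for all $\alpha,\beta\in\Gamma$: (i) $A_\alpha\cdot A_\beta:=\operatorname{span}\{ab:a\in A_\alpha,b\in A_\beta\}\subseteq A_{\alpha\beta}$; (ii) $\{a^*:a\in A_\alpha\}\subseteq A_{\alpha^{-1}}$;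 and (iii) $\bigoplus_{\gamma\in\Gamma}A_\gamma$ is dense in $A$. It is strongly $\Gamma$-graded if in addition $A_\alpha\cdot A_\beta$ is dense in $A_{\alpha\beta}$ for all $\alpha,\beta\in\Gamma$. *)

theory Defs
  imports "HOL-Analysis.Analysis" "HOL-Algebra.AbelCoset"
begin

section \<open>Ample groupoids and cocycles\<close>

text \<open>The carrier of the groupoid is the underlying set of an abstract topology, so the space is
  not assumed to be Hausdorff. The product \<open>gmul G x y\<close> is only meaningful when
  \<open>gsrc G x = gran G y\<close>.\<close>

record 'g tgroupoid =
  gtop :: "'g topology"
  gmul :: "'g \<Rightarrow> 'g \<Rightarrow> 'g"
  ginv :: "'g \<Rightarrow> 'g"
  gran :: "'g \<Rightarrow> 'g"
  gsrc :: "'g \<Rightarrow> 'g"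

abbreviation elts :: "('g, 'x) tgroupoid_scheme \<Rightarrow> 'g set"
  where "elts G \<equiv> topspace (gtop G)"

definition gunits :: "('g, 'x) tgroupoid_scheme \<Rightarrow> 'g set"
  where "gunits G = gran G ` elts G"

definition unit_topology :: "('g, 'x) tgroupoid_scheme \<Rightarrow> 'g topology"
  where "unit_topology G = subtopology (gtop G) (gunits G)"

definition composable :: "('g, 'x) tgroupoid_scheme \<Rightarrow> ('g \<times> 'g) set"
  where "composable G = {(x, y). x \<in> elts G \<and> y \<in> elts G \<and> gsrc G x = gran G y}"

locale algebraic_groupoid =
  fixes G :: "('g, 'x) tgroupoid_scheme"
  assumes ran_closed: "x \<in> elts G \<Longrightarrow> gran G x \<in> elts G"
    and src_closed: "x \<in> elts G \<Longrightarrow> gsrc G x \<in> elts G"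
    and ran_ran: "x \<in> elts G \<Longrightarrow> gran G (gran G x) = gran G x"
    and src_ran: "x \<in> elts G \<Longrightarrow> gsrc G (gran G x) = gran G x"
    and ran_src: "x \<in> elts G \<Longrightarrow> gran G (gsrc G x) = gsrc G x"
    and src_src: "x \<in> elts G \<Longrightarrow> gsrc G (gsrc G x) = gsrc G x"
    and mul_closed: "(x, y) \<in> composable G \<Longrightarrow> gmul G x y \<in> elts G"
    and ran_mul: "(x, y) \<in> composable G \<Longrightarrow> gran G (gmul G x y) = gran G x"
    and src_mul: "(x, y) \<in> composable G \<Longrightarrow> gsrc G (gmul G x y) = gsrc G y"
    and mul_assoc: "(x, y) \<in> composable G \<Longrightarrow> (y, z) \<in> composable G \<Longrightarrow>
          gmul G (gmul G x y) z = gmul G x (gmul G y z)"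
    and ran_unit: "x \<in> elts G \<Longrightarrow> gmul G (gran G x) x = x"
    and src_unit: "x \<in> elts G \<Longrightarrow> gmul G x (gsrc G x) = x"
    and inv_closed: "x \<in> elts G \<Longrightarrow> ginv G x \<in> elts G"
    and ran_inv: "x \<in> elts G \<Longrightarrow> gran G (ginv G x) = gsrc G x"
    and src_inv: "x \<in> elts G \<Longrightarrow> gsrc G (ginv G x) = gran G x"
    and mul_inv: "x \<in> elts G \<Longrightarrow> gmul G x (ginv G x) = gran G x"
    and inv_mul: "x \<in> elts G \<Longrightarrow> gmul G (ginv G x) x = gsrc G x"

text \<open>Continuity of the range and source maps follows from \<open>r(x) = x x\<^sup>-\<^sup>1\<close> and
  \<open>s(x) = x\<^sup>-\<^sup>1 x\<close>.\<close>

locale topological_groupoid = algebraic_groupoid G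
  for G :: "('g, 'x) tgroupoid_scheme" +
  assumes continuous_mul:
      "continuous_map (subtopology (prod_topology (gtop G) (gtop G)) (composable G)) (gtop G)
         (\<lambda>(x, y). gmul G x y)"
    and continuous_inv: "continuous_map (gtop G) (gtop G) (ginv G)"

definition open_bisection :: "('g, 'x) tgroupoid_scheme \<Rightarrow> 'g set \<Rightarrow> bool"
  where "open_bisection G B \<longleftrightarrow>
    openin (gtop G) B \<and>
    (\<forall>p \<in> {gran G, gsrc G}.
       openin (unit_topology G) (p ` B) \<and>
       homeomorphic_map (subtopology (gtop G) B) (subtopology (unit_topology G) (p ` B)) p)"

definition compact_open_bisection :: "('g, 'x) tgroupoid_scheme \<Rightarrow> 'g set \<Rightarrow> bool"
  where "compact_open_bisection G B \<longleftrightarrow> open_bisection G B \<and> compactin (gtop G) B"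

locale ample_groupoid = topological_groupoid G
  for G :: "('g, 'x) tgroupoid_scheme" +
  assumes ample_basis:
    "openin (gtop G) W \<Longrightarrow> x \<in> W \<Longrightarrow> \<exists>B. compact_open_bisection G B \<and> x \<in> B \<and> B \<subseteq> W"

definition set_mul :: "('g, 'x) tgroupoid_scheme \<Rightarrow> 'g set \<Rightarrow> 'g set \<Rightarrow> 'g set"
  where "set_mul G X Y = {gmul G x y | x y. x \<in> X \<and> y \<in> Y \<and> gsrc G x = gran G y}"

definition continuous_cocycle ::
    "('g, 'x) tgroupoid_scheme \<Rightarrow> ('k, 'm) monoid_scheme \<Rightarrow> ('g \<Rightarrow> 'k) \<Rightarrow> bool"
  where "continuous_cocycle G \<Gamma> c \<longleftrightarrow>
    continuous_map (gtop G) (discrete_topology (carrier \<Gamma>)) c \<and>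
    (\<forall>(x, y) \<in> composable G. c (gmul G x y) = c x \<otimes>\<^bsub>\<Gamma>\<^esub> c y)"

definition groupoid_component :: "('g, 'x) tgroupoid_scheme \<Rightarrow> ('g \<Rightarrow> 'k) \<Rightarrow> 'k \<Rightarrow> 'g set"
  where "groupoid_component G c \<gamma> = {x \<in> elts G. c x = \<gamma>}"

definition strongly_graded_groupoid ::
    "('k, 'm) monoid_scheme \<Rightarrow> ('g, 'x) tgroupoid_scheme \<Rightarrow> ('g \<Rightarrow> 'k) \<Rightarrow> bool"
  where "strongly_graded_groupoid \<Gamma> G c \<longleftrightarrow>
    (\<forall>\<alpha> \<in> carrier \<Gamma>. \<forall>\<beta> \<in> carrier \<Gamma>.
       set_mul G (groupoid_component G c \<alpha>) (groupoid_component G c \<beta>) =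
       groupoid_component G c (\<alpha> \<otimes>\<^bsub>\<Gamma>\<^esub> \<beta>))"

section \<open>Graded rings\<close>

text \<open>Rings need not have an identity: \<open>A(G)\<close> has one only when the unit space is
  compact. The records of HOL-Algebra are reused, but their \<open>one\<close> field plays no role here.\<close>

locale nonunital_ring = abelian_group R
  for R (structure) +
  assumes mult_closed: "x \<in> carrier R \<Longrightarrow> y \<in> carrier R \<Longrightarrow> x \<otimes> y \<in> carrier R"
    and mult_assoc: "x \<in> carrier R \<Longrightarrow> y \<in> carrier R \<Longrightarrow> z \<in> carrier R \<Longrightarrow>
          (x \<otimes> y) \<otimes> z = x \<otimes> (y \<otimes> z)"
    and distrib_right: "x \<in> carrier R \<Longrightarrow> y \<in> carrier R \<Longrightarrow> z \<in> carrier R \<Longrightarrow>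
          (x \<oplus> y) \<otimes> z = x \<otimes> z \<oplus> y \<otimes> z"
    and distrib_left: "x \<in> carrier R \<Longrightarrow> y \<in> carrier R \<Longrightarrow> z \<in> carrier R \<Longrightarrow>
          z \<otimes> (x \<oplus> y) = z \<otimes> x \<oplus> z \<otimes> y"

definition product_sums :: "('a, 'm) ring_scheme \<Rightarrow> 'a set \<Rightarrow> 'a set \<Rightarrow> 'a set"
  where "product_sums R X Y =
    {(\<Oplus>\<^bsub>R\<^esub>i\<in>{..<n}. a i \<otimes>\<^bsub>R\<^esub> b i) | (n::nat) a b. a \<in> {..<n} \<rightarrow> X \<and> b \<in> {..<n} \<rightarrow> Y}"

definition component_sums :: "('a, 'm) ring_scheme \<Rightarrow> 'k set \<Rightarrow> ('k \<Rightarrow> 'a set) \<Rightarrow> 'a set"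
  where "component_sums R I S = {(\<Oplus>\<^bsub>R\<^esub>i\<in>F. a i) | F a. finite F \<and> F \<subseteq> I \<and> a \<in> Pi F S}"

definition independent_components :: "('a, 'm) ring_scheme \<Rightarrow> 'k set \<Rightarrow> ('k \<Rightarrow> 'a set) \<Rightarrow> bool"
  where "independent_components R I S \<longleftrightarrow>
    (\<forall>F a. finite F \<and> F \<subseteq> I \<and> a \<in> Pi F S \<and> (\<Oplus>\<^bsub>R\<^esub>i\<in>F. a i) = \<zero>\<^bsub>R\<^esub> \<longrightarrow>
       (\<forall>i\<in>F. a i = \<zero>\<^bsub>R\<^esub>))"

locale graded_ring = grading: group \<Gamma> + nonunital_ring R
  for \<Gamma> :: "('k, 'm) monoid_scheme" and R :: "('a, 'n) ring_scheme" (structure)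
    and S :: "'k \<Rightarrow> 'a set" +
  assumes component_subgroup: "\<gamma> \<in> carrier \<Gamma> \<Longrightarrow> additive_subgroup (S \<gamma>) R"
    and component_mult: "\<alpha> \<in> carrier \<Gamma> \<Longrightarrow> \<beta> \<in> carrier \<Gamma> \<Longrightarrow>
          product_sums R (S \<alpha>) (S \<beta>) \<subseteq> S (\<alpha> \<otimes>\<^bsub>\<Gamma>\<^esub> \<beta>)"
    and components_independent: "independent_components R (carrier \<Gamma>) S"
    and components_span: "component_sums R (carrier \<Gamma>) S = carrier R"

locale strongly_graded_ring = graded_ring +
  assumes component_mult_eq: "\<alpha> \<in> carrier \<Gamma> \<Longrightarrow> \<beta> \<in> carrier \<Gamma> \<Longrightarrow>
          product_sums R (S \<alpha>) (S \<beta>) = S (\<alpha> \<otimes>\<^bsub>\<Gamma>\<^esub> \<beta>)"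

section \<open>Graded C*-algebras\<close>

record 'a star_algebra = "'a ring" +
  ascale :: "complex \<Rightarrow> 'a \<Rightarrow> 'a"
  astar :: "'a \<Rightarrow> 'a"
  anorm :: "'a \<Rightarrow> real"

text \<open>Outside the carrier the distance is set to 0, since the library's \<open>Metric_space\<close> asks
  for a function that is symmetric and nonnegative on the whole type.\<close>

definition adist :: "('a, 'm) star_algebra_scheme \<Rightarrow> 'a \<Rightarrow> 'a \<Rightarrow> real"
  where "adist A x y =
    (if x \<in> carrier A \<and> y \<in> carrier A then anorm A (x \<ominus>\<^bsub>A\<^esub> y) else 0)"

abbreviation atopology :: "('a, 'm) star_algebra_scheme \<Rightarrow> 'a topology"
  where "atopology A \<equiv> Metric_space.mtopology (carrier A) (adist A)"

locale cstar_algebra = nonunital_ring A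
  for A :: "('a, 'm) star_algebra_scheme" (structure) +
  assumes scale_closed: "x \<in> carrier A \<Longrightarrow> ascale A k x \<in> carrier A"
    and scale_add: "x \<in> carrier A \<Longrightarrow> y \<in> carrier A \<Longrightarrow>
          ascale A k (x \<oplus> y) = ascale A k x \<oplus> ascale A k y"
    and add_scale: "x \<in> carrier A \<Longrightarrow> ascale A (k + l) x = ascale A k x \<oplus> ascale A l x"
    and scale_scale: "x \<in> carrier A \<Longrightarrow> ascale A k (ascale A l x) = ascale A (k * l) x"
    and scale_one: "x \<in> carrier A \<Longrightarrow> ascale A 1 x = x"
    and scale_mult_left: "x \<in> carrier A \<Longrightarrow> y \<in> carrier A \<Longrightarrow>
          ascale A k x \<otimes> y = ascale A k (x \<otimes> y)"
    and scale_mult_right: "x \<in> carrier A \<Longrightarrow> y \<in> carrier A \<Longrightarrow>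
          x \<otimes> ascale A k y = ascale A k (x \<otimes> y)"
    and star_closed: "x \<in> carrier A \<Longrightarrow> astar A x \<in> carrier A"
    and star_star: "x \<in> carrier A \<Longrightarrow> astar A (astar A x) = x"
    and star_add: "x \<in> carrier A \<Longrightarrow> y \<in> carrier A \<Longrightarrow>
          astar A (x \<oplus> y) = astar A x \<oplus> astar A y"
    and star_scale: "x \<in> carrier A \<Longrightarrow> astar A (ascale A k x) = ascale A (cnj k) (astar A x)"
    and star_mult: "x \<in> carrier A \<Longrightarrow> y \<in> carrier A \<Longrightarrow>
          astar A (x \<otimes> y) = astar A y \<otimes> astar A x"
    and norm_nonneg: "x \<in> carrier A \<Longrightarrow> 0 \<le> anorm A x"
    and norm_eq_zero: "x \<in> carrier A \<Longrightarrow> anorm A x = 0 \<longleftrightarrow> x = \<zero>"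
    and norm_triangle: "x \<in> carrier A \<Longrightarrow> y \<in> carrier A \<Longrightarrow>
          anorm A (x \<oplus> y) \<le> anorm A x + anorm A y"
    and norm_scale: "x \<in> carrier A \<Longrightarrow> anorm A (ascale A k x) = cmod k * anorm A x"
    and norm_mult_le: "x \<in> carrier A \<Longrightarrow> y \<in> carrier A \<Longrightarrow>
          anorm A (x \<otimes> y) \<le> anorm A x * anorm A y"
    and cstar_identity: "x \<in> carrier A \<Longrightarrow> anorm A (astar A x \<otimes> x) = (anorm A x)\<^sup>2"
    and complete: "Metric_space.mcomplete (carrier A) (adist A)"

definition aspan :: "('a, 'm) star_algebra_scheme \<Rightarrow> 'a set \<Rightarrow> 'a set"
  where "aspan A X =
    {(\<Oplus>\<^bsub>A\<^esub>i\<in>{..<n}. ascale A (k i) (v i)) | (n::nat) k v. v \<in> {..<n} \<rightarrow> X}"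

definition span_mult :: "('a, 'm) star_algebra_scheme \<Rightarrow> 'a set \<Rightarrow> 'a set \<Rightarrow> 'a set"
  where "span_mult A X Y = aspan A {x \<otimes>\<^bsub>A\<^esub> y | x y. x \<in> X \<and> y \<in> Y}"

definition closed_subspace :: "('a, 'm) star_algebra_scheme \<Rightarrow> 'a set \<Rightarrow> bool"
  where "closed_subspace A X \<longleftrightarrow>
    additive_subgroup X A \<and> (\<forall>k. \<forall>x\<in>X. ascale A k x \<in> X) \<and> closedin (atopology A) X"

locale graded_cstar_algebra = grading: group \<Gamma> + cstar_algebra A
  for \<Gamma> :: "('k, 'm) monoid_scheme" and A :: "('a, 'n) star_algebra_scheme" (structure)
    and S :: "'k \<Rightarrow> 'a set" +
  assumes component_closed_subspace: "\<gamma> \<in> carrier \<Gamma> \<Longrightarrow> closed_subspace A (S \<gamma>)"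
    and components_independent: "independent_components A (carrier \<Gamma>) S"
    and component_mult: "\<alpha> \<in> carrier \<Gamma> \<Longrightarrow> \<beta> \<in> carrier \<Gamma> \<Longrightarrow>
          span_mult A (S \<alpha>) (S \<beta>) \<subseteq> S (\<alpha> \<otimes>\<^bsub>\<Gamma>\<^esub> \<beta>)"
    and component_star: "\<alpha> \<in> carrier \<Gamma> \<Longrightarrow> astar A ` S \<alpha> \<subseteq> S (inv\<^bsub>\<Gamma>\<^esub> \<alpha>)"
    and components_dense: "atopology A closure_of component_sums A (carrier \<Gamma>) S = carrier A"

locale strongly_graded_cstar_algebra = graded_cstar_algebra +
  assumes component_mult_dense: "\<alpha> \<in> carrier \<Gamma> \<Longrightarrow> \<beta> \<in> carrier \<Gamma> \<Longrightarrow>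
          atopology A closure_of span_mult A (S \<alpha>) (S \<beta>) = S (\<alpha> \<otimes>\<^bsub>\<Gamma>\<^esub> \<beta>)"

section \<open>The Steinberg algebra\<close>

text \<open>Functions on \<open>G\<close> are represented by functions on the whole type that vanish outside
  the carrier.\<close>

definition fun_span :: "('g \<Rightarrow> complex) set \<Rightarrow> ('g \<Rightarrow> complex) set"
  where "fun_span X = {(\<lambda>x. \<Sum>f\<in>F. k f * f x) | F k. finite F \<and> F \<subseteq> X}"

text \<open>For the functions considered below only finitely many terms of this sum are nonzero.\<close>

definition convolution ::
    "('g, 'x) tgroupoid_scheme \<Rightarrow> ('g \<Rightarrow> complex) \<Rightarrow> ('g \<Rightarrow> complex) \<Rightarrow> 'g \<Rightarrow> complex"
  where "convolution G f g x =
    (\<Sum>\<^sub>\<infinity>(y, z)\<in>{(y, z) \<in> composable G. gmul G y z = x}. f y * g z)"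

definition involution ::
    "('g, 'x) tgroupoid_scheme \<Rightarrow> ('g \<Rightarrow> complex) \<Rightarrow> 'g \<Rightarrow> complex"
  where "involution G f x = (if x \<in> elts G then cnj (f (ginv G x)) else 0)"

definition steinberg :: "('g, 'x) tgroupoid_scheme \<Rightarrow> ('g \<Rightarrow> complex) set"
  where "steinberg G = fun_span {indicator B | B. compact_open_bisection G B}"

definition steinberg_ring :: "('g, 'x) tgroupoid_scheme \<Rightarrow> ('g \<Rightarrow> complex) ring"
  where "steinberg_ring G =
    \<lparr>carrier = steinberg G,
     mult = convolution G,
     one = indicator (gunits G),
     zero = (\<lambda>x. 0),
     add = (\<lambda>f g x. f x + g x)\<rparr>"

definition steinberg_component ::
    "('g, 'x) tgroupoid_scheme \<Rightarrow> ('g \<Rightarrow> 'k) \<Rightarrow> 'k \<Rightarrow> ('g \<Rightarrow> complex) set"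
  where "steinberg_component G c \<gamma> =
    {f \<in> steinberg G. {x. f x \<noteq> 0} \<subseteq> groupoid_component G c \<gamma>}"

section \<open>The reduced groupoid C*-algebra\<close>

definition bisection_function ::
    "('g, 'x) tgroupoid_scheme \<Rightarrow> ('g \<Rightarrow> complex) \<Rightarrow> bool"
  where "bisection_function G f \<longleftrightarrow>
    (\<exists>U. open_bisection G U \<and> (\<forall>x. x \<notin> U \<longrightarrow> f x = 0) \<and>
         continuous_map (subtopology (gtop G) U) euclidean f \<and>
         compactin (gtop G) (subtopology (gtop G) U closure_of {x \<in> U. f x \<noteq> 0}))"

definition Cc :: "('g, 'x) tgroupoid_scheme \<Rightarrow> ('g \<Rightarrow> complex) set"
  where "Cc G = fun_span {f. bisection_function G f}"

definition source_fibre :: "('g, 'x) tgroupoid_scheme \<Rightarrow> 'g \<Rightarrow> 'g set"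
  where "source_fibre G u = {x \<in> elts G. gsrc G x = u}"

definition ell2 :: "'g set \<Rightarrow> ('g \<Rightarrow> complex) set"
  where "ell2 X = {\<xi>. (\<forall>x. x \<notin> X \<longrightarrow> \<xi> x = 0) \<and> (\<lambda>x. (cmod (\<xi> x))\<^sup>2) summable_on X}"

definition ell2_norm :: "'g set \<Rightarrow> ('g \<Rightarrow> complex) \<Rightarrow> real"
  where "ell2_norm X \<xi> = sqrt (\<Sum>\<^sub>\<infinity>x\<in>X. (cmod (\<xi> x))\<^sup>2)"

text \<open>\<open>regular_delta G f x\<close> is the vector \<open>\<lambda>\<^sub>u(f) \<delta>\<^sub>x = \<Sum> f(y) \<delta>\<^sub>y\<^sub>x\<close>, the sum being over
  all \<open>y\<close> with \<open>s(y) = r(x)\<close>; \<open>regular_rep G u f\<close> is its bounded linear extension to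
  \<open>\<ell>\<^sup>2(s\<^sup>-\<^sup>1(u))\<close>, written in coordinates. For \<open>f\<close> in \<open>C\<^sub>c(G)\<close> each
  coordinate of the result is a sum with only finitely many nonzero terms.\<close>

definition regular_delta ::
    "('g, 'x) tgroupoid_scheme \<Rightarrow> ('g \<Rightarrow> complex) \<Rightarrow> 'g \<Rightarrow> 'g \<Rightarrow> complex"
  where "regular_delta G f x z =
    (\<Sum>\<^sub>\<infinity>y\<in>{y \<in> elts G. gsrc G y = gran G x}. f y * indicator {gmul G y x} z)"

definition regular_rep ::
    "('g, 'x) tgroupoid_scheme \<Rightarrow> 'g \<Rightarrow> ('g \<Rightarrow> complex) \<Rightarrow> ('g \<Rightarrow> complex) \<Rightarrow> 'g \<Rightarrow> complex"
  where "regular_rep G u f \<xi> z = (\<Sum>\<^sub>\<infinity>x\<in>source_fibre G u. \<xi> x * regular_delta G f x z)"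

definition regular_norm ::
    "('g, 'x) tgroupoid_scheme \<Rightarrow> 'g \<Rightarrow> ('g \<Rightarrow> complex) \<Rightarrow> real"
  where "regular_norm G u f =
    (SUP \<xi>\<in>{\<xi> \<in> ell2 (source_fibre G u). ell2_norm (source_fibre G u) \<xi> \<le> 1}.
       ell2_norm (source_fibre G u) (regular_rep G u f \<xi>))"

text \<open>The inserted 0 only matters for the empty groupoid, where the supremum would be over the
  empty set.\<close>

definition reduced_norm :: "('g, 'x) tgroupoid_scheme \<Rightarrow> ('g \<Rightarrow> complex) \<Rightarrow> real"
  where "reduced_norm G f = Sup (insert 0 ((\<lambda>u. regular_norm G u f) ` gunits G))"

definition Cc_algebra :: "('g, 'x) tgroupoid_scheme \<Rightarrow> ('g \<Rightarrow> complex) star_algebra"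
  where "Cc_algebra G =
    \<lparr>carrier = Cc G,
     mult = convolution G,
     one = indicator (gunits G),
     zero = (\<lambda>x. 0),
     add = (\<lambda>f g x. f x + g x),
     ascale = (\<lambda>k f x. k * f x),
     astar = involution G,
     anorm = reduced_norm G\<rparr>"

text \<open>The completion of a normed *-algebra: Cauchy sequences modulo null sequences.\<close>

definition null_equiv :: "('a, 'm) star_algebra_scheme \<Rightarrow> (nat \<Rightarrow> 'a) rel"
  where "null_equiv P =
    {(x, y). Metric_space.MCauchy (carrier P) (adist P) x \<and>
             Metric_space.MCauchy (carrier P) (adist P) y \<and>
             (\<lambda>n. adist P (x n) (y n)) \<longlonglongrightarrow> 0}"

definition const_class :: "('a, 'm) star_algebra_scheme \<Rightarrow> 'a \<Rightarrow> (nat \<Rightarrow> 'a) set"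
  where "const_class P a = null_equiv P `` {\<lambda>n. a}"

definition star_completion ::
    "('a, 'm) star_algebra_scheme \<Rightarrow> (nat \<Rightarrow> 'a) set star_algebra"
  where "star_completion P =
    \<lparr>carrier = {x. Metric_space.MCauchy (carrier P) (adist P) x} // null_equiv P,
     mult = (\<lambda>X Y. \<Union>x\<in>X. \<Union>y\<in>Y. null_equiv P `` {\<lambda>n. x n \<otimes>\<^bsub>P\<^esub> y n}),
     one = const_class P \<one>\<^bsub>P\<^esub>,
     zero = const_class P \<zero>\<^bsub>P\<^esub>,
     add = (\<lambda>X Y. \<Union>x\<in>X. \<Union>y\<in>Y. null_equiv P `` {\<lambda>n. x n \<oplus>\<^bsub>P\<^esub> y n}),
     ascale = (\<lambda>k X. \<Union>x\<in>X. null_equiv P `` {\<lambda>n. ascale P k (x n)}),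
     astar = (\<lambda>X. \<Union>x\<in>X. null_equiv P `` {\<lambda>n. astar P (x n)}),
     anorm = (\<lambda>X. the_elem ((\<lambda>x. lim (\<lambda>n. anorm P (x n))) ` X))\<rparr>"

definition reduced_cstar ::
    "('g, 'x) tgroupoid_scheme \<Rightarrow> (nat \<Rightarrow> 'g \<Rightarrow> complex) set star_algebra"
  where "reduced_cstar G = star_completion (Cc_algebra G)"

definition reduced_component ::
    "('g, 'x) tgroupoid_scheme \<Rightarrow> ('g \<Rightarrow> 'k) \<Rightarrow> 'k \<Rightarrow> (nat \<Rightarrow> 'g \<Rightarrow> complex) set set"
  where "reduced_component G c \<gamma> =
    atopology (reduced_cstar G) closure_of
      (const_class (Cc_algebra G) ` steinberg_component G c \<gamma>)"

end

theory Submission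
  imports Defs
begin

text \<open>
  The groupoid is strongly graded exactly when every unit is the range of an element of each
  \<open>G\<^sub>\<alpha>\<close>. Such an element has a compact open bisection \<open>Y \<subseteq> G\<^sub>\<alpha>\<close> around it. For a compact open
  bisection \<open>B \<subseteq> G\<^sub>\<alpha>\<^sub>\<beta>\<close> with \<open>r(B) \<subseteq> r(Y)\<close> one has \<open>B = Y (Y\<^sup>-\<^sup>1 B)\<close>, so \<open>1\<^sub>B\<close> is a product of
  indicators of degrees \<open>\<alpha>\<close> and \<open>\<beta>\<close> (\<open>indicator_product\<close>). Every compact open bisection is a
  finite disjoint union of such small ones (\<open>compact_open_induct\<close>), and the indicators of
  degree \<open>\<alpha>\<beta>\<close> span \<open>A(G)\<^sub>\<alpha>\<^sub>\<beta>\<close>. Hence a strongly graded groupoid has a strongly graded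
  Steinberg algebra. Taking closures gives the strong grading of the reduced \<open>C\<^sup>*\<close>-algebra.

  Conversely, if \<open>(f * g)(x) \<noteq> 0\<close> with \<open>f\<close> of degree \<open>\<alpha>\<close> and \<open>g\<close> of degree \<open>\<beta>\<close>, then \<open>x\<close> is a
  product of elements of degrees \<open>\<alpha>\<close> and \<open>\<beta>\<close> (\<open>strongly_graded_groupoidI\<close>). Since \<open>|f(x)|\<close> is
  at most the reduced norm of \<open>f\<close> (\<open>value_le_reduced_norm\<close>), an approximation of \<open>1\<^sub>B\<close> by sums
  of such products, with error less than 1, already forces one of them to be nonzero at a
  given \<open>x \<in> B\<close>. So even density of the products in the reduced algebra implies strong grading
  of the groupoid.

  Most of the work is to show that \<open>A(G)\<close> and \<open>C\<^sup>*\<^sub>r(G)\<close> are graded at all. Functions act by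
  convolution on finitely supported vectors, where all sums are finite; the reduced norm is
  the least bound of this action (\<open>reduced_norm_opbound\<close>, \<open>reduced_norm_least\<close>), and a bounded
  function supported in a bisection acts with norm at most its supremum (\<open>bisection_opbound\<close>).
  This yields the \<open>C\<^sup>*\<close>-identities on \<open>C\<^sub>c(G)\<close> and the density of \<open>A(G)\<close> in it
  (\<open>steinberg_dense\<close>); the completion of such an algebra is a \<open>C\<^sup>*\<close>-algebra
  (\<open>cstar_algebra_completion\<close>). Independence of the closed subspaces \<open>C\<^sup>*\<^sub>r(G)\<^sub>\<gamma>\<close> is the one
  point where disjoint supports in \<open>A(G)\<close> do not suffice by themselves: it needs that a
  norm-Cauchy sequence of functions that tends to 0 pointwise tends to 0 in norm
  (\<open>pointwise_null_imp_norm_null\<close>).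

  The groupoid need not be Hausdorff. The Hausdorff unit space makes each bisection Hausdorff
  (\<open>hausdorff_bisection\<close>), and that is what keeps products of compact open bisections, and
  intersections and differences inside one bisection, compact and open.
\<close>

section \<open>Calculus in an algebraic groupoid\<close>

context algebraic_groupoid
begin

lemma composable_iff [simp]:
  "(x, y) \<in> composable G \<longleftrightarrow> x \<in> elts G \<and> y \<in> elts G \<and> gsrc G x = gran G y"
  by (simp add: composable_def)

lemmas range_source_simps [simp] =
  ran_closed src_closed ran_ran src_ran ran_src src_src ran_unit src_unit inv_closed ran_inv
  src_inv mul_inv inv_mul

lemma mul_simps [simp]:
  assumes "x \<in> elts G" "y \<in> elts G" "gsrc G x = gran G y"
  shows "gmul G x y \<in> elts G" "gran G (gmul G x y) = gran G x" "gsrc G (gmul G x y) = gsrc G y"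
  using assms mul_closed[of x y] ran_mul[of x y] src_mul[of x y] by simp_all

lemma assoc:
  assumes "x \<in> elts G" "y \<in> elts G" "z \<in> elts G" "gsrc G x = gran G y" "gsrc G y = gran G z"
  shows "gmul G (gmul G x y) z = gmul G x (gmul G y z)"
  using assms mul_assoc[of x y z] by simp

lemma inv_mul_cancel [simp]:
  assumes "x \<in> elts G" "y \<in> elts G" "gsrc G x = gran G y"
  shows "gmul G (ginv G x) (gmul G x y) = y"
  using assms assoc[of "ginv G x" x y] by simp

lemma mul_inv_cancel [simp]:
  assumes "x \<in> elts G" "y \<in> elts G" "gran G x = gran G y"
  shows "gmul G x (gmul G (ginv G x) y) = y"
  using assms assoc[of x "ginv G x" y] by simp

lemma mul_cancel_inv [simp]:
  assumes "x \<in> elts G" "y \<in> elts G" "gsrc G x = gran G y"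
  shows "gmul G (gmul G x y) (ginv G y) = x"
  using assms assoc[of x y "ginv G y"] src_unit[of x] by simp

lemma mul_cancel_inv' [simp]:
  assumes "x \<in> elts G" "y \<in> elts G" "gsrc G x = gsrc G y"
  shows "gmul G (gmul G x (ginv G y)) y = x"
  using assms assoc[of x "ginv G y" y] src_unit[of x] by simp

lemma left_cancel:
  assumes "x \<in> elts G" "y \<in> elts G" "z \<in> elts G" "gsrc G x = gran G y" "gsrc G x = gran G z"
    "gmul G x y = gmul G x z"
  shows "y = z"
  using assms inv_mul_cancel by metis

lemma inv_inv [simp]:
  assumes "x \<in> elts G"
  shows "ginv G (ginv G x) = x"
  using left_cancel[of "ginv G x" "ginv G (ginv G x)" x] assms by simp

lemma inv_prod:
  assumes "x \<in> elts G" "y \<in> elts G" "gsrc G x = gran G y"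
  shows "ginv G (gmul G x y) = gmul G (ginv G y) (ginv G x)"
proof -
  have "gmul G (gmul G x y) (gmul G (ginv G y) (ginv G x)) = gran G x"
    using assms assoc[of "gmul G x y" "ginv G y" "ginv G x"] by simp
  then show ?thesis
    using assms left_cancel[of "gmul G x y" "ginv G (gmul G x y)" "gmul G (ginv G y) (ginv G x)"]
    by simp
qed

lemma gunits_iff: "u \<in> gunits G \<longleftrightarrow> u \<in> elts G \<and> gran G u = u"
  unfolding gunits_def using ran_closed ran_ran by (auto simp: image_iff) metis+

lemma ran_in_gunits [simp]: "x \<in> elts G \<Longrightarrow> gran G x \<in> gunits G"
  by (simp add: gunits_iff)

lemma src_in_gunits [simp]: "x \<in> elts G \<Longrightarrow> gsrc G x \<in> gunits G"
  by (simp add: gunits_iff)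

lemma unit_simps [simp]:
  assumes "u \<in> gunits G"
  shows "u \<in> elts G" "gran G u = u" "gsrc G u = u" "ginv G u = u"
proof -
  show u: "u \<in> elts G" "gran G u = u" using assms gunits_iff by auto
  then show s: "gsrc G u = u" using src_ran by metis
  show "ginv G u = u"
    using u s mul_inv[of u] ran_unit[of "ginv G u"] by simp
qed

section \<open>Convolution as a sum over a fibre\<close>

lemma convolution_outside: "x \<notin> elts G \<Longrightarrow> convolution G f g x = 0"
  unfolding convolution_def
  by (rule infsum_0) (auto simp: composable_def)

text \<open>The pairs with product \<open>x\<close> are parametrized by their first entry, an arbitrary element of
  the range fibre of \<open>x\<close>, and equally by their second entry, an arbitrary element of the source
  fibre.\<close>

lemma convolution_over_range:
  assumes "x \<in> elts G"
  shows "convolution G f g x =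
    (\<Sum>\<^sub>\<infinity>y\<in>{y \<in> elts G. gran G y = gran G x}. f y * g (gmul G (ginv G y) x))"
proof -
  have "bij_betw (\<lambda>y. (y, gmul G (ginv G y) x)) {y \<in> elts G. gran G y = gran G x}
      {(y, z) \<in> composable G. gmul G y z = x}"
    by (rule bij_betwI[where g = fst]) (use assms in \<open>auto\<close>)
  from infsum_reindex_bij_betw[OF this, of "\<lambda>(y, z). f y * g z"]
  show ?thesis unfolding convolution_def by simp
qed

lemma convolution_over_source:
  assumes "x \<in> elts G"
  shows "convolution G f g x =
    (\<Sum>\<^sub>\<infinity>z\<in>source_fibre G (gsrc G x). f (gmul G x (ginv G z)) * g z)"
proof -
  have "bij_betw (\<lambda>z. (gmul G x (ginv G z), z)) (source_fibre G (gsrc G x))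
      {(y, z) \<in> composable G. gmul G y z = x}"
    by (rule bij_betwI[where g = snd]) (use assms in \<open>auto simp: source_fibre_def\<close>)
  from infsum_reindex_bij_betw[OF this, of "\<lambda>(y, z). f y * g z"]
  show ?thesis unfolding convolution_def by simp
qed

lemma infsum_eq_finite_sum:
  fixes h :: "'c \<Rightarrow> complex"
  assumes "finite E" "E \<subseteq> X" "\<And>y. y \<in> X - E \<Longrightarrow> h y = 0"
  shows "infsum h X = sum h E"
proof -
  have "infsum h X = infsum h E"
    by (rule infsum_cong_neutral) (use assms in auto)
  then show ?thesis using assms by simp
qed

lemma convolution_range_sum:
  assumes "x \<in> elts G" "finite E" "E \<subseteq> {y \<in> elts G. gran G y = gran G x}"
    and "\<And>y. y \<in> elts G \<Longrightarrow> gran G y = gran G x \<Longrightarrow> y \<notin> E \<Longrightarrow> f y * g (gmul G (ginv G y) x) = 0"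
  shows "convolution G f g x = (\<Sum>y\<in>E. f y * g (gmul G (ginv G y) x))"
  unfolding convolution_over_range[OF assms(1)]
  by (rule infsum_eq_finite_sum) (use assms in auto)

lemma convolution_source_sum:
  assumes "x \<in> elts G" "finite E" "E \<subseteq> source_fibre G (gsrc G x)"
    and "\<And>z. z \<in> elts G \<Longrightarrow> gsrc G z = gsrc G x \<Longrightarrow> z \<notin> E \<Longrightarrow> f (gmul G x (ginv G z)) * g z = 0"
  shows "convolution G f g x = (\<Sum>z\<in>E. f (gmul G x (ginv G z)) * g z)"
  unfolding convolution_over_source[OF assms(1)]
  by (rule infsum_eq_finite_sum) (use assms in \<open>auto simp: source_fibre_def\<close>)

lemma convolution_nonzeroE:
  assumes "convolution G f g x \<noteq> 0"
  obtains y z where "y \<in> elts G" "z \<in> elts G" "gsrc G y = gran G z" "x = gmul G y z"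
    "f y \<noteq> 0" "g z \<noteq> 0"
proof -
  have "\<exists>y z. (y, z) \<in> composable G \<and> gmul G y z = x \<and> f y * g z \<noteq> 0"
  proof (rule ccontr)
    assume "\<not> ?thesis"
    then have "convolution G f g x = 0"
      unfolding convolution_def by (intro infsum_0) auto
    with assms show False by simp
  qed
  then show ?thesis using that by auto
qed

text \<open>This is the finiteness that makes all convolutions finite sums. It is weaker than finite support
  and is shared by all functions supported in finitely many bisections.\<close>

definition fibre_finite :: "('g \<Rightarrow> complex) \<Rightarrow> bool"
  where "fibre_finite f \<longleftrightarrow> (\<forall>x. f x \<noteq> 0 \<longrightarrow> x \<in> elts G) \<and>
    (\<forall>u. finite {x. f x \<noteq> 0 \<and> gran G x = u} \<and> finite {x. f x \<noteq> 0 \<and> gsrc G x = u})"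

lemma fibre_finiteD:
  assumes "fibre_finite f"
  shows "f x \<noteq> 0 \<Longrightarrow> x \<in> elts G" "finite {x. f x \<noteq> 0 \<and> gran G x = u}"
    "finite {x. f x \<noteq> 0 \<and> gsrc G x = u}"
  using assms unfolding fibre_finite_def by auto

lemma fibre_finite_zero: "fibre_finite (\<lambda>x. 0)"
  by (simp add: fibre_finite_def)

lemma fibre_finite_add:
  assumes "fibre_finite f" "fibre_finite g"
  shows "fibre_finite (\<lambda>x. f x + g x)"
proof -
  have "finite {x. f x + g x \<noteq> 0 \<and> gran G x = u}" for u
    by (rule finite_subset[of _ "{x. f x \<noteq> 0 \<and> gran G x = u} \<union> {x. g x \<noteq> 0 \<and> gran G x = u}"])
      (use assms fibre_finiteD in auto)
  moreover have "finite {x. f x + g x \<noteq> 0 \<and> gsrc G x = u}" for u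
    by (rule finite_subset[of _ "{x. f x \<noteq> 0 \<and> gsrc G x = u} \<union> {x. g x \<noteq> 0 \<and> gsrc G x = u}"])
      (use assms fibre_finiteD in auto)
  moreover have "x \<in> elts G" if "f x + g x \<noteq> 0" for x
  proof -
    have "f x \<noteq> 0 \<or> g x \<noteq> 0" using that by auto
    then show ?thesis using assms fibre_finiteD(1) by blast
  qed
  ultimately show ?thesis unfolding fibre_finite_def by blast
qed

lemma fibre_finite_scale:
  assumes "fibre_finite f"
  shows "fibre_finite (\<lambda>x. k * f x)"
proof (cases "k = 0")
  case False
  then have "{x. k * f x \<noteq> 0 \<and> P x} = {x. f x \<noteq> 0 \<and> P x}" for P by auto
  then show ?thesis using assms False unfolding fibre_finite_def by auto
qed (simp add: fibre_finite_zero)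

lemma fibre_finite_involution:
  assumes "fibre_finite f"
  shows "fibre_finite (involution G f)"
proof -
  have "finite {x. involution G f x \<noteq> 0 \<and> gran G x = u}" for u
    by (rule finite_subset[OF _ finite_imageI[OF fibre_finiteD(3)[OF assms, of u], of "ginv G"]])
      (force simp: involution_def image_iff split: if_splits intro: inv_inv[symmetric])
  moreover have "finite {x. involution G f x \<noteq> 0 \<and> gsrc G x = u}" for u
    by (rule finite_subset[OF _ finite_imageI[OF fibre_finiteD(2)[OF assms, of u], of "ginv G"]])
      (force simp: involution_def image_iff split: if_splits intro: inv_inv[symmetric])
  ultimately show ?thesis unfolding fibre_finite_def by (auto simp: involution_def)
qed

lemma fibre_finite_convolution:
  assumes f: "fibre_finite f" and g: "fibre_finite g"
  shows "fibre_finite (convolution G f g)"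
proof -
  have "finite {x. convolution G f g x \<noteq> 0 \<and> gran G x = u}" for u
  proof (rule finite_subset)
    let ?Y = "{x. f x \<noteq> 0 \<and> gran G x = u}"
    show "{x. convolution G f g x \<noteq> 0 \<and> gran G x = u}
      \<subseteq> (\<Union>y\<in>?Y. gmul G y ` {z. g z \<noteq> 0 \<and> gran G z = gsrc G y})"
      by (auto elim!: convolution_nonzeroE)
  qed (use fibre_finiteD[OF f] fibre_finiteD[OF g] in auto)
  moreover have "finite {x. convolution G f g x \<noteq> 0 \<and> gsrc G x = u}" for u
  proof (rule finite_subset)
    let ?Z = "{x. g x \<noteq> 0 \<and> gsrc G x = u}"
    show "{x. convolution G f g x \<noteq> 0 \<and> gsrc G x = u}
      \<subseteq> (\<Union>z\<in>?Z. (\<lambda>y. gmul G y z) ` {y. f y \<noteq> 0 \<and> gsrc G y = gran G z})"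
      by (auto elim!: convolution_nonzeroE)
  qed (use fibre_finiteD[OF f] fibre_finiteD[OF g] in auto)
  ultimately show ?thesis
    unfolding fibre_finite_def using convolution_outside by blast
qed

lemma convolution_support_sum:
  assumes "fibre_finite f" "x \<in> elts G" "finite E" "E \<subseteq> {y \<in> elts G. gran G y = gran G x}"
    "{y. f y \<noteq> 0 \<and> gran G y = gran G x} \<subseteq> E"
  shows "convolution G f g x = (\<Sum>y\<in>E. f y * g (gmul G (ginv G y) x))"
  by (rule convolution_range_sum) (use assms in auto)

lemma convolution_support_sum':
  assumes "fibre_finite f" "x \<in> elts G"
  shows "convolution G f g x =
    (\<Sum>y\<in>{y. f y \<noteq> 0 \<and> gran G y = gran G x}. f y * g (gmul G (ginv G y) x))"
  by (rule convolution_support_sum) (use assms fibre_finiteD[OF assms(1)] in auto)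

lemma convolution_add_left:
  assumes "fibre_finite f" "fibre_finite g"
  shows "convolution G (\<lambda>x. f x + g x) h = (\<lambda>x. convolution G f h x + convolution G g h x)"
proof
  fix x
  show "convolution G (\<lambda>x. f x + g x) h x = convolution G f h x + convolution G g h x"
  proof (cases "x \<in> elts G")
    case True
    let ?E = "{y. f y \<noteq> 0 \<and> gran G y = gran G x} \<union> {y. g y \<noteq> 0 \<and> gran G y = gran G x}"
    have E: "finite ?E" "?E \<subseteq> {y \<in> elts G. gran G y = gran G x}"
      using assms fibre_finiteD by auto
    have "convolution G (\<lambda>x. f x + g x) h x = (\<Sum>y\<in>?E. (f y + g y) * h (gmul G (ginv G y) x))"
      by (rule convolution_support_sum) (use assms True E in \<open>auto simp: fibre_finite_add\<close>)
    moreover have "convolution G f h x = (\<Sum>y\<in>?E. f y * h (gmul G (ginv G y) x))"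
      by (rule convolution_support_sum) (use assms True E in auto)
    moreover have "convolution G g h x = (\<Sum>y\<in>?E. g y * h (gmul G (ginv G y) x))"
      by (rule convolution_support_sum) (use assms True E in auto)
    ultimately show ?thesis by (simp add: distrib_right sum.distrib)
  qed (simp add: convolution_outside)
qed

lemma convolution_add_right:
  assumes "fibre_finite f"
  shows "convolution G f (\<lambda>x. g x + h x) = (\<lambda>x. convolution G f g x + convolution G f h x)"
proof
  fix x
  show "convolution G f (\<lambda>x. g x + h x) x = convolution G f g x + convolution G f h x"
    by (cases "x \<in> elts G")
      (simp_all add: convolution_outside convolution_support_sum'[OF assms] distrib_left sum.distrib)
qed

lemma convolution_scale_left: "convolution G (\<lambda>x. k * f x) h = (\<lambda>x. k * convolution G f h x)"
  unfolding convolution_def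
  by (simp add: infsum_cmult_right'[symmetric] case_prod_unfold mult.assoc)

lemma convolution_scale_right: "convolution G f (\<lambda>x. k * h x) = (\<lambda>x. k * convolution G f h x)"
  unfolding convolution_def
  by (simp add: infsum_cmult_right'[symmetric] case_prod_unfold mult.left_commute)

lemma convolution_zero [simp]:
  "convolution G (\<lambda>x. 0) f = (\<lambda>x. 0)" "convolution G f (\<lambda>x. 0) = (\<lambda>x. 0)"
  unfolding convolution_def by (simp_all add: case_prod_unfold)

text \<open>The third factor is arbitrary, so that the law also says that convolution operators multiply:
  it will be applied with a vector of \<open>\<ell>\<^sup>2\<close> in the last place.\<close>

lemma convolution_assoc:
  assumes f: "fibre_finite f" and g: "fibre_finite g"
  shows "convolution G (convolution G f g) h = convolution G f (convolution G g h)"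
proof
  fix x
  show "convolution G (convolution G f g) h x = convolution G f (convolution G g h) x"
  proof (cases "x \<in> elts G")
    case x: True
    \<comment> \<open>Only factorizations \<open>x = z w v\<close> with \<open>z \<in> Z\<close> and \<open>w \<in> W z\<close> contribute; \<open>E\<close> collects the
      finitely many products \<open>z w\<close>.\<close>
    define Z where "Z = {z. f z \<noteq> 0 \<and> gran G z = gran G x}"
    define W where "W z = {w. g w \<noteq> 0 \<and> gran G w = gsrc G z}" for z
    define E where "E = (\<Union>z\<in>Z. gmul G z ` W z)"
    have Z: "z \<in> elts G" "gran G z = gran G x" if "z \<in> Z" for z
      using that fibre_finiteD[OF f] unfolding Z_def by auto
    have W: "w \<in> elts G" "gran G w = gsrc G z" if "w \<in> W z" for w z
      using that fibre_finiteD[OF g] unfolding W_def by auto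
    have fin: "finite Z" "finite (W z)" "finite E" for z
      using fibre_finiteD[OF f] fibre_finiteD[OF g] unfolding Z_def W_def E_def by auto
    have E: "y \<in> elts G" "gran G y = gran G x" if "y \<in> E" for y
      using that Z W unfolding E_def by auto
    have "convolution G (convolution G f g) h x =
        (\<Sum>y\<in>E. convolution G f g y * h (gmul G (ginv G y) x))"
    proof (rule convolution_support_sum)
      show "{y. convolution G f g y \<noteq> 0 \<and> gran G y = gran G x} \<subseteq> E"
      proof clarify
        fix y assume "convolution G f g y \<noteq> 0" "gran G y = gran G x"
        then obtain z w where "z \<in> elts G" "w \<in> elts G" "gsrc G z = gran G w" "y = gmul G z w"
          "f z \<noteq> 0" "g w \<noteq> 0" by (elim convolution_nonzeroE)
        then show "y \<in> E" using \<open>gran G y = gran G x\<close> unfolding E_def Z_def W_def by auto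
      qed
    qed (use x E fin fibre_finite_convolution[OF f g] in auto)
    also have "\<dots> = (\<Sum>y\<in>E. \<Sum>z\<in>Z. f z * (g (gmul G (ginv G z) y) * h (gmul G (ginv G y) x)))"
    proof (rule sum.cong[OF refl])
      fix y assume y: "y \<in> E"
      show "convolution G f g y * h (gmul G (ginv G y) x) =
          (\<Sum>z\<in>Z. f z * (g (gmul G (ginv G z) y) * h (gmul G (ginv G y) x)))"
        using convolution_support_sum'[OF f E(1)[OF y], of g] E(2)[OF y]
        by (simp add: Z_def sum_distrib_right mult.assoc)
    qed
    also have "\<dots> = (\<Sum>z\<in>Z. f z * (\<Sum>y\<in>E. g (gmul G (ginv G z) y) * h (gmul G (ginv G y) x)))"
      by (subst sum.swap) (simp add: sum_distrib_left)
    also have "\<dots> = (\<Sum>z\<in>Z. f z * convolution G g h (gmul G (ginv G z) x))"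
    proof (rule sum.cong[OF refl], rule arg_cong[where f = "\<lambda>t. _ * t"])
      fix z assume z: "z \<in> Z"
      have "(\<Sum>y\<in>E. g (gmul G (ginv G z) y) * h (gmul G (ginv G y) x)) =
          (\<Sum>y\<in>gmul G z ` W z. g (gmul G (ginv G z) y) * h (gmul G (ginv G y) x))"
      proof (rule sum.mono_neutral_right)
        show "\<forall>y\<in>E - gmul G z ` W z. g (gmul G (ginv G z) y) * h (gmul G (ginv G y) x) = 0"
        proof
          fix y assume y: "y \<in> E - gmul G z ` W z"
          have "y = gmul G z (gmul G (ginv G z) y)" using y z Z E by simp
          then have "gmul G (ginv G z) y \<notin> W z" using y by blast
          then show "g (gmul G (ginv G z) y) * h (gmul G (ginv G y) x) = 0"
            using y z Z E unfolding W_def by simp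
        qed
      qed (use fin z in \<open>auto simp: E_def\<close>)
      also have "\<dots> = (\<Sum>w\<in>W z. g w * h (gmul G (ginv G (gmul G z w)) x))"
      proof (subst sum.reindex)
        show "inj_on (gmul G z) (W z)"
          by (rule inj_onI) (use z Z W left_cancel[of z] in auto)
      qed (use z Z W in \<open>simp add: o_def\<close>)
      also have "\<dots> = (\<Sum>w\<in>W z. g w * h (gmul G (ginv G w) (gmul G (ginv G z) x)))"
        using z Z W x by (intro sum.cong refl) (simp add: inv_prod assoc)
      also have "\<dots> = convolution G g h (gmul G (ginv G z) x)"
        using convolution_support_sum'[OF g, of "gmul G (ginv G z) x" h] z Z x
        by (simp add: W_def)
      finally show "(\<Sum>y\<in>E. g (gmul G (ginv G z) y) * h (gmul G (ginv G y) x)) =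
        convolution G g h (gmul G (ginv G z) x)" .
    qed
    also have "\<dots> = convolution G f (convolution G g h) x"
      using convolution_support_sum'[OF f x] by (simp add: Z_def)
    finally show ?thesis .
  qed (simp add: convolution_outside)
qed

lemma involution_involution:
  assumes "\<And>x. f x \<noteq> 0 \<Longrightarrow> x \<in> elts G"
  shows "involution G (involution G f) = f"
  using assms by (auto simp: involution_def fun_eq_iff)

lemma involution_add: "involution G (\<lambda>x. f x + g x) = (\<lambda>x. involution G f x + involution G g x)"
  by (auto simp: involution_def fun_eq_iff)

lemma involution_scale: "involution G (\<lambda>x. k * f x) = (\<lambda>x. cnj k * involution G f x)"
  by (auto simp: involution_def fun_eq_iff)

lemma involution_convolution:
  "involution G (convolution G f g) = convolution G (involution G g) (involution G f)"
proof
  fix x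
  show "involution G (convolution G f g) x = convolution G (involution G g) (involution G f) x"
  proof (cases "x \<in> elts G")
    case True
    have "cnj (convolution G f g (ginv G x)) =
      (\<Sum>\<^sub>\<infinity>y\<in>{y \<in> elts G. gran G y = gsrc G x}. cnj (f y) * cnj (g (gmul G (ginv G y) (ginv G x))))"
      using True by (simp add: convolution_over_range flip: infsum_cnj)
    also have "\<dots> = (\<Sum>\<^sub>\<infinity>z\<in>source_fibre G (gsrc G x).
        involution G g (gmul G x (ginv G z)) * involution G f z)"
    proof -
      have "bij_betw (ginv G) (source_fibre G (gsrc G x)) {y \<in> elts G. gran G y = gsrc G x}"
        by (rule bij_betwI[where g = "ginv G"]) (auto simp: source_fibre_def)
      from infsum_reindex_bij_betw[OF this, of "\<lambda>y. cnj (f y) * cnj (g (gmul G (ginv G y) (ginv G x)))"]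
      have "(\<Sum>\<^sub>\<infinity>y\<in>{y \<in> elts G. gran G y = gsrc G x}. cnj (f y) * cnj (g (gmul G (ginv G y) (ginv G x)))) =
        (\<Sum>\<^sub>\<infinity>z\<in>source_fibre G (gsrc G x).
          cnj (f (ginv G z)) * cnj (g (gmul G (ginv G (ginv G z)) (ginv G x))))" by simp
      also have "\<dots> = (\<Sum>\<^sub>\<infinity>z\<in>source_fibre G (gsrc G x).
          involution G g (gmul G x (ginv G z)) * involution G f z)"
        by (rule infsum_cong)
          (use True in \<open>auto simp: source_fibre_def involution_def inv_prod mult.commute\<close>)
      finally show ?thesis .
    qed
    also have "\<dots> = convolution G (involution G g) (involution G f) x"
      using convolution_over_source[OF True] by simp
    finally show ?thesis using True by (simp add: involution_def)
  qed (simp add: convolution_outside involution_def)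
qed

end

section \<open>Convolution operators on square-summable functions\<close>

text \<open>The norm and inner product of \<open>\<ell>\<^sup>2\<close> on finitely supported functions, where they are finite
  sums. All estimates are made there and carried over to \<open>\<ell>\<^sup>2\<close> by truncation.\<close>

definition fnorm :: "('a \<Rightarrow> complex) \<Rightarrow> real"
  where "fnorm \<xi> = L2_set (\<lambda>x. cmod (\<xi> x)) {x. \<xi> x \<noteq> 0}"

definition finner :: "('a \<Rightarrow> complex) \<Rightarrow> ('a \<Rightarrow> complex) \<Rightarrow> complex"
  where "finner \<xi> \<eta> = (\<Sum>x | \<xi> x \<noteq> 0. \<xi> x * cnj (\<eta> x))"

lemma fnorm_eq:
  assumes "finite E" "{x. \<xi> x \<noteq> 0} \<subseteq> E"
  shows "fnorm \<xi> = L2_set (\<lambda>x. cmod (\<xi> x)) E"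
  unfolding fnorm_def L2_set_def
  by (rule arg_cong[where f = sqrt], rule sum.mono_neutral_left) (use assms in auto)

lemma finner_eq:
  assumes "finite E" "{x. \<xi> x \<noteq> 0} \<subseteq> E"
  shows "finner \<xi> \<eta> = (\<Sum>x\<in>E. \<xi> x * cnj (\<eta> x))"
  unfolding finner_def
  by (rule sum.mono_neutral_left) (use assms in auto)

lemma fnorm_nonneg [simp]: "0 \<le> fnorm \<xi>"
  by (simp add: fnorm_def)

lemma finner_self:
  assumes "finite {x. \<xi> x \<noteq> 0}"
  shows "finner \<xi> \<xi> = complex_of_real ((fnorm \<xi>)\<^sup>2)"
  unfolding finner_def fnorm_def L2_set_def
  by (simp add: sum_nonneg complex_norm_square flip: of_real_power)

lemma cauchy_schwarz:
  assumes "finite {x. \<xi> x \<noteq> 0}" "finite {x. \<eta> x \<noteq> 0}"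
  shows "cmod (finner \<xi> \<eta>) \<le> fnorm \<xi> * fnorm \<eta>"
proof -
  let ?E = "{x. \<xi> x \<noteq> 0} \<union> {x. \<eta> x \<noteq> 0}"
  have E: "finite ?E" using assms by simp
  have "cmod (finner \<xi> \<eta>) = cmod (\<Sum>x\<in>?E. \<xi> x * cnj (\<eta> x))"
    by (subst finner_eq[OF E]) auto
  also have "\<dots> \<le> (\<Sum>x\<in>?E. cmod (\<xi> x) * cmod (\<eta> x))"
    by (rule order_trans[OF norm_sum]) (simp add: norm_mult)
  also have "\<dots> \<le> L2_set (\<lambda>x. cmod (\<xi> x)) ?E * L2_set (\<lambda>x. cmod (\<eta> x)) ?E"
    using L2_set_mult_ineq[of "\<lambda>x. cmod (\<xi> x)" "\<lambda>x. cmod (\<eta> x)" ?E] by simp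
  also have "\<dots> = fnorm \<xi> * fnorm \<eta>"
    by (simp add: fnorm_eq[OF E])
  finally show ?thesis .
qed

lemma fnorm_triangle:
  assumes "finite {x. \<xi> x \<noteq> 0}" "finite {x. \<eta> x \<noteq> 0}"
  shows "fnorm (\<lambda>x. \<xi> x + \<eta> x) \<le> fnorm \<xi> + fnorm \<eta>"
proof -
  let ?E = "{x. \<xi> x \<noteq> 0} \<union> {x. \<eta> x \<noteq> 0}"
  have E: "finite ?E" using assms by simp
  have "fnorm (\<lambda>x. \<xi> x + \<eta> x) = L2_set (\<lambda>x. cmod (\<xi> x + \<eta> x)) ?E"
    by (rule fnorm_eq[OF E]) auto
  also have "\<dots> \<le> L2_set (\<lambda>x. cmod (\<xi> x) + cmod (\<eta> x)) ?E"
    by (rule L2_set_mono) (auto simp: norm_triangle_ineq)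
  also have "\<dots> \<le> L2_set (\<lambda>x. cmod (\<xi> x)) ?E + L2_set (\<lambda>x. cmod (\<eta> x)) ?E"
    by (rule L2_set_triangle_ineq)
  also have "\<dots> = fnorm \<xi> + fnorm \<eta>"
    by (simp add: fnorm_eq[OF E])
  finally show ?thesis .
qed

lemma fnorm_scale: "fnorm (\<lambda>x. k * \<xi> x) = cmod k * fnorm \<xi>"
proof (cases "k = 0")
  case False
  then show ?thesis
    by (simp add: fnorm_def norm_mult L2_set_right_distrib)
qed (simp add: fnorm_def)

lemma fnorm_eq_0_iff:
  assumes "finite {x. \<xi> x \<noteq> 0}"
  shows "fnorm \<xi> = 0 \<longleftrightarrow> \<xi> = (\<lambda>x. 0)"
  using assms by (auto simp: fnorm_def L2_set_eq_0_iff)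

lemma coefficient_le_fnorm:
  assumes "finite {x. \<xi> x \<noteq> 0}"
  shows "cmod (\<xi> x) \<le> fnorm \<xi>"
proof (cases "\<xi> x = 0")
  case False
  then show ?thesis
    unfolding fnorm_def using assms by (intro member_le_L2_set) auto
qed simp

lemma fnorm_indicator: "fnorm (indicator {x}) = 1"
  by (subst fnorm_eq[of "{x}"]) (auto simp: indicator_def L2_set_def)

lemma le_from_square_le:
  fixes a b :: real
  assumes "a\<^sup>2 \<le> b * a" "0 \<le> a" "0 \<le> b"
  shows "a \<le> b"
  using assms by (cases "a = 0") (auto simp: power2_eq_square)

lemma ell2_norm_finite_support:
  assumes "finite {x. \<xi> x \<noteq> 0}" "{x. \<xi> x \<noteq> 0} \<subseteq> X"
  shows "\<xi> \<in> ell2 X" "ell2_norm X \<xi> = fnorm \<xi>"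
proof -
  have s: "((\<lambda>x. (cmod (\<xi> x))\<^sup>2) has_sum (\<Sum>x | \<xi> x \<noteq> 0. (cmod (\<xi> x))\<^sup>2)) X"
    by (rule has_sum_finite_neutralI) (use assms in auto)
  then show "\<xi> \<in> ell2 X" using assms unfolding ell2_def summable_on_def by auto
  show "ell2_norm X \<xi> = fnorm \<xi>"
    using infsumI[OF s] by (simp add: ell2_norm_def fnorm_def L2_set_def)
qed

lemma ell2_norm_bound:
  assumes "\<And>F. finite F \<Longrightarrow> F \<subseteq> X \<Longrightarrow> L2_set (\<lambda>x. cmod (\<xi> x)) F \<le> M"
    and "\<And>x. x \<notin> X \<Longrightarrow> \<xi> x = 0" and M: "0 \<le> M"
  shows "\<xi> \<in> ell2 X" "ell2_norm X \<xi> \<le> M"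
proof -
  have b: "(\<Sum>x\<in>F. (cmod (\<xi> x))\<^sup>2) \<le> M\<^sup>2" if "finite F" "F \<subseteq> X" for F
    using sqrt_le_D[OF assms(1)[OF that, unfolded L2_set_def]] .
  have s: "(\<lambda>x. (cmod (\<xi> x))\<^sup>2) summable_on X"
    by (rule nonneg_bdd_above_summable_on) (auto intro!: bdd_aboveI2[where M = "M\<^sup>2"] b)
  then show "\<xi> \<in> ell2 X" using assms unfolding ell2_def by auto
  have "(\<Sum>\<^sub>\<infinity>x\<in>X. (cmod (\<xi> x))\<^sup>2) \<le> M\<^sup>2"
    by (rule infsum_le_finite_sums[OF s]) (use b in auto)
  then show "ell2_norm X \<xi> \<le> M"
    unfolding ell2_norm_def using M real_le_lsqrt real_sqrt_le_mono real_sqrt_abs abs_of_nonneg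
    by metis
qed

lemma finite_part_le_ell2_norm:
  assumes "\<xi> \<in> ell2 X" "finite F" "F \<subseteq> X"
  shows "L2_set (\<lambda>x. cmod (\<xi> x)) F \<le> ell2_norm X \<xi>"
  unfolding L2_set_def ell2_norm_def
  using assms by (intro real_sqrt_le_mono finite_sum_le_infsum) (auto simp: ell2_def)

context algebraic_groupoid
begin

definition fvec :: "'g \<Rightarrow> ('g \<Rightarrow> complex) set"
  where "fvec u = {\<xi>. finite {x. \<xi> x \<noteq> 0} \<and> {x. \<xi> x \<noteq> 0} \<subseteq> source_fibre G u}"

text \<open>\<open>M\<close> bounds the norm of \<open>\<lambda>\<^sub>u(f)\<close> for every unit \<open>u\<close>, tested on finitely supported vectors.\<close>

definition opbound :: "('g \<Rightarrow> complex) \<Rightarrow> real \<Rightarrow> bool"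
  where "opbound f M \<longleftrightarrow> 0 \<le> M \<and>
    (\<forall>u\<in>gunits G. \<forall>\<xi>\<in>fvec u. fnorm (convolution G f \<xi>) \<le> M * fnorm \<xi>)"

text \<open>Convolvers form a *-algebra of functions on which the reduced norm behaves. It contains \<open>C\<^sub>c(G)\<close>, but
  is defined without reference to the topology.\<close>

definition convolver :: "('g \<Rightarrow> complex) \<Rightarrow> bool"
  where "convolver f \<longleftrightarrow> fibre_finite f \<and> (\<exists>M. opbound f M)"

lemma fvecD:
  assumes "\<xi> \<in> fvec u"
  shows "finite {x. \<xi> x \<noteq> 0}" "\<xi> x \<noteq> 0 \<Longrightarrow> x \<in> elts G" "\<xi> x \<noteq> 0 \<Longrightarrow> gsrc G x = u"
  using assms unfolding fvec_def source_fibre_def by auto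

lemma fvec_fibre_finite: "\<xi> \<in> fvec u \<Longrightarrow> fibre_finite \<xi>"
  unfolding fibre_finite_def by (auto dest: fvecD)

lemma fvec_scale: "\<xi> \<in> fvec u \<Longrightarrow> (\<lambda>x. k * \<xi> x) \<in> fvec u"
  unfolding fvec_def by (auto elim: rev_finite_subset)

lemma indicator_fvec:
  assumes "x \<in> elts G"
  shows "indicator {x} \<in> fvec (gsrc G x)"
proof -
  have "{y. indicator {x} y \<noteq> (0::complex)} = {x}" by (auto simp: indicator_def)
  then show ?thesis using assms by (auto simp: fvec_def source_fibre_def)
qed

lemma convolution_fvec:
  assumes f: "fibre_finite f" and \<xi>: "\<xi> \<in> fvec u"
  shows "convolution G f \<xi> \<in> fvec u"
proof -
  have src: "gsrc G x = u" if "convolution G f \<xi> x \<noteq> 0" for x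
    using that \<xi> by (elim convolution_nonzeroE) (auto dest: fvecD)
  then have "{x. convolution G f \<xi> x \<noteq> 0} = {x. convolution G f \<xi> x \<noteq> 0 \<and> gsrc G x = u}" by auto
  moreover have ff: "fibre_finite (convolution G f \<xi>)"
    by (rule fibre_finite_convolution[OF f fvec_fibre_finite[OF \<xi>]])
  ultimately have "finite {x. convolution G f \<xi> x \<noteq> 0}"
    using fibre_finiteD(3)[OF ff, of u] by simp
  then show ?thesis
    using src fibre_finiteD(1)[OF ff] unfolding fvec_def source_fibre_def by auto
qed

lemma convolution_indicator:
  assumes "x \<in> elts G" "z \<in> elts G" "gsrc G z = gsrc G x"
  shows "convolution G f (indicator {x}) z = f (gmul G z (ginv G x))"
  by (subst convolution_source_sum[of z "{x}"]) (use assms in \<open>auto simp: source_fibre_def\<close>)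

lemma opboundD:
  assumes "opbound f M" "u \<in> gunits G" "\<xi> \<in> fvec u"
  shows "fnorm (convolution G f \<xi>) \<le> M * fnorm \<xi>"
  using assms unfolding opbound_def by auto

lemma opbound_nonneg: "opbound f M \<Longrightarrow> 0 \<le> M"
  unfolding opbound_def by auto

lemma opbound_add:
  assumes "fibre_finite f" "fibre_finite g" "opbound f M" "opbound g N"
  shows "opbound (\<lambda>x. f x + g x) (M + N)"
  unfolding opbound_def
proof (intro conjI ballI)
  fix u \<xi> assume u: "u \<in> gunits G" and \<xi>: "\<xi> \<in> fvec u"
  have "fnorm (convolution G (\<lambda>x. f x + g x) \<xi>)
      = fnorm (\<lambda>x. convolution G f \<xi> x + convolution G g \<xi> x)"
    using assms by (simp add: convolution_add_left)
  also have "\<dots> \<le> fnorm (convolution G f \<xi>) + fnorm (convolution G g \<xi>)"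
    by (rule fnorm_triangle) (use convolution_fvec[OF _ \<xi>] assms fvecD in blast)+
  also have "\<dots> \<le> M * fnorm \<xi> + N * fnorm \<xi>"
    using assms opboundD u \<xi> by (meson add_mono)
  finally show "fnorm (convolution G (\<lambda>x. f x + g x) \<xi>) \<le> (M + N) * fnorm \<xi>"
    by (simp add: distrib_right)
qed (use assms opbound_nonneg in simp)

lemma opbound_scale:
  assumes "opbound f M"
  shows "opbound (\<lambda>x. k * f x) (cmod k * M)"
  using assms unfolding opbound_def
  by (auto simp: convolution_scale_left fnorm_scale mult.assoc intro!: mult_left_mono)

lemma opbound_zero: "opbound (\<lambda>x. 0) 0"
  unfolding opbound_def by (simp add: fnorm_def)

lemma opbound_convolution:
  assumes "fibre_finite f" "fibre_finite g" "opbound f M" "opbound g N"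
  shows "opbound (convolution G f g) (M * N)"
  unfolding opbound_def
proof (intro conjI ballI)
  fix u \<xi> assume u: "u \<in> gunits G" and \<xi>: "\<xi> \<in> fvec u"
  have "fnorm (convolution G (convolution G f g) \<xi>) \<le> M * fnorm (convolution G g \<xi>)"
    using opboundD[OF assms(3) u convolution_fvec[OF assms(2) \<xi>]]
    by (simp add: convolution_assoc assms)
  also have "\<dots> \<le> M * (N * fnorm \<xi>)"
    using opboundD[OF assms(4) u \<xi>] opbound_nonneg[OF assms(3)] by (simp add: mult_left_mono)
  finally show "fnorm (convolution G (convolution G f g) \<xi>) \<le> M * N * fnorm \<xi>" by simp
qed (use assms opbound_nonneg in simp)

text \<open>Both sides are the finite double sum of \<open>f(z x\<^sup>-\<^sup>1) \<xi>(x) \<eta>(z)\<close> with the last factor conjugated,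
  because \<open>f(z x\<^sup>-\<^sup>1)\<close> is the conjugate of \<open>f\<^sup>*(x z\<^sup>-\<^sup>1)\<close>.\<close>

lemma convolution_adjoint:
  assumes f: "fibre_finite f" and \<xi>: "\<xi> \<in> fvec u" and \<eta>: "\<eta> \<in> fvec u"
  shows "finner (convolution G f \<xi>) \<eta> = finner \<xi> (convolution G (involution G f) \<eta>)"
proof -
  define E where "E = {x. \<xi> x \<noteq> 0} \<union> {x. \<eta> x \<noteq> 0} \<union> {x. convolution G f \<xi> x \<noteq> 0}"
  have E: "finite E" "x \<in> E \<Longrightarrow> x \<in> elts G" "x \<in> E \<Longrightarrow> gsrc G x = u" for x
    using fvecD[OF \<xi>] fvecD[OF \<eta>] fvecD[OF convolution_fvec[OF f \<xi>]] unfolding E_def by auto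
  have sub: "{x. convolution G f \<xi> x \<noteq> 0} \<subseteq> E" "{x. \<xi> x \<noteq> 0} \<subseteq> E" by (auto simp: E_def)
  have c: "convolution G h \<zeta> z = (\<Sum>x\<in>E. h (gmul G z (ginv G x)) * \<zeta> x)"
    if "z \<in> E" "\<zeta> \<in> {\<xi>, \<eta>}" for h \<zeta> z
    by (rule convolution_source_sum) (use E that in \<open>auto simp: E_def source_fibre_def\<close>)
  have "finner (convolution G f \<xi>) \<eta> = (\<Sum>z\<in>E. (\<Sum>x\<in>E. f (gmul G z (ginv G x)) * \<xi> x) * cnj (\<eta> z))"
    unfolding finner_eq[OF E(1) sub(1)] by (rule sum.cong[OF refl]) (simp add: c)
  also have "\<dots> = (\<Sum>x\<in>E. \<Sum>z\<in>E. f (gmul G z (ginv G x)) * \<xi> x * cnj (\<eta> z))"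
    by (subst sum.swap) (simp add: sum_distrib_right)
  also have "\<dots> = (\<Sum>x\<in>E. \<xi> x * cnj (\<Sum>z\<in>E. involution G f (gmul G x (ginv G z)) * \<eta> z))"
    using E by (intro sum.cong refl)
      (simp add: sum_distrib_left involution_def inv_prod mult_ac)
  also have "\<dots> = finner \<xi> (convolution G (involution G f) \<eta>)"
    unfolding finner_eq[OF E(1) sub(2)] by (rule sum.cong[OF refl]) (simp add: c)
  finally show ?thesis .
qed

text \<open>From \<open>\<parallel>f\<^sup>* \<xi>\<parallel>\<^sup>2 = \<langle>f f\<^sup>* \<xi>, \<xi>\<rangle> \<le> M \<parallel>f\<^sup>* \<xi>\<parallel> \<parallel>\<xi>\<parallel>\<close>.\<close>

lemma opbound_involution:
  assumes f: "fibre_finite f" and M: "opbound f M"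
  shows "opbound (involution G f) M"
  unfolding opbound_def
proof (intro conjI ballI)
  fix u \<xi> assume u: "u \<in> gunits G" and \<xi>: "\<xi> \<in> fvec u"
  let ?\<eta> = "convolution G (involution G f) \<xi>"
  have \<eta>: "?\<eta> \<in> fvec u" by (rule convolution_fvec[OF fibre_finite_involution[OF f] \<xi>])
  have "complex_of_real ((fnorm ?\<eta>)\<^sup>2) = finner (convolution G f ?\<eta>) \<xi>"
    using convolution_adjoint[OF f \<eta> \<xi>] finner_self[OF fvecD(1)[OF \<eta>]] by simp
  then have "(fnorm ?\<eta>)\<^sup>2 \<le> fnorm (convolution G f ?\<eta>) * fnorm \<xi>"
    using cauchy_schwarz[OF fvecD(1)[OF convolution_fvec[OF f \<eta>]] fvecD(1)[OF \<xi>]]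
    by (metis norm_of_real abs_of_nonneg zero_le_power2)
  also have "\<dots> \<le> M * fnorm ?\<eta> * fnorm \<xi>"
    using opboundD[OF M u \<eta>] by (simp add: mult_right_mono)
  finally have "(fnorm ?\<eta>)\<^sup>2 \<le> M * fnorm \<xi> * fnorm ?\<eta>"
    by (simp only: mult.assoc mult.commute[of "fnorm ?\<eta>"])
  then show "fnorm ?\<eta> \<le> M * fnorm \<xi>"
    by (rule le_from_square_le) (simp_all add: opbound_nonneg[OF M])
qed (use opbound_nonneg[OF M] in simp)

text \<open>The substance of the \<open>C\<^sup>*\<close>-identity: \<open>\<parallel>f \<xi>\<parallel>\<^sup>2 = \<langle>\<xi>, f\<^sup>* f \<xi>\<rangle>\<close>.\<close>

lemma opbound_sqrt:
  assumes f: "fibre_finite f" and M: "opbound (convolution G (involution G f) f) M"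
  shows "opbound f (sqrt M)"
  unfolding opbound_def
proof (intro conjI ballI)
  fix u \<xi> assume u: "u \<in> gunits G" and \<xi>: "\<xi> \<in> fvec u"
  let ?\<eta> = "convolution G f \<xi>"
  let ?\<zeta> = "convolution G (convolution G (involution G f) f) \<xi>"
  have \<eta>: "?\<eta> \<in> fvec u" by (rule convolution_fvec[OF f \<xi>])
  have f': "fibre_finite (involution G f)" by (rule fibre_finite_involution[OF f])
  have \<zeta>: "?\<zeta> \<in> fvec u"
    by (rule convolution_fvec[OF fibre_finite_convolution[OF f' f] \<xi>])
  have "complex_of_real ((fnorm ?\<eta>)\<^sup>2) = finner \<xi> ?\<zeta>"
    using convolution_adjoint[OF f \<xi> \<eta>] finner_self[OF fvecD(1)[OF \<eta>]] convolution_assoc[OF f' f]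
    by simp
  then have "(fnorm ?\<eta>)\<^sup>2 \<le> fnorm \<xi> * fnorm ?\<zeta>"
    using cauchy_schwarz[OF fvecD(1)[OF \<xi>] fvecD(1)[OF \<zeta>]]
    by (metis norm_of_real abs_of_nonneg zero_le_power2)
  also have "\<dots> \<le> fnorm \<xi> * (M * fnorm \<xi>)"
    using opboundD[OF M u \<xi>] by (simp add: mult_left_mono)
  also have "\<dots> = (sqrt M * fnorm \<xi>)\<^sup>2"
    using opbound_nonneg[OF M] by (simp add: power_mult_distrib power2_eq_square)
  finally show "fnorm ?\<eta> \<le> sqrt M * fnorm \<xi>"
    using opbound_nonneg[OF M] by (simp add: power2_le_iff_abs_le)
qed (use opbound_nonneg[OF M] in simp)

text \<open>Evaluate the operator at the basis vector of the source of \<open>x\<close>.\<close>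

lemma value_le_opbound:
  assumes f: "fibre_finite f" and M: "opbound f M"
  shows "cmod (f x) \<le> M"
proof (cases "x \<in> elts G")
  case True
  let ?\<delta> = "indicator {gsrc G x} :: 'g \<Rightarrow> complex"
  have \<delta>: "?\<delta> \<in> fvec (gsrc G x)" using indicator_fvec[of "gsrc G x"] True by simp
  have "cmod (f x) = cmod (convolution G f ?\<delta> x)"
    using convolution_indicator[of "gsrc G x" x f] True by simp
  also have "\<dots> \<le> fnorm (convolution G f ?\<delta>)"
    by (rule coefficient_le_fnorm[OF fvecD(1)[OF convolution_fvec[OF f \<delta>]]])
  also have "\<dots> \<le> M" using opboundD[OF M _ \<delta>] True by (simp add: fnorm_indicator)
  finally show ?thesis .
next
  case False
  then have "f x = 0" using fibre_finiteD[OF f] by blast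
  then show ?thesis using opbound_nonneg[OF M] by simp
qed

text \<open>A function supported in a bisection acts as a weighted partial permutation of each fibre.\<close>

lemma bisection_opbound:
  assumes B: "B \<subseteq> elts G" "inj_on (gran G) B" "inj_on (gsrc G) B"
    and f: "\<And>x. x \<notin> B \<Longrightarrow> f x = 0" "\<And>x. cmod (f x) \<le> M" and M: "0 \<le> M"
  shows "fibre_finite f" "opbound f M"
proof -
  have sub: "x \<in> B" if "f x \<noteq> 0" for x using f that by blast
  have fin: "finite {x. f x \<noteq> 0 \<and> p x = u}" if "inj_on p B" for p :: "'g \<Rightarrow> 'g" and u
  proof (cases "{x. f x \<noteq> 0 \<and> p x = u} = {}")
    case False
    then obtain x where "f x \<noteq> 0" "p x = u" by auto
    then have "{x. f x \<noteq> 0 \<and> p x = u} \<subseteq> {x}"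
      using sub by (auto intro: inj_onD[OF that])
    then show ?thesis using finite_subset by blast
  qed (simp only: finite.emptyI)
  show ff: "fibre_finite f"
    unfolding fibre_finite_def using fin B sub by auto
  show "opbound f M"
    unfolding opbound_def
  proof (intro conjI ballI M)
    fix u \<xi> assume u: "u \<in> gunits G" and \<xi>: "\<xi> \<in> fvec u"
    let ?E = "{z. convolution G f \<xi> z \<noteq> 0}"
    have E: "finite ?E" by (rule fvecD(1)[OF convolution_fvec[OF ff \<xi>]])
    have "\<exists>y. z \<in> ?E \<longrightarrow> y \<in> B \<and> gran G y = gran G z \<and>
        convolution G f \<xi> z = f y * \<xi> (gmul G (ginv G y) z)" for z
    proof (cases "z \<in> ?E")
      case True
      then have "convolution G f \<xi> z \<noteq> 0" by simp
      then obtain y w where y: "y \<in> elts G" "w \<in> elts G" "gsrc G y = gran G w" "z = gmul G y w"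
        "f y \<noteq> 0" by (elim convolution_nonzeroE)
      then have z: "z \<in> elts G" "gran G y = gran G z" by auto
      have "convolution G f \<xi> z = (\<Sum>y\<in>{y}. f y * \<xi> (gmul G (ginv G y) z))"
      proof (rule convolution_support_sum[OF ff z(1)])
        show "{y. f y \<noteq> 0 \<and> gran G y = gran G z} \<subseteq> {y}"
          using y(5) z(2) sub by (auto intro: inj_onD[OF B(2)])
      qed (use y z in auto)
      then show ?thesis by (intro exI[of _ y]) (use y z sub in simp)
    qed simp
    then obtain \<sigma> where \<sigma>: "\<And>z. z \<in> ?E \<Longrightarrow> \<sigma> z \<in> B \<and> gran G (\<sigma> z) = gran G z \<and>
        convolution G f \<xi> z = f (\<sigma> z) * \<xi> (gmul G (ginv G (\<sigma> z)) z)"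
      by metis
    \<comment> \<open>\<open>\<sigma> z\<close> is the element of \<open>B\<close> over \<open>r(z)\<close>, so the operator moves the coordinate at \<open>\<tau> z\<close> to
      \<open>z\<close> with weight \<open>f(\<sigma> z)\<close>. Injectivity of the source map on \<open>B\<close> makes \<open>\<tau>\<close> injective.\<close>
    define \<tau> where "\<tau> z = gmul G (ginv G (\<sigma> z)) z" for z
    have elt: "z \<in> elts G" if "z \<in> ?E" for z using that convolution_outside by blast
    have inj: "inj_on \<tau> ?E"
    proof (rule inj_onI)
      fix z z' assume z: "z \<in> ?E" "z' \<in> ?E" "\<tau> z = \<tau> z'"
      have e: "z \<in> elts G" "z' \<in> elts G" "\<sigma> z \<in> elts G" "\<sigma> z' \<in> elts G"
        "gran G (\<sigma> z) = gran G z" "gran G (\<sigma> z') = gran G z'"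
        using z(1,2) \<sigma> elt B(1) by blast+
      have quot: "gran G (gmul G (ginv G a) b) = gsrc G a \<and> gmul G a (gmul G (ginv G a) b) = b"
        if "a \<in> elts G" "b \<in> elts G" "gran G a = gran G b" for a b using that by simp
      have "gran G (\<tau> z) = gsrc G (\<sigma> z)" "gran G (\<tau> z') = gsrc G (\<sigma> z')"
        unfolding \<tau>_def using quot[OF e(3,1,5)] quot[OF e(4,2,6)] by blast+
      then have "gsrc G (\<sigma> z) = gsrc G (\<sigma> z')" using z(3) by simp
      then have "\<sigma> z = \<sigma> z'" by (rule inj_onD[OF B(3)]) (use z \<sigma> in blast)+
      then show "z = z'"
        using quot[OF e(3,1,5)] quot[OF e(4,2,6)] z(3) unfolding \<tau>_def by metis
    qed
    have im: "\<tau> ` ?E \<subseteq> {x. \<xi> x \<noteq> 0}"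
    proof
      fix x assume "x \<in> \<tau> ` ?E"
      then obtain z where z: "z \<in> ?E" "x = \<tau> z" by blast
      then have "convolution G f \<xi> z = f (\<sigma> z) * \<xi> x" using \<sigma>[OF z(1)] unfolding \<tau>_def by simp
      then show "x \<in> {x. \<xi> x \<noteq> 0}" using z by auto
    qed
    have "(\<Sum>z\<in>?E. (cmod (convolution G f \<xi> z))\<^sup>2) \<le> (\<Sum>z\<in>?E. M\<^sup>2 * (cmod (\<xi> (\<tau> z)))\<^sup>2)"
    proof (rule sum_mono)
      fix z assume "z \<in> ?E"
      then have "cmod (convolution G f \<xi> z) = cmod (f (\<sigma> z)) * cmod (\<xi> (\<tau> z))"
        using \<sigma> unfolding \<tau>_def by (metis norm_mult)
      also have "\<dots> \<le> M * cmod (\<xi> (\<tau> z))" by (simp add: f(2) mult_right_mono)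
      finally show "(cmod (convolution G f \<xi> z))\<^sup>2 \<le> M\<^sup>2 * (cmod (\<xi> (\<tau> z)))\<^sup>2"
        by (metis power_mono norm_ge_zero power_mult_distrib)
    qed
    also have "\<dots> = M\<^sup>2 * (\<Sum>x\<in>\<tau> ` ?E. (cmod (\<xi> x))\<^sup>2)"
      by (simp add: sum.reindex[OF inj] sum_distrib_left)
    also have "\<dots> \<le> M\<^sup>2 * (\<Sum>x | \<xi> x \<noteq> 0. (cmod (\<xi> x))\<^sup>2)"
      by (intro mult_left_mono sum_mono2) (use im fvecD(1)[OF \<xi>] in auto)
    finally have "sqrt (\<Sum>z\<in>?E. (cmod (convolution G f \<xi> z))\<^sup>2)
        \<le> sqrt (M\<^sup>2 * (\<Sum>x | \<xi> x \<noteq> 0. (cmod (\<xi> x))\<^sup>2))" by simp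
    then show "fnorm (convolution G f \<xi>) \<le> M * fnorm \<xi>"
      using M by (simp add: fnorm_def L2_set_def real_sqrt_mult)
  qed
qed

section \<open>The reduced norm\<close>

text \<open>The vector \<open>\<lambda>\<^sub>u(f) \<xi>\<close> is the convolution of \<open>f\<close> with \<open>\<xi>\<close> extended by 0 to all of \<open>G\<close>, so
  associativity of convolution says that \<open>\<lambda>\<^sub>u\<close> is multiplicative.\<close>

lemma regular_rep_eq_convolution:
  assumes \<xi>: "\<xi> \<in> ell2 (source_fibre G u)"
  shows "regular_rep G u f \<xi> = convolution G f \<xi>"
proof
  fix z
  have delta: "regular_delta G f x z =
      (if z \<in> elts G \<and> gsrc G z = gsrc G x then f (gmul G z (ginv G x)) else 0)"
    if x: "x \<in> elts G" for x
  proof (cases "z \<in> elts G \<and> gsrc G z = gsrc G x")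
    case True
    have "regular_delta G f x z = (\<Sum>y\<in>{gmul G z (ginv G x)}. f y * indicator {gmul G y x} z)"
      unfolding regular_delta_def
      by (rule infsum_eq_finite_sum) (use True x in \<open>auto simp: indicator_def\<close>)
    then show ?thesis using True x by simp
  next
    case False
    then have "regular_delta G f x z = 0"
      unfolding regular_delta_def
      by (intro infsum_0) (use x in \<open>auto simp: indicator_def\<close>)
    then show ?thesis unfolding if_not_P[OF False] .
  qed
  have out: "\<xi> x = 0" if "x \<notin> source_fibre G u" for x using \<xi> that by (auto simp: ell2_def)
  show "regular_rep G u f \<xi> z = convolution G f \<xi> z"
  proof (cases "z \<in> source_fibre G u")
    case True
    have "regular_rep G u f \<xi> z = (\<Sum>\<^sub>\<infinity>x\<in>source_fibre G u. f (gmul G z (ginv G x)) * \<xi> x)"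
      unfolding regular_rep_def
      by (rule infsum_cong) (use True in \<open>auto simp: source_fibre_def delta mult.commute\<close>)
    then show ?thesis using True convolution_over_source[of z] by (simp add: source_fibre_def)
  next
    case False
    have "regular_rep G u f \<xi> z = 0"
      unfolding regular_rep_def
      by (rule infsum_0) (use False in \<open>auto simp: source_fibre_def delta\<close>)
    moreover have "convolution G f \<xi> z = 0"
    proof (rule ccontr)
      assume "convolution G f \<xi> z \<noteq> 0"
      then obtain y w where "y \<in> elts G" "w \<in> elts G" "gsrc G y = gran G w" "z = gmul G y w"
        "\<xi> w \<noteq> 0" by (elim convolution_nonzeroE)
      then show False using False out[of w] by (auto simp: source_fibre_def)
    qed
    ultimately show ?thesis by simp
  qed
qed

text \<open>Each coordinate of \<open>f * \<xi>\<close> involves only finitely many coordinates of \<open>\<xi>\<close>. So a bound on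
  finitely supported vectors passes to all of \<open>\<ell>\<^sup>2\<close>, by truncating \<open>\<xi>\<close>.\<close>

lemma opbound_ell2:
  assumes f: "fibre_finite f" and M: "opbound f M" and u: "u \<in> gunits G"
    and \<xi>: "\<xi> \<in> ell2 (source_fibre G u)"
  shows "ell2_norm (source_fibre G u) (regular_rep G u f \<xi>) \<le> M * ell2_norm (source_fibre G u) \<xi>"
proof (rule ell2_norm_bound(2))
  let ?X = "source_fibre G u"
  show "0 \<le> M * ell2_norm ?X \<xi>"
    using opbound_nonneg[OF M] by (simp add: ell2_norm_def infsum_nonneg)
  have out: "\<xi> x = 0" if "x \<notin> ?X" for x using \<xi> that by (auto simp: ell2_def)
  show "regular_rep G u f \<xi> z = 0" if "z \<notin> ?X" for z
  proof (rule ccontr)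
    assume "regular_rep G u f \<xi> z \<noteq> 0"
    then have "convolution G f \<xi> z \<noteq> 0" using regular_rep_eq_convolution[OF \<xi>] by simp
    then obtain y w where "y \<in> elts G" "w \<in> elts G" "gsrc G y = gran G w" "z = gmul G y w"
      "\<xi> w \<noteq> 0" by (elim convolution_nonzeroE)
    then show False using that out[of w] by (auto simp: source_fibre_def)
  qed
  fix F assume F: "finite F" "F \<subseteq> ?X"
  \<comment> \<open>The coordinates of \<open>\<xi>\<close> that enter the coordinates of \<open>f * \<xi>\<close> in \<open>F\<close>.\<close>
  define E where
    "E = (\<Union>z\<in>F. (\<lambda>y. gmul G (ginv G y) z) ` {y. f y \<noteq> 0 \<and> gran G y = gran G z})"
  define \<zeta> where "\<zeta> x = (if x \<in> E then \<xi> x else 0)" for x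
  have E: "finite E" unfolding E_def using F fibre_finiteD[OF f] by auto
  have EX: "E \<subseteq> ?X" using F fibre_finiteD(1)[OF f] unfolding E_def source_fibre_def by auto
  have supp: "{x. \<zeta> x \<noteq> 0} \<subseteq> E" by (auto simp: \<zeta>_def)
  have \<zeta>: "\<zeta> \<in> fvec u"
    unfolding fvec_def using supp E EX finite_subset by blast
  have eq: "regular_rep G u f \<xi> z = convolution G f \<zeta> z" if z: "z \<in> F" for z
  proof -
    have zX: "z \<in> elts G" using z F by (auto simp: source_fibre_def)
    have "\<zeta> (gmul G (ginv G y) z) = \<xi> (gmul G (ginv G y) z)"
      if "f y \<noteq> 0" "gran G y = gran G z" for y
      using that z unfolding \<zeta>_def E_def by auto
    then show ?thesis
      unfolding regular_rep_eq_convolution[OF \<xi>] by (simp add: convolution_support_sum'[OF f zX])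
  qed
  have "L2_set (\<lambda>x. cmod (regular_rep G u f \<xi> x)) F = L2_set (\<lambda>x. cmod (convolution G f \<zeta> x)) F"
    using eq by (intro L2_set_cong) auto
  also have "\<dots> \<le> L2_set (\<lambda>x. cmod (convolution G f \<zeta> x)) (F \<union> {x. convolution G f \<zeta> x \<noteq> 0})"
    unfolding L2_set_def
    by (intro real_sqrt_le_mono sum_mono2)
      (use F fvecD(1)[OF convolution_fvec[OF f \<zeta>]] in auto)
  also have "\<dots> = fnorm (convolution G f \<zeta>)"
    by (rule fnorm_eq[symmetric]) (use F fvecD(1)[OF convolution_fvec[OF f \<zeta>]] in auto)
  also have "\<dots> \<le> M * fnorm \<zeta>" by (rule opboundD[OF M u \<zeta>])
  also have "fnorm \<zeta> = L2_set (\<lambda>x. cmod (\<xi> x)) E"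
    unfolding fnorm_eq[OF E supp] by (rule L2_set_cong) (auto simp: \<zeta>_def)
  also have "M * \<dots> \<le> M * ell2_norm ?X \<xi>"
    by (intro mult_left_mono finite_part_le_ell2_norm \<xi> E EX opbound_nonneg[OF M])
  finally show "L2_set (\<lambda>x. cmod (regular_rep G u f \<xi> x)) F \<le> M * ell2_norm ?X \<xi>"
    by simp
qed

lemma
  assumes f: "fibre_finite f" and M: "opbound f M" and u: "u \<in> gunits G"
  shows regular_norm_le: "regular_norm G u f \<le> M"
    and fnorm_le_regular_norm:
      "\<xi> \<in> fvec u \<Longrightarrow> fnorm (convolution G f \<xi>) \<le> regular_norm G u f * fnorm \<xi>"
proof -
  let ?X = "source_fibre G u"
  let ?B = "{\<xi> \<in> ell2 ?X. ell2_norm ?X \<xi> \<le> 1}"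
  have le: "ell2_norm ?X (regular_rep G u f \<xi>) \<le> M" if "\<xi> \<in> ?B" for \<xi>
  proof -
    have "ell2_norm ?X (regular_rep G u f \<xi>) \<le> M * ell2_norm ?X \<xi>"
      using opbound_ell2[OF f M u] that by simp
    also have "\<dots> \<le> M * 1"
      using that opbound_nonneg[OF M] by (intro mult_left_mono) auto
    finally show ?thesis by simp
  qed
  have zero: "(\<lambda>x. 0) \<in> ?B" by (auto simp: ell2_def ell2_norm_def)
  show "regular_norm G u f \<le> M"
    unfolding regular_norm_def by (rule cSUP_least) (use zero le in auto)
  have bdd: "bdd_above ((\<lambda>\<xi>. ell2_norm ?X (regular_rep G u f \<xi>)) ` ?B)"
    using le by (rule bdd_aboveI2)
  have up: "ell2_norm ?X (regular_rep G u f \<xi>) \<le> regular_norm G u f" if "\<xi> \<in> ?B" for \<xi>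
    unfolding regular_norm_def using that bdd by (rule cSUP_upper)
  assume \<xi>: "\<xi> \<in> fvec u"
  show "fnorm (convolution G f \<xi>) \<le> regular_norm G u f * fnorm \<xi>"
  proof (cases "fnorm \<xi> = 0")
    case True
    then have "\<xi> = (\<lambda>x. 0)" using fnorm_eq_0_iff fvecD(1)[OF \<xi>] by blast
    then show ?thesis by (simp add: fnorm_def)
  next
    case False
    then have pos: "0 < fnorm \<xi>" using fnorm_nonneg[of \<xi>] by linarith
    define \<zeta> where "\<zeta> x = complex_of_real (1 / fnorm \<xi>) * \<xi> x" for x
    have \<zeta>: "\<zeta> \<in> fvec u" unfolding \<zeta>_def by (rule fvec_scale[OF \<xi>])
    have n: "fnorm \<zeta> = 1" unfolding \<zeta>_def fnorm_scale using pos by (simp add: norm_divide)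
    have e: "\<zeta> \<in> ell2 ?X" "ell2_norm ?X \<zeta> = 1"
      using ell2_norm_finite_support[of \<zeta> ?X] \<zeta> n unfolding fvec_def by auto
    have c: "convolution G f \<zeta> \<in> fvec u" by (rule convolution_fvec[OF f \<zeta>])
    have "fnorm (convolution G f \<zeta>) \<le> regular_norm G u f"
      using up[of \<zeta>] e regular_rep_eq_convolution[OF e(1)]
        ell2_norm_finite_support(2)[of "convolution G f \<zeta>" ?X] c unfolding fvec_def by simp
    then have "1 / fnorm \<xi> * fnorm (convolution G f \<xi>) \<le> regular_norm G u f"
      unfolding \<zeta>_def convolution_scale_right fnorm_scale using pos by (simp add: norm_divide)
    then show ?thesis using pos by (simp add: field_simps)
  qed
qed

text \<open>The reduced norm is the least operator bound over all units. These two facts are the only access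
  to it below, so that norm estimates become estimates on finitely supported vectors.\<close>

lemma
  assumes f: "convolver f"
  shows reduced_norm_opbound: "opbound f (reduced_norm G f)"
    and reduced_norm_least: "\<And>M. opbound f M \<Longrightarrow> reduced_norm G f \<le> M"
proof -
  have ff: "fibre_finite f" using f by (simp add: convolver_def)
  let ?S = "insert 0 ((\<lambda>u. regular_norm G u f) ` gunits G)"
  show least: "reduced_norm G f \<le> M" if "opbound f M" for M
    unfolding reduced_norm_def
    by (rule cSup_least) (use regular_norm_le[OF ff that] opbound_nonneg[OF that] in auto)
  obtain M where M: "opbound f M" using f by (auto simp: convolver_def)
  have bdd: "bdd_above ?S"
    by (rule bdd_aboveI[of _ M]) (use regular_norm_le[OF ff M] opbound_nonneg[OF M] in auto)
  show "opbound f (reduced_norm G f)"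
    unfolding opbound_def
  proof (intro conjI ballI)
    show "0 \<le> reduced_norm G f"
      unfolding reduced_norm_def by (rule cSup_upper[OF _ bdd]) simp
    fix u \<xi> assume u: "u \<in> gunits G" and \<xi>: "\<xi> \<in> fvec u"
    have "regular_norm G u f \<le> reduced_norm G f"
      unfolding reduced_norm_def by (rule cSup_upper[OF _ bdd]) (use u in simp)
    then show "fnorm (convolution G f \<xi>) \<le> reduced_norm G f * fnorm \<xi>"
      using fnorm_le_regular_norm[OF ff M u \<xi>] by (meson fnorm_nonneg mult_right_mono order_trans)
  qed
qed

lemma convolver_fibre_finite: "convolver f \<Longrightarrow> fibre_finite f"
  by (simp add: convolver_def)

lemma convolver_zero: "convolver (\<lambda>x. 0)"
  unfolding convolver_def using fibre_finite_zero opbound_zero by blast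

lemma convolver_add: "convolver f \<Longrightarrow> convolver g \<Longrightarrow> convolver (\<lambda>x. f x + g x)"
  unfolding convolver_def using fibre_finite_add opbound_add by blast

lemma convolver_scale: "convolver f \<Longrightarrow> convolver (\<lambda>x. k * f x)"
  unfolding convolver_def using fibre_finite_scale opbound_scale by blast

lemma convolver_convolution: "convolver f \<Longrightarrow> convolver g \<Longrightarrow> convolver (convolution G f g)"
  unfolding convolver_def using fibre_finite_convolution opbound_convolution by blast

lemma convolver_involution: "convolver f \<Longrightarrow> convolver (involution G f)"
  unfolding convolver_def using fibre_finite_involution opbound_involution by blast

lemma reduced_norm_nonneg: "convolver f \<Longrightarrow> 0 \<le> reduced_norm G f"
  using reduced_norm_opbound opbound_nonneg by blast

lemma value_le_reduced_norm: "convolver f \<Longrightarrow> cmod (f x) \<le> reduced_norm G f"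
  using value_le_opbound reduced_norm_opbound convolver_fibre_finite by blast

lemma reduced_norm_add:
  "convolver f \<Longrightarrow> convolver g \<Longrightarrow> reduced_norm G (\<lambda>x. f x + g x) \<le> reduced_norm G f + reduced_norm G g"
  by (intro reduced_norm_least opbound_add reduced_norm_opbound convolver_add convolver_fibre_finite)

lemma reduced_norm_convolution:
  "convolver f \<Longrightarrow> convolver g \<Longrightarrow> reduced_norm G (convolution G f g) \<le> reduced_norm G f * reduced_norm G g"
  by (intro reduced_norm_least opbound_convolution reduced_norm_opbound convolver_convolution
      convolver_fibre_finite)

lemma reduced_norm_zero: "reduced_norm G (\<lambda>x. 0) = 0"
  using reduced_norm_least[OF convolver_zero opbound_zero] reduced_norm_nonneg[OF convolver_zero]
  by simp

lemma reduced_norm_scale: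
  assumes f: "convolver f"
  shows "reduced_norm G (\<lambda>x. k * f x) = cmod k * reduced_norm G f"
proof (cases "k = 0")
  case False
  have le: "reduced_norm G (\<lambda>x. l * g x) \<le> cmod l * reduced_norm G g" if "convolver g" for l g
    using that by (intro reduced_norm_least opbound_scale reduced_norm_opbound convolver_scale)
  have "reduced_norm G (\<lambda>x. inverse k * (k * f x)) \<le> cmod (inverse k) * reduced_norm G (\<lambda>x. k * f x)"
    by (rule le[OF convolver_scale[OF f]])
  moreover have "(\<lambda>x. inverse k * (k * f x)) = f" using False by (simp add: fun_eq_iff)
  ultimately have "reduced_norm G f \<le> reduced_norm G (\<lambda>x. k * f x) / cmod k"
    by (simp add: norm_inverse divide_inverse mult.commute)
  then have "cmod k * reduced_norm G f \<le> reduced_norm G (\<lambda>x. k * f x)"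
    using False by (simp add: pos_le_divide_eq mult.commute)
  then show ?thesis using le[OF f, of k] by simp
qed (simp add: reduced_norm_zero)

lemma reduced_norm_eq_0_iff:
  assumes "convolver f"
  shows "reduced_norm G f = 0 \<longleftrightarrow> f = (\<lambda>x. 0)"
proof
  assume "reduced_norm G f = 0"
  then show "f = (\<lambda>x. 0)" using value_le_reduced_norm[OF assms] by (auto simp: fun_eq_iff)
qed (simp add: reduced_norm_zero)

lemma reduced_norm_cstar:
  assumes f: "convolver f"
  shows "reduced_norm G (convolution G (involution G f) f) = (reduced_norm G f)\<^sup>2"
proof (rule antisym)
  have f': "convolver (involution G f)" by (rule convolver_involution[OF f])
  have "reduced_norm G (involution G f) \<le> reduced_norm G f"
    by (intro reduced_norm_least opbound_involution reduced_norm_opbound f f' convolver_fibre_finite)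
  then show "reduced_norm G (convolution G (involution G f) f) \<le> (reduced_norm G f)\<^sup>2"
    unfolding power2_eq_square
    by (meson reduced_norm_convolution[OF f' f] mult_right_mono reduced_norm_nonneg[OF f] order_trans)
  let ?N = "reduced_norm G (convolution G (involution G f) f)"
  have c: "convolver (convolution G (involution G f) f)" by (rule convolver_convolution[OF f' f])
  have "reduced_norm G f \<le> sqrt ?N"
    by (intro reduced_norm_least[OF f] opbound_sqrt convolver_fibre_finite[OF f] reduced_norm_opbound[OF c])
  then have "(reduced_norm G f)\<^sup>2 \<le> (sqrt ?N)\<^sup>2"
    using reduced_norm_nonneg[OF f] by (rule power_mono)
  then show "(reduced_norm G f)\<^sup>2 \<le> ?N" using reduced_norm_nonneg[OF c] by simp
qed

text \<open>This is the injectivity of the canonical map from \<open>C\<^sup>*\<^sub>r(G)\<close> to functions on \<open>G\<close>. A matrix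
  coefficient of \<open>\<lambda>\<^sub>u(f)\<close> on finitely supported vectors involves finitely many values of \<open>f\<close>, so
  pointwise convergence passes to the estimates that define the norm.\<close>

lemma pointwise_null_imp_norm_null:
  assumes f: "\<And>n. convolver (f n)"
    and cauchy: "\<And>e. 0 < e \<Longrightarrow> \<exists>N. \<forall>m\<ge>N. \<forall>n\<ge>N. reduced_norm G (\<lambda>x. f m x + - 1 * f n x) < e"
    and pointwise: "\<And>x. (\<lambda>n. f n x) \<longlonglongrightarrow> 0"
  shows "(\<lambda>n. reduced_norm G (f n)) \<longlonglongrightarrow> 0"
proof (rule LIMSEQ_I)
  fix r :: real assume r: "0 < r"
  obtain N where N: "\<And>m n. N \<le> m \<Longrightarrow> N \<le> n \<Longrightarrow> reduced_norm G (\<lambda>x. f m x + - 1 * f n x) < r / 2"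
    using cauchy[of "r / 2"] r by auto
  have "reduced_norm G (f n) \<le> r / 2" if n: "N \<le> n" for n
  proof (rule reduced_norm_least[OF f], unfold opbound_def, intro conjI ballI)
    show "0 \<le> r / 2" using r by simp
    fix u \<xi> assume u: "u \<in> gunits G" and \<xi>: "\<xi> \<in> fvec u"
    note ff = convolver_fibre_finite[OF f]
    have coord: "(\<lambda>m. convolution G (f m) \<xi> z) \<longlonglongrightarrow> 0" for z
    proof (cases "z \<in> elts G \<and> gsrc G z = u")
      case True
      have "convolution G (f m) \<xi> z = (\<Sum>x | \<xi> x \<noteq> 0. f m (gmul G z (ginv G x)) * \<xi> x)" for m
        by (rule convolution_source_sum)
          (use True fvecD[OF \<xi>] in \<open>auto simp: source_fibre_def\<close>)
      moreover have "(\<lambda>m. \<Sum>x | \<xi> x \<noteq> 0. f m (gmul G z (ginv G x)) * \<xi> x)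
          \<longlonglongrightarrow> (\<Sum>x | \<xi> x \<noteq> 0. 0 * \<xi> x)"
        by (intro tendsto_intros pointwise)
      ultimately show ?thesis by simp
    next
      case False
      then have "convolution G (f m) \<xi> z = 0" for m
        using fvecD[OF convolution_fvec[OF ff \<xi>]] by blast
      then show ?thesis by simp
    qed
    let ?E = "{z. convolution G (f n) \<xi> z \<noteq> 0}"
    have E: "finite ?E" by (rule fvecD(1)[OF convolution_fvec[OF ff \<xi>]])
    define d where "d m z = convolution G (f n) \<xi> z + - 1 * convolution G (f m) \<xi> z" for m z
    have "L2_set (\<lambda>z. cmod (d m z)) ?E \<le> r / 2 * fnorm \<xi>" if m: "N \<le> m" for m
    proof -
      have d: "d m = convolution G (\<lambda>x. f n x + - 1 * f m x) \<xi>"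
        unfolding d_def fun_eq_iff convolution_add_left[OF ff fibre_finite_scale[OF ff]] convolution_scale_left
        by simp
      have c: "convolver (\<lambda>x. f n x + - 1 * f m x)"
        by (intro convolver_add convolver_scale f)
      have fv: "d m \<in> fvec u" unfolding d by (rule convolution_fvec[OF convolver_fibre_finite[OF c] \<xi>])
      have "L2_set (\<lambda>z. cmod (d m z)) ?E \<le> L2_set (\<lambda>z. cmod (d m z)) (?E \<union> {z. d m z \<noteq> 0})"
        unfolding L2_set_def
        by (intro real_sqrt_le_mono sum_mono2) (use E fvecD(1)[OF fv] in auto)
      also have "\<dots> = fnorm (d m)"
        by (rule fnorm_eq[symmetric]) (use E fvecD(1)[OF fv] in auto)
      also have "\<dots> \<le> reduced_norm G (\<lambda>x. f n x + - 1 * f m x) * fnorm \<xi>"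
        unfolding d by (rule opboundD[OF reduced_norm_opbound[OF c] u \<xi>])
      also have "\<dots> \<le> r / 2 * fnorm \<xi>"
        using N[OF n m] by (intro mult_right_mono) auto
      finally show ?thesis .
    qed
    moreover have "(\<lambda>m. L2_set (\<lambda>z. cmod (d m z)) ?E) \<longlonglongrightarrow> L2_set (\<lambda>z. cmod (convolution G (f n) \<xi> z + - 1 * 0)) ?E"
      unfolding L2_set_def d_def by (intro tendsto_intros coord)
    ultimately have "L2_set (\<lambda>z. cmod (convolution G (f n) \<xi> z + - 1 * 0)) ?E \<le> r / 2 * fnorm \<xi>"
      by (intro LIMSEQ_le_const2) blast+
    then show "fnorm (convolution G (f n) \<xi>) \<le> r / 2 * fnorm \<xi>"
      by (simp add: fnorm_def)
  qed
  then have "norm (reduced_norm G (f n) - 0) < r" if "N \<le> n" for n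
    using that r reduced_norm_nonneg[OF f, of n] by fastforce
  then show "\<exists>N. \<forall>n\<ge>N. norm (reduced_norm G (f n) - 0) < r" by blast
qed

end

section \<open>Completion of a normed star-algebra\<close>

text \<open>The axioms common to \<open>C\<^sub>c(G)\<close> and its completion: all those of a \<open>C\<^sup>*\<close>-algebra except
  completeness.\<close>

locale pre_cstar_algebra = nonunital_ring A
  for A :: "('a, 'm) star_algebra_scheme" (structure) +
  assumes scale_closed: "x \<in> carrier A \<Longrightarrow> ascale A k x \<in> carrier A"
    and scale_add: "x \<in> carrier A \<Longrightarrow> y \<in> carrier A \<Longrightarrow>
          ascale A k (x \<oplus> y) = ascale A k x \<oplus> ascale A k y"
    and add_scale: "x \<in> carrier A \<Longrightarrow> ascale A (k + l) x = ascale A k x \<oplus> ascale A l x"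
    and scale_scale: "x \<in> carrier A \<Longrightarrow> ascale A k (ascale A l x) = ascale A (k * l) x"
    and scale_one: "x \<in> carrier A \<Longrightarrow> ascale A 1 x = x"
    and scale_mult_left: "x \<in> carrier A \<Longrightarrow> y \<in> carrier A \<Longrightarrow>
          ascale A k x \<otimes> y = ascale A k (x \<otimes> y)"
    and scale_mult_right: "x \<in> carrier A \<Longrightarrow> y \<in> carrier A \<Longrightarrow>
          x \<otimes> ascale A k y = ascale A k (x \<otimes> y)"
    and star_closed: "x \<in> carrier A \<Longrightarrow> astar A x \<in> carrier A"
    and star_star: "x \<in> carrier A \<Longrightarrow> astar A (astar A x) = x"
    and star_add: "x \<in> carrier A \<Longrightarrow> y \<in> carrier A \<Longrightarrow>
          astar A (x \<oplus> y) = astar A x \<oplus> astar A y"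
    and star_scale: "x \<in> carrier A \<Longrightarrow> astar A (ascale A k x) = ascale A (cnj k) (astar A x)"
    and star_mult: "x \<in> carrier A \<Longrightarrow> y \<in> carrier A \<Longrightarrow>
          astar A (x \<otimes> y) = astar A y \<otimes> astar A x"
    and norm_nonneg: "x \<in> carrier A \<Longrightarrow> 0 \<le> anorm A x"
    and norm_eq_zero: "x \<in> carrier A \<Longrightarrow> anorm A x = 0 \<longleftrightarrow> x = \<zero>"
    and norm_triangle: "x \<in> carrier A \<Longrightarrow> y \<in> carrier A \<Longrightarrow>
          anorm A (x \<oplus> y) \<le> anorm A x + anorm A y"
    and norm_scale: "x \<in> carrier A \<Longrightarrow> anorm A (ascale A k x) = cmod k * anorm A x"
    and norm_mult_le: "x \<in> carrier A \<Longrightarrow> y \<in> carrier A \<Longrightarrow>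
          anorm A (x \<otimes> y) \<le> anorm A x * anorm A y"
    and cstar_identity: "x \<in> carrier A \<Longrightarrow> anorm A (astar A x \<otimes> x) = (anorm A x)\<^sup>2"
begin

lemmas closed_rules [simp, intro] = mult_closed scale_closed star_closed

lemma complete_imp_cstar_algebra:
  assumes "Metric_space.mcomplete (carrier A) (adist A)"
  shows "cstar_algebra A"
  by unfold_locales
    (rule scale_closed scale_add add_scale scale_scale scale_one scale_mult_left scale_mult_right
      star_closed star_star star_add star_scale star_mult norm_nonneg norm_eq_zero norm_triangle
      norm_scale norm_mult_le cstar_identity assms; assumption)+

lemma scale_zero: "x \<in> carrier A \<Longrightarrow> ascale A 0 x = \<zero>"
  using norm_scale[of x 0] norm_eq_zero[of "ascale A 0 x"] by simp

lemma scale_minus_one: "x \<in> carrier A \<Longrightarrow> ascale A (- 1) x = \<ominus> x"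
  using add_scale[of x "- 1" 1] scale_zero[of x] scale_one[of x] minus_equality[of "ascale A (-1) x" x]
  by simp

lemma diff_eq: "x \<in> carrier A \<Longrightarrow> y \<in> carrier A \<Longrightarrow> x \<ominus> y = x \<oplus> ascale A (- 1) y"
  by (simp add: a_minus_def scale_minus_one)

lemma norm_zero [simp]: "anorm A \<zero> = 0"
  using norm_eq_zero[of \<zero>] by simp

lemma diff_zero [simp]: "x \<in> carrier A \<Longrightarrow> x \<ominus> \<zero> = x"
  by (simp add: a_minus_def minus_equality[of \<zero> \<zero>])

lemma norm_diff_self: "x \<in> carrier A \<Longrightarrow> anorm A (x \<ominus> x) = 0"
  by (simp add: a_minus_def r_neg)

lemma norm_diff_commute:
  assumes "x \<in> carrier A" "y \<in> carrier A"
  shows "anorm A (x \<ominus> y) = anorm A (y \<ominus> x)"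
proof -
  have "x \<ominus> y = ascale A (- 1) (y \<ominus> x)"
    using assms by (simp add: diff_eq scale_add scale_scale scale_one a_comm)
  then show ?thesis using assms by (simp add: norm_scale)
qed

lemma diff_chain:
  assumes "x \<in> carrier A" "y \<in> carrier A" "z \<in> carrier A"
  shows "x \<ominus> z = (x \<ominus> y) \<oplus> (y \<ominus> z)"
  using assms by (simp add: a_minus_def a_assoc) (simp add: l_neg r_neg1 a_assoc[symmetric])

lemma norm_diff_triangle:
  assumes "x \<in> carrier A" "y \<in> carrier A" "z \<in> carrier A"
  shows "anorm A (x \<ominus> z) \<le> anorm A (x \<ominus> y) + anorm A (y \<ominus> z)"
  using norm_triangle[of "x \<ominus> y" "y \<ominus> z"] diff_chain[OF assms] assms by simp

lemma norm_diff_eq_zero: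
  assumes "x \<in> carrier A" "y \<in> carrier A"
  shows "anorm A (x \<ominus> y) = 0 \<longleftrightarrow> x = y"
proof -
  have "x = y" if "x \<ominus> y = \<zero>"
    using minus_equality[of x "\<ominus> y"] that assms by (simp add: a_minus_def)
  then show ?thesis using assms norm_eq_zero[of "x \<ominus> y"] norm_diff_self by auto
qed

lemma norm_reverse_triangle:
  assumes "x \<in> carrier A" "y \<in> carrier A"
  shows "\<bar>anorm A x - anorm A y\<bar> \<le> anorm A (x \<ominus> y)"
proof -
  have le: "anorm A a \<le> anorm A (a \<ominus> b) + anorm A b" if "a \<in> carrier A" "b \<in> carrier A" for a b
    using norm_diff_triangle[of a b \<zero>] that by simp
  show ?thesis using le[of x y] le[of y x] norm_diff_commute[OF assms] assms by simp
qed

lemma norm_star: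
  assumes x: "x \<in> carrier A"
  shows "anorm A (astar A x) = anorm A x"
proof -
  have le: "anorm A y \<le> anorm A (astar A y)" if y: "y \<in> carrier A" for y
  proof (rule le_from_square_le)
    show "(anorm A y)\<^sup>2 \<le> anorm A (astar A y) * anorm A y"
      using norm_mult_le[of "astar A y" y] cstar_identity[OF y] y by simp
  qed (use y norm_nonneg in auto)
  show ?thesis using le[OF x] le[of "astar A x"] x by (simp add: star_star)
qed

sublocale metric: Metric_space "carrier A" "adist A"
proof
  show "adist A x z \<le> adist A x y + adist A y z"
    if "x \<in> carrier A" "y \<in> carrier A" "z \<in> carrier A" for x y z
    using that norm_diff_triangle by (simp add: adist_def)
qed (auto simp: adist_def norm_nonneg norm_diff_commute norm_diff_eq_zero)

abbreviation "cauchy_seq \<equiv> Metric_space.MCauchy (carrier A) (adist A)"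

lemma cauchy_seq_iff:
  "cauchy_seq x \<longleftrightarrow> (\<forall>n. x n \<in> carrier A) \<and>
    (\<forall>e>0. \<exists>N. \<forall>m\<ge>N. \<forall>n\<ge>N. anorm A (x m \<ominus> x n) < e)"
proof -
  have "(\<forall>e>0. \<exists>N. \<forall>m\<ge>N. \<forall>n\<ge>N. adist A (x m) (x n) < e) \<longleftrightarrow>
      (\<forall>e>0. \<exists>N. \<forall>m\<ge>N. \<forall>n\<ge>N. anorm A (x m \<ominus> x n) < e)" if "\<And>n. x n \<in> carrier A"
    using that by (simp add: adist_def)
  then show ?thesis unfolding metric.MCauchy_def by (auto simp: image_subset_iff)
qed

lemma cauchy_seqD: "cauchy_seq x \<Longrightarrow> x n \<in> carrier A"
  by (simp add: cauchy_seq_iff)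

lemma cauchy_seq_const: "a \<in> carrier A \<Longrightarrow> cauchy_seq (\<lambda>n. a)"
  by (auto simp: cauchy_seq_iff norm_diff_self)

text \<open>All algebraic operations satisfy such a Lipschitz estimate, the product because Cauchy
  sequences are bounded. Hence they act on Cauchy sequences termwise.\<close>

lemma cauchy_seq_bound:
  assumes x: "cauchy_seq x" and y: "cauchy_seq y" and z: "\<And>n. z n \<in> carrier A"
    and le: "\<And>m n. anorm A (z m \<ominus> z n) \<le> C * anorm A (x m \<ominus> x n) + D * anorm A (y m \<ominus> y n)"
    and pos: "0 \<le> C" "0 \<le> D"
  shows "cauchy_seq z"
  unfolding cauchy_seq_iff
proof (intro conjI allI impI z)
  fix e :: real assume e: "0 < e"
  \<comment> \<open>The summand 1 keeps the denominator positive when \<open>C = D = 0\<close>.\<close>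
  define d where "d = e / (C + D + 1)"
  have d: "0 < d" using e pos by (simp add: d_def add_nonneg_pos)
  obtain N where N: "\<And>m n. N \<le> m \<Longrightarrow> N \<le> n \<Longrightarrow> anorm A (x m \<ominus> x n) < d"
    using x d unfolding cauchy_seq_iff by meson
  obtain M where M: "\<And>m n. M \<le> m \<Longrightarrow> M \<le> n \<Longrightarrow> anorm A (y m \<ominus> y n) < d"
    using y d unfolding cauchy_seq_iff by meson
  have "anorm A (z m \<ominus> z n) < e" if "max M N \<le> m" "max M N \<le> n" for m n
  proof -
    have "anorm A (z m \<ominus> z n) \<le> C * d + D * d"
      using le[of m n] mult_left_mono[OF less_imp_le[OF N] pos(1), of m n]
        mult_left_mono[OF less_imp_le[OF M] pos(2), of m n] that by simp
    also have "\<dots> < (C + D + 1) * d" using d by (simp add: algebra_simps)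
    also have "\<dots> = e" using pos by (simp add: d_def)
    finally show ?thesis .
  qed
  then show "\<exists>N. \<forall>m\<ge>N. \<forall>n\<ge>N. anorm A (z m \<ominus> z n) < e" by blast
qed

lemma cauchy_seq_norm_tendsto:
  assumes x: "cauchy_seq x"
  shows "(\<lambda>n. anorm A (x n)) \<longlonglongrightarrow> lim (\<lambda>n. anorm A (x n))"
proof -
  have "Cauchy (\<lambda>n. anorm A (x n))"
    unfolding Cauchy_def dist_real_def
  proof (intro allI impI)
    fix e :: real assume "0 < e"
    then obtain N where "\<And>m n. N \<le> m \<Longrightarrow> N \<le> n \<Longrightarrow> anorm A (x m \<ominus> x n) < e"
      using x unfolding cauchy_seq_iff by meson
    then show "\<exists>N. \<forall>m\<ge>N. \<forall>n\<ge>N. \<bar>anorm A (x m) - anorm A (x n)\<bar> < e"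
      using norm_reverse_triangle[OF cauchy_seqD[OF x] cauchy_seqD[OF x]] by (meson order_le_less_trans)
  qed
  then show ?thesis using Cauchy_convergent convergent_LIMSEQ_iff by blast
qed

lemma cauchy_seq_norm_bound:
  assumes x: "cauchy_seq x"
  obtains C where "0 \<le> C" "\<And>n. anorm A (x n) \<le> C"
proof -
  have "Bseq (\<lambda>n. anorm A (x n))"
    using cauchy_seq_norm_tendsto[OF x] convergentI convergent_imp_Bseq by blast
  then obtain C where "\<And>n. norm (anorm A (x n)) \<le> C" unfolding Bseq_def by blast
  then have le: "anorm A (x n) \<le> C" for n using abs_ge_self[of "anorm A (x n)"] order_trans by force
  moreover have "0 \<le> C" using le[of 0] norm_nonneg[OF cauchy_seqD[OF x, of 0]] by linarith
  ultimately show ?thesis using that by blast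
qed

lemma add_diff:
  assumes "x \<in> carrier A" "y \<in> carrier A" "x' \<in> carrier A" "y' \<in> carrier A"
  shows "(x \<oplus> y) \<ominus> (x' \<oplus> y') = (x \<ominus> x') \<oplus> (y \<ominus> y')"
  using assms by (simp add: a_minus_def minus_add a_ac)

lemma mult_diff:
  assumes "x \<in> carrier A" "y \<in> carrier A" "x' \<in> carrier A" "y' \<in> carrier A"
  shows "(x \<otimes> y) \<ominus> (x' \<otimes> y') = (x \<ominus> x') \<otimes> y \<oplus> x' \<otimes> (y \<ominus> y')"
proof -
  have "(x \<ominus> x') \<otimes> y = x \<otimes> y \<ominus> x' \<otimes> y" "x' \<otimes> (y \<ominus> y') = x' \<otimes> y \<ominus> x' \<otimes> y'"
    using assms
    by (simp_all add: diff_eq distrib_right distrib_left scale_mult_left scale_mult_right)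
  then show ?thesis using assms diff_chain[of "x \<otimes> y" "x' \<otimes> y" "x' \<otimes> y'"] by simp
qed

lemma norm_add_diff:
  assumes "x \<in> carrier A" "y \<in> carrier A" "x' \<in> carrier A" "y' \<in> carrier A"
  shows "anorm A ((x \<oplus> y) \<ominus> (x' \<oplus> y')) \<le> anorm A (x \<ominus> x') + anorm A (y \<ominus> y')"
  unfolding add_diff[OF assms] using assms by (simp add: norm_triangle)

lemma norm_mult_diff:
  assumes "x \<in> carrier A" "y \<in> carrier A" "x' \<in> carrier A" "y' \<in> carrier A"
    and "anorm A y \<le> C" "anorm A x' \<le> D"
  shows "anorm A ((x \<otimes> y) \<ominus> (x' \<otimes> y')) \<le> C * anorm A (x \<ominus> x') + D * anorm A (y \<ominus> y')"
proof -
  have "anorm A ((x \<otimes> y) \<ominus> (x' \<otimes> y'))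
      \<le> anorm A ((x \<ominus> x') \<otimes> y) + anorm A (x' \<otimes> (y \<ominus> y'))"
    unfolding mult_diff[OF assms(1-4)] using assms by (simp add: norm_triangle)
  also have "\<dots> \<le> anorm A (x \<ominus> x') * anorm A y + anorm A x' * anorm A (y \<ominus> y')"
    using assms by (intro add_mono norm_mult_le) auto
  also have "\<dots> \<le> anorm A (x \<ominus> x') * C + D * anorm A (y \<ominus> y')"
    using assms by (intro add_mono mult_left_mono mult_right_mono norm_nonneg) auto
  finally show ?thesis by (simp add: mult.commute)
qed

lemma norm_scale_diff:
  assumes "x \<in> carrier A" "y \<in> carrier A"
  shows "anorm A (ascale A k x \<ominus> ascale A k y) = cmod k * anorm A (x \<ominus> y)"
proof -
  have "ascale A k x \<ominus> ascale A k y = ascale A k (x \<ominus> y)"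
    using assms by (simp add: diff_eq scale_add scale_scale mult.commute)
  then show ?thesis using assms by (simp add: norm_scale)
qed

lemma norm_star_diff:
  assumes "x \<in> carrier A" "y \<in> carrier A"
  shows "anorm A (astar A x \<ominus> astar A y) = anorm A (x \<ominus> y)"
proof -
  have "astar A x \<ominus> astar A y = astar A (x \<ominus> y)"
    using assms by (simp add: diff_eq star_add star_scale)
  then show ?thesis using assms by (simp add: norm_star)
qed

lemma cauchy_seq_add:
  assumes x: "cauchy_seq x" and y: "cauchy_seq y"
  shows "cauchy_seq (\<lambda>n. x n \<oplus> y n)"
  by (rule cauchy_seq_bound[OF x y, where C = 1 and D = 1])
    (use cauchy_seqD[OF x] cauchy_seqD[OF y] norm_add_diff in auto)

lemma cauchy_seq_scale:
  assumes x: "cauchy_seq x"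
  shows "cauchy_seq (\<lambda>n. ascale A k (x n))"
  by (rule cauchy_seq_bound[OF x x, where C = "cmod k" and D = 0])
    (use cauchy_seqD[OF x] norm_scale_diff in auto)

lemma cauchy_seq_star:
  assumes x: "cauchy_seq x"
  shows "cauchy_seq (\<lambda>n. astar A (x n))"
  by (rule cauchy_seq_bound[OF x x, where C = 1 and D = 0])
    (use cauchy_seqD[OF x] norm_star_diff in auto)

lemma cauchy_seq_mult:
  assumes x: "cauchy_seq x" and y: "cauchy_seq y"
  shows "cauchy_seq (\<lambda>n. x n \<otimes> y n)"
proof -
  obtain C where C: "0 \<le> C" "\<And>n. anorm A (y n) \<le> C" using cauchy_seq_norm_bound[OF y] by blast
  obtain D where D: "0 \<le> D" "\<And>n. anorm A (x n) \<le> D" using cauchy_seq_norm_bound[OF x] by blast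
  show ?thesis
    by (rule cauchy_seq_bound[OF x y _ _ C(1) D(1)])
      (use C D cauchy_seqD[OF x] cauchy_seqD[OF y] norm_mult_diff in auto)
qed

subsection \<open>Equivalence of Cauchy sequences\<close>

lemma null_equiv_iff:
  "(x, y) \<in> null_equiv A \<longleftrightarrow> cauchy_seq x \<and> cauchy_seq y \<and> (\<lambda>n. anorm A (x n \<ominus> y n)) \<longlonglongrightarrow> 0"
proof -
  have "adist A (x n) (y n) = anorm A (x n \<ominus> y n)" if "cauchy_seq x" "cauchy_seq y" for n
    using cauchy_seqD that by (simp add: adist_def)
  then show ?thesis unfolding null_equiv_def by auto
qed

lemma null_seq_bound:
  fixes f g :: "nat \<Rightarrow> real"
  assumes "f \<longlonglongrightarrow> 0" "g \<longlonglongrightarrow> 0" "\<And>n. 0 \<le> h n" "\<And>n. h n \<le> C * f n + D * g n"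
  shows "h \<longlonglongrightarrow> 0"
proof (rule tendsto_sandwich[OF _ _ tendsto_const])
  show "(\<lambda>n. C * f n + D * g n) \<longlonglongrightarrow> 0"
    using tendsto_add[OF tendsto_mult_right_zero[OF assms(1), of C] tendsto_mult_right_zero[OF assms(2), of D]]
    by simp
qed (use assms in auto)

lemma equiv_null_equiv: "equiv {x. cauchy_seq x} (null_equiv A)"
proof (rule equivI)
  show "null_equiv A \<subseteq> {x. cauchy_seq x} \<times> {x. cauchy_seq x}" by (auto simp: null_equiv_iff)
  show "refl_on {x. cauchy_seq x} (null_equiv A)"
    by (rule refl_onI) (auto simp: null_equiv_iff norm_diff_self cauchy_seqD)
  show "sym (null_equiv A)"
    by (rule symI) (auto simp: null_equiv_iff norm_diff_commute cauchy_seqD)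
  show "trans (null_equiv A)"
  proof (rule transI)
    fix x y z assume xy: "(x, y) \<in> null_equiv A" and yz: "(y, z) \<in> null_equiv A"
    then have c: "cauchy_seq x" "cauchy_seq y" "cauchy_seq z" by (auto simp: null_equiv_iff)
    have "(\<lambda>n. anorm A (x n \<ominus> z n)) \<longlonglongrightarrow> 0"
      by (rule null_seq_bound[where C = 1 and D = 1 and f = "\<lambda>n. anorm A (x n \<ominus> y n)"
            and g = "\<lambda>n. anorm A (y n \<ominus> z n)"])
        (use xy yz c cauchy_seqD norm_diff_triangle norm_nonneg in \<open>auto simp: null_equiv_iff\<close>)
    with c show "(x, z) \<in> null_equiv A" by (simp add: null_equiv_iff)
  qed
qed

definition seq_class :: "(nat \<Rightarrow> 'a) \<Rightarrow> (nat \<Rightarrow> 'a) set"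
  where "seq_class x = null_equiv A `` {x}"

abbreviation "K \<equiv> star_completion A"

lemma const_class_eq: "const_class A a = seq_class (\<lambda>n. a)"
  by (simp add: const_class_def seq_class_def)

lemma seq_class_eq_iff:
  assumes "cauchy_seq x" "cauchy_seq y"
  shows "seq_class x = seq_class y \<longleftrightarrow> (\<lambda>n. anorm A (x n \<ominus> y n)) \<longlonglongrightarrow> 0"
  unfolding seq_class_def using eq_equiv_class_iff[OF equiv_null_equiv, of x y] assms
  by (simp add: null_equiv_iff)

lemma carrier_K: "carrier K = seq_class ` {x. cauchy_seq x}"
  by (auto simp: star_completion_def quotient_def seq_class_def)

lemma carrier_KE:
  assumes "X \<in> carrier K"
  obtains x where "cauchy_seq x" "X = seq_class x"
  using assms by (auto simp: carrier_K)

lemma seq_class_in_K: "cauchy_seq x \<Longrightarrow> seq_class x \<in> carrier K"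
  by (simp add: carrier_K)

lemma zero_K: "\<zero>\<^bsub>K\<^esub> = seq_class (\<lambda>n. \<zero>)"
  by (simp add: star_completion_def const_class_eq)

lemma add_K:
  assumes "cauchy_seq x" "cauchy_seq y"
  shows "seq_class x \<oplus>\<^bsub>K\<^esub> seq_class y = seq_class (\<lambda>n. x n \<oplus> y n)"
proof -
  have "congruent2 (null_equiv A) (null_equiv A) (\<lambda>x y. null_equiv A `` {\<lambda>n. x n \<oplus> y n})"
  proof (rule congruent2I'[OF _ ])
    fix x x' y y' assume r: "(x, x') \<in> null_equiv A" "(y, y') \<in> null_equiv A"
    then have c: "cauchy_seq x" "cauchy_seq y" "cauchy_seq x'" "cauchy_seq y'"
      by (auto simp: null_equiv_iff)
    have "(\<lambda>n. anorm A ((x n \<oplus> y n) \<ominus> (x' n \<oplus> y' n))) \<longlonglongrightarrow> 0"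
      by (rule null_seq_bound[where C = 1 and D = 1 and f = "\<lambda>n. anorm A (x n \<ominus> x' n)"
            and g = "\<lambda>n. anorm A (y n \<ominus> y' n)"])
        (use r c cauchy_seqD norm_add_diff norm_nonneg in \<open>auto simp: null_equiv_iff\<close>)
    then show "null_equiv A `` {\<lambda>n. x n \<oplus> y n} = null_equiv A `` {\<lambda>n. x' n \<oplus> y' n}"
      using seq_class_eq_iff c by (simp add: seq_class_def cauchy_seq_add)
  qed
  from UN_equiv_class2[OF equiv_null_equiv equiv_null_equiv this, of x y] assms
  show ?thesis by (simp add: star_completion_def seq_class_def)
qed

lemma mult_K:
  assumes "cauchy_seq x" "cauchy_seq y"
  shows "seq_class x \<otimes>\<^bsub>K\<^esub> seq_class y = seq_class (\<lambda>n. x n \<otimes> y n)"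
proof -
  have "congruent2 (null_equiv A) (null_equiv A) (\<lambda>x y. null_equiv A `` {\<lambda>n. x n \<otimes> y n})"
  proof (rule congruent2I'[OF _ ])
    fix x x' y y' assume r: "(x, x') \<in> null_equiv A" "(y, y') \<in> null_equiv A"
    then have c: "cauchy_seq x" "cauchy_seq y" "cauchy_seq x'" "cauchy_seq y'"
      by (auto simp: null_equiv_iff)
    obtain C where C: "0 \<le> C" "\<And>n. anorm A (y n) \<le> C" using cauchy_seq_norm_bound[OF c(2)] by blast
    obtain D where D: "0 \<le> D" "\<And>n. anorm A (x' n) \<le> D" using cauchy_seq_norm_bound[OF c(3)] by blast
    have "(\<lambda>n. anorm A ((x n \<otimes> y n) \<ominus> (x' n \<otimes> y' n))) \<longlonglongrightarrow> 0"
      by (rule null_seq_bound[where C = C and D = D and f = "\<lambda>n. anorm A (x n \<ominus> x' n)"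
            and g = "\<lambda>n. anorm A (y n \<ominus> y' n)"])
        (use r c C D cauchy_seqD norm_mult_diff norm_nonneg in \<open>auto simp: null_equiv_iff\<close>)
    then show "null_equiv A `` {\<lambda>n. x n \<otimes> y n} = null_equiv A `` {\<lambda>n. x' n \<otimes> y' n}"
      using seq_class_eq_iff c by (simp add: seq_class_def cauchy_seq_mult)
  qed
  from UN_equiv_class2[OF equiv_null_equiv equiv_null_equiv this, of x y] assms
  show ?thesis by (simp add: star_completion_def seq_class_def)
qed

lemma scale_K:
  assumes "cauchy_seq x"
  shows "ascale K k (seq_class x) = seq_class (\<lambda>n. ascale A k (x n))"
proof -
  have "congruent (null_equiv A) (\<lambda>x. null_equiv A `` {\<lambda>n. ascale A k (x n)})"
  proof (rule congruentI)
    fix x y assume r: "(x, y) \<in> null_equiv A"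
    then have c: "cauchy_seq x" "cauchy_seq y" by (auto simp: null_equiv_iff)
    have "(\<lambda>n. anorm A (ascale A k (x n) \<ominus> ascale A k (y n))) \<longlonglongrightarrow> 0"
      using r tendsto_mult_right_zero[of "\<lambda>n. anorm A (x n \<ominus> y n)" sequentially "cmod k"]
      by (simp add: null_equiv_iff norm_scale_diff cauchy_seqD c)
    then show "null_equiv A `` {\<lambda>n. ascale A k (x n)} = null_equiv A `` {\<lambda>n. ascale A k (y n)}"
      using seq_class_eq_iff c by (simp add: seq_class_def cauchy_seq_scale)
  qed
  from UN_equiv_class[OF equiv_null_equiv this, of x] assms
  show ?thesis by (simp add: star_completion_def seq_class_def)
qed

lemma star_K:
  assumes "cauchy_seq x"
  shows "astar K (seq_class x) = seq_class (\<lambda>n. astar A (x n))"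
proof -
  have "congruent (null_equiv A) (\<lambda>x. null_equiv A `` {\<lambda>n. astar A (x n)})"
  proof (rule congruentI)
    fix x y assume r: "(x, y) \<in> null_equiv A"
    then have c: "cauchy_seq x" "cauchy_seq y" by (auto simp: null_equiv_iff)
    have "(\<lambda>n. anorm A (astar A (x n) \<ominus> astar A (y n))) \<longlonglongrightarrow> 0"
      using r by (simp add: null_equiv_iff norm_star_diff cauchy_seqD c)
    then show "null_equiv A `` {\<lambda>n. astar A (x n)} = null_equiv A `` {\<lambda>n. astar A (y n)}"
      using seq_class_eq_iff c by (simp add: seq_class_def cauchy_seq_star)
  qed
  from UN_equiv_class[OF equiv_null_equiv this, of x] assms
  show ?thesis by (simp add: star_completion_def seq_class_def)
qed

lemma norm_K:
  assumes x: "cauchy_seq x"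
  shows "(\<lambda>n. anorm A (x n)) \<longlonglongrightarrow> anorm K (seq_class x)"
proof -
  have "lim (\<lambda>n. anorm A (y n)) = lim (\<lambda>n. anorm A (x n))" if "y \<in> seq_class x" for y
  proof -
    have r: "cauchy_seq y" "(\<lambda>n. anorm A (x n \<ominus> y n)) \<longlonglongrightarrow> 0"
      using that by (auto simp: seq_class_def null_equiv_iff)
    have "(\<lambda>n. anorm A (x n) - anorm A (y n)) \<longlonglongrightarrow> 0"
      by (rule Lim_null_comparison[OF _ r(2)])
        (simp add: norm_reverse_triangle cauchy_seqD x r)
    from tendsto_diff[OF cauchy_seq_norm_tendsto[OF x] this]
    have "(\<lambda>n. anorm A (y n)) \<longlonglongrightarrow> lim (\<lambda>n. anorm A (x n))" by simp
    then show ?thesis by (rule limI)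
  qed
  moreover have "x \<in> seq_class x"
    using x by (auto simp: seq_class_def null_equiv_iff norm_diff_self cauchy_seqD)
  ultimately have "(\<lambda>x. lim (\<lambda>n. anorm A (x n))) ` seq_class x = {lim (\<lambda>n. anorm A (x n))}"
    by blast
  then have "anorm K (seq_class x) = lim (\<lambda>n. anorm A (x n))"
    by (simp add: star_completion_def)
  then show ?thesis using cauchy_seq_norm_tendsto[OF x] by simp
qed

lemmas class_K_simps = add_K mult_K scale_K star_K zero_K cauchy_seq_add cauchy_seq_mult cauchy_seq_scale
  cauchy_seq_star cauchy_seq_const cauchy_seqD

lemma pre_cstar_K: "pre_cstar_algebra K"
proof -
  have grp: "abelian_group K"
  proof (rule abelian_groupI)
    fix X Y assume "X \<in> carrier K" "Y \<in> carrier K"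
    then obtain x y where x: "cauchy_seq x" "X = seq_class x" "cauchy_seq y" "Y = seq_class y"
      by (metis carrier_KE)
    then show "X \<oplus>\<^bsub>K\<^esub> Y \<in> carrier K" by (simp add: class_K_simps seq_class_in_K)
    show "X \<oplus>\<^bsub>K\<^esub> Y = Y \<oplus>\<^bsub>K\<^esub> X"
      using x by (simp add: class_K_simps a_comm)
    fix Z assume "Z \<in> carrier K"
    then obtain z where z: "cauchy_seq z" "Z = seq_class z" by (metis carrier_KE)
    show "X \<oplus>\<^bsub>K\<^esub> Y \<oplus>\<^bsub>K\<^esub> Z = X \<oplus>\<^bsub>K\<^esub> (Y \<oplus>\<^bsub>K\<^esub> Z)"
      using x z by (simp add: class_K_simps a_assoc)
  next
    show "\<zero>\<^bsub>K\<^esub> \<in> carrier K" by (simp add: zero_K seq_class_in_K cauchy_seq_const)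
  next
    fix X assume "X \<in> carrier K"
    then obtain x where x: "cauchy_seq x" "X = seq_class x" by (metis carrier_KE)
    show "\<zero>\<^bsub>K\<^esub> \<oplus>\<^bsub>K\<^esub> X = X" using x by (simp add: class_K_simps)
    have "ascale A (- 1) (x n) \<oplus> x n = \<zero>" for n
      using cauchy_seqD[OF x(1)] by (simp add: scale_minus_one l_neg)
    then have "ascale K (- 1) X \<oplus>\<^bsub>K\<^esub> X = \<zero>\<^bsub>K\<^esub>"
      using x by (simp add: class_K_simps)
    then show "\<exists>Y\<in>carrier K. Y \<oplus>\<^bsub>K\<^esub> X = \<zero>\<^bsub>K\<^esub>"
      using x by (metis scale_K seq_class_in_K cauchy_seq_scale)
  qed
  show ?thesis
  proof (intro pre_cstar_algebra.intro nonunital_ring.intro[OF grp] nonunital_ring_axioms.intro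
      pre_cstar_algebra_axioms.intro)
    fix X assume "X \<in> carrier K"
    then obtain x where x: "cauchy_seq x" "X = seq_class x" by (metis carrier_KE)
    have xc: "x n \<in> carrier A" for n using x by (simp add: cauchy_seqD)
    note lx = norm_K[OF x(1), folded x(2)]
    show "ascale K k X \<in> carrier K" for k using x by (simp add: class_K_simps seq_class_in_K)
    show "ascale K (k + l) X = ascale K k X \<oplus>\<^bsub>K\<^esub> ascale K l X" for k l
      using x by (simp add: class_K_simps add_scale)
    show "ascale K k (ascale K l X) = ascale K (k * l) X" for k l
      using x by (simp add: class_K_simps scale_scale)
    show "ascale K 1 X = X" using x by (simp add: class_K_simps scale_one)
    show "astar K X \<in> carrier K" using x by (simp add: class_K_simps seq_class_in_K)
    show "astar K (astar K X) = X" using x by (simp add: class_K_simps star_star)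
    show "astar K (ascale K k X) = ascale K (cnj k) (astar K X)" for k
      using x by (simp add: class_K_simps star_scale)
    show "0 \<le> anorm K X" by (rule LIMSEQ_le_const[OF lx]) (use norm_nonneg xc in blast)
    have "anorm K X = 0 \<longleftrightarrow> (\<lambda>n. anorm A (x n)) \<longlonglongrightarrow> 0"
      using lx LIMSEQ_unique[OF lx] by metis
    also have "\<dots> \<longleftrightarrow> X = \<zero>\<^bsub>K\<^esub>"
      using seq_class_eq_iff[OF x(1) cauchy_seq_const[of \<zero>]] x xc by (simp add: zero_K)
    finally show "anorm K X = 0 \<longleftrightarrow> X = \<zero>\<^bsub>K\<^esub>" .
    show "anorm K (ascale K k X) = cmod k * anorm K X" for k
      using LIMSEQ_unique[OF norm_K[OF cauchy_seq_scale[OF x(1)]], of k "cmod k * anorm K X"]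
        tendsto_mult_left[OF lx, of "cmod k"] x xc by (simp add: class_K_simps norm_scale)
    show "anorm K (astar K X \<otimes>\<^bsub>K\<^esub> X) = (anorm K X)\<^sup>2"
      using LIMSEQ_unique[OF norm_K[OF cauchy_seq_mult[OF cauchy_seq_star[OF x(1)] x(1)]],
          of "(anorm K X)\<^sup>2"]
        tendsto_power[OF lx, of 2] x xc by (simp add: class_K_simps cstar_identity)
    fix Y assume "Y \<in> carrier K"
    then obtain y where y: "cauchy_seq y" "Y = seq_class y" by (metis carrier_KE)
    have yc: "y n \<in> carrier A" for n using y by (simp add: cauchy_seqD)
    note ly = norm_K[OF y(1), folded y(2)]
    note xy = x y xc yc
    show "X \<otimes>\<^bsub>K\<^esub> Y \<in> carrier K" using xy by (simp add: class_K_simps seq_class_in_K)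
    show "ascale K k (X \<oplus>\<^bsub>K\<^esub> Y) = ascale K k X \<oplus>\<^bsub>K\<^esub> ascale K k Y" for k
      using xy by (simp add: class_K_simps scale_add)
    show "ascale K k X \<otimes>\<^bsub>K\<^esub> Y = ascale K k (X \<otimes>\<^bsub>K\<^esub> Y)" for k
      using xy by (simp add: class_K_simps scale_mult_left)
    show "X \<otimes>\<^bsub>K\<^esub> ascale K k Y = ascale K k (X \<otimes>\<^bsub>K\<^esub> Y)" for k
      using xy by (simp add: class_K_simps scale_mult_right)
    show "astar K (X \<oplus>\<^bsub>K\<^esub> Y) = astar K X \<oplus>\<^bsub>K\<^esub> astar K Y"
      using xy by (simp add: class_K_simps star_add)
    show "astar K (X \<otimes>\<^bsub>K\<^esub> Y) = astar K Y \<otimes>\<^bsub>K\<^esub> astar K X"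
      using xy by (simp add: class_K_simps star_mult)
    show "anorm K (X \<oplus>\<^bsub>K\<^esub> Y) \<le> anorm K X + anorm K Y"
      using LIMSEQ_le[OF norm_K[OF cauchy_seq_add[OF x(1) y(1)]] tendsto_add[OF lx ly]] xy
      by (auto simp: class_K_simps norm_triangle)
    show "anorm K (X \<otimes>\<^bsub>K\<^esub> Y) \<le> anorm K X * anorm K Y"
      using LIMSEQ_le[OF norm_K[OF cauchy_seq_mult[OF x(1) y(1)]] tendsto_mult[OF lx ly]] xy
      by (auto simp: class_K_simps norm_mult_le)
    fix Z assume "Z \<in> carrier K"
    then obtain z where z: "cauchy_seq z" "Z = seq_class z" by (metis carrier_KE)
    have zc: "z n \<in> carrier A" for n using z by (simp add: cauchy_seqD)
    note xyz = xy z zc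
    show "X \<otimes>\<^bsub>K\<^esub> Y \<otimes>\<^bsub>K\<^esub> Z = X \<otimes>\<^bsub>K\<^esub> (Y \<otimes>\<^bsub>K\<^esub> Z)"
      using xyz by (simp add: class_K_simps mult_assoc)
    show "(X \<oplus>\<^bsub>K\<^esub> Y) \<otimes>\<^bsub>K\<^esub> Z = X \<otimes>\<^bsub>K\<^esub> Z \<oplus>\<^bsub>K\<^esub> Y \<otimes>\<^bsub>K\<^esub> Z"
      using xyz by (simp add: class_K_simps distrib_right)
    show "Z \<otimes>\<^bsub>K\<^esub> (X \<oplus>\<^bsub>K\<^esub> Y) = Z \<otimes>\<^bsub>K\<^esub> X \<oplus>\<^bsub>K\<^esub> Z \<otimes>\<^bsub>K\<^esub> Y"
      using xyz by (simp add: class_K_simps distrib_left)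
  qed
qed

lemma diff_K:
  assumes "cauchy_seq x" "cauchy_seq y"
  shows "seq_class x \<ominus>\<^bsub>K\<^esub> seq_class y = seq_class (\<lambda>n. x n \<ominus> y n)"
  using pre_cstar_algebra.diff_eq[OF pre_cstar_K] assms
  by (simp add: class_K_simps seq_class_in_K diff_eq)

lemma norm_diff_K:
  assumes "cauchy_seq x" "cauchy_seq y"
  shows "(\<lambda>n. anorm A (x n \<ominus> y n)) \<longlonglongrightarrow> anorm K (seq_class x \<ominus>\<^bsub>K\<^esub> seq_class y)"
  unfolding diff_K[OF assms]
  by (rule norm_K) (use assms in \<open>simp add: diff_eq class_K_simps\<close>)

lemma const_class_in_K: "a \<in> carrier A \<Longrightarrow> const_class A a \<in> carrier K"
  by (simp add: const_class_eq seq_class_in_K cauchy_seq_const)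

lemma norm_diff_const_K:
  assumes "a \<in> carrier A" "b \<in> carrier A"
  shows "anorm K (const_class A a \<ominus>\<^bsub>K\<^esub> const_class A b) = anorm A (a \<ominus> b)"
  using LIMSEQ_unique[OF norm_diff_K[OF cauchy_seq_const[OF assms(1)] cauchy_seq_const[OF assms(2)]] tendsto_const]
  by (simp add: const_class_eq)

lemma const_class_tendsto:
  assumes x: "cauchy_seq x"
  shows "(\<lambda>n. anorm K (seq_class x \<ominus>\<^bsub>K\<^esub> const_class A (x n))) \<longlonglongrightarrow> 0"
proof (rule LIMSEQ_I)
  interpret K: pre_cstar_algebra K by (rule pre_cstar_K)
  fix r :: real assume r: "0 < r"
  then obtain N where N: "\<And>m n. N \<le> m \<Longrightarrow> N \<le> n \<Longrightarrow> anorm A (x m \<ominus> x n) < r / 2"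
    using x unfolding cauchy_seq_iff by (meson half_gt_zero)
  have "norm (anorm K (seq_class x \<ominus>\<^bsub>K\<^esub> const_class A (x n)) - 0) < r" if n: "N \<le> n" for n
  proof -
    have "anorm K (seq_class x \<ominus>\<^bsub>K\<^esub> const_class A (x n)) \<le> r / 2"
    proof (rule LIMSEQ_le_const2)
      show "(\<lambda>m. anorm A (x m \<ominus> x n)) \<longlonglongrightarrow> anorm K (seq_class x \<ominus>\<^bsub>K\<^esub> const_class A (x n))"
        unfolding const_class_eq
        by (rule norm_diff_K[OF x cauchy_seq_const]) (rule cauchy_seqD[OF x])
      show "\<exists>N. \<forall>m\<ge>N. anorm A (x m \<ominus> x n) \<le> r / 2"
        using N[OF _ n] less_imp_le by blast
    qed
    moreover have "0 \<le> anorm K (seq_class x \<ominus>\<^bsub>K\<^esub> const_class A (x n))"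
      by (intro K.norm_nonneg K.minus_closed seq_class_in_K const_class_in_K x cauchy_seqD)
    ultimately show ?thesis using r by simp
  qed
  then show "\<exists>N. \<forall>n\<ge>N. norm (anorm K (seq_class x \<ominus>\<^bsub>K\<^esub> const_class A (x n)) - 0) < r" by blast
qed

text \<open>A Cauchy sequence of the completion is approximated, with error tending to 0, by a sequence of
  elements of \<open>A\<close>. That sequence is Cauchy, and its own class is the limit.\<close>

lemma cauchy_approximation:
  assumes X: "Metric_space.MCauchy (carrier K) (adist K) X" and S: "S \<subseteq> carrier A"
    and approx: "\<And>n e. 0 < e \<Longrightarrow> \<exists>s\<in>S. anorm K (X n \<ominus>\<^bsub>K\<^esub> const_class A s) < e"
  obtains a where "cauchy_seq a" "\<forall>n. a n \<in> S" "(\<lambda>n. anorm K (X n \<ominus>\<^bsub>K\<^esub> seq_class a)) \<longlonglongrightarrow> 0"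
proof -
  interpret K: pre_cstar_algebra K by (rule pre_cstar_K)
  have Xc: "X n \<in> carrier K" for n using X by (rule K.cauchy_seqD)
  have "\<exists>s. s \<in> S \<and> anorm K (X n \<ominus>\<^bsub>K\<^esub> const_class A s) < inverse (real (Suc n))" for n
    using approx[of "inverse (real (Suc n))" n] by auto
  then obtain a where aS: "\<And>n. a n \<in> S"
    and less: "\<And>n. anorm K (X n \<ominus>\<^bsub>K\<^esub> const_class A (a n)) < inverse (real (Suc n))" by metis
  have aA: "a n \<in> carrier A" for n using aS S by blast
  have ac: "const_class A (a n) \<in> carrier K" for n by (rule const_class_in_K[OF aA])
  have close: "(\<lambda>n. anorm K (X n \<ominus>\<^bsub>K\<^esub> const_class A (a n))) \<longlonglongrightarrow> 0"
    by (rule tendsto_sandwich[OF _ _ tendsto_const LIMSEQ_inverse_real_of_nat])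
      (use less less_imp_le K.norm_nonneg K.minus_closed Xc ac in \<open>auto intro!: always_eventually\<close>)
  have cauchy: "cauchy_seq a"
    unfolding cauchy_seq_iff
  proof (intro conjI allI impI aA)
    fix e :: real assume e: "0 < e"
    then have e3: "0 < e / 3" by simp
    obtain N where N: "\<And>n. N \<le> n \<Longrightarrow> anorm K (X n \<ominus>\<^bsub>K\<^esub> const_class A (a n)) < e / 3"
      using LIMSEQ_D[OF close e3] by fastforce
    obtain M where M: "\<And>m n. M \<le> m \<Longrightarrow> M \<le> n \<Longrightarrow> anorm K (X m \<ominus>\<^bsub>K\<^esub> X n) < e / 3"
      using X e3 unfolding K.cauchy_seq_iff by meson
    have "anorm A (a m \<ominus> a n) < e" if "max M N \<le> m" "max M N \<le> n" for m n
      using K.norm_diff_triangle[OF ac[of m] Xc[of m] ac[of n]] K.norm_diff_commute[OF Xc[of m] ac[of m]]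
        K.norm_diff_triangle[OF Xc[of m] Xc[of n] ac[of n]] N[of m] M[of m n] N[of n] that
      by (simp add: norm_diff_const_K aA)
    then show "\<exists>N. \<forall>m\<ge>N. \<forall>n\<ge>N. anorm A (a m \<ominus> a n) < e" by blast
  qed
  have lim: "seq_class a \<in> carrier K" by (rule seq_class_in_K[OF cauchy])
  have "(\<lambda>n. anorm K (X n \<ominus>\<^bsub>K\<^esub> seq_class a)) \<longlonglongrightarrow> 0"
  proof (rule null_seq_bound[OF close const_class_tendsto[OF cauchy], where C = 1 and D = 1])
    fix n
    show "0 \<le> anorm K (X n \<ominus>\<^bsub>K\<^esub> seq_class a)"
      by (intro K.norm_nonneg K.minus_closed Xc lim)
    show "anorm K (X n \<ominus>\<^bsub>K\<^esub> seq_class a) \<le> 1 * anorm K (X n \<ominus>\<^bsub>K\<^esub> const_class A (a n)) +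
        1 * anorm K (seq_class a \<ominus>\<^bsub>K\<^esub> const_class A (a n))"
      using K.norm_diff_triangle[OF Xc[of n] ac[of n] lim] K.norm_diff_commute[OF lim ac[of n]] by simp
  qed
  then show ?thesis by (rule that[OF cauchy allI[OF aS]])
qed

lemma complete_K: "Metric_space.mcomplete (carrier K) (adist K)"
proof -
  interpret K: pre_cstar_algebra K by (rule pre_cstar_K)
  show ?thesis
    unfolding K.metric.mcomplete_def
  proof (intro allI impI)
    fix X assume X: "K.metric.MCauchy X"
    have Xc: "X n \<in> carrier K" for n using X by (rule K.cauchy_seqD)
    have approx: "\<exists>s\<in>carrier A. anorm K (X n \<ominus>\<^bsub>K\<^esub> const_class A s) < e" if e: "0 < e" for n e
    proof -
      obtain x where x: "cauchy_seq x" "X n = seq_class x" by (rule carrier_KE[OF Xc])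
      from LIMSEQ_D[OF const_class_tendsto[OF x(1)] e]
      obtain N where "norm (anorm K (seq_class x \<ominus>\<^bsub>K\<^esub> const_class A (x N)) - 0) < e" by blast
      then show ?thesis using x cauchy_seqD[OF x(1)] by (intro bexI[of _ "x N"]) auto
    qed
    obtain a where a: "cauchy_seq a" "(\<lambda>n. anorm K (X n \<ominus>\<^bsub>K\<^esub> seq_class a)) \<longlonglongrightarrow> 0"
      by (rule cauchy_approximation[OF X subset_refl approx])
    then have "limitin K.metric.mtopology X (seq_class a) sequentially"
      unfolding K.metric.limitin_metric_dist_null using Xc seq_class_in_K[OF a(1)]
      by (auto simp: adist_def)
    then show "\<exists>x. limitin K.metric.mtopology X x sequentially" by blast
  qed
qed

lemma cstar_algebra_completion: "cstar_algebra K"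
  by (rule pre_cstar_algebra.complete_imp_cstar_algebra[OF pre_cstar_K complete_K])

lemma closure_const_class:
  assumes S: "S \<subseteq> carrier A"
  shows "atopology K closure_of (const_class A ` S) = {seq_class a |a. cauchy_seq a \<and> (\<forall>n. a n \<in> S)}"
proof -
  interpret K: pre_cstar_algebra K by (rule pre_cstar_K)
  show ?thesis
  proof (intro equalityI subsetI)
    fix X assume "X \<in> atopology K closure_of (const_class A ` S)"
    then have X: "X \<in> carrier K" "\<And>r. 0 < r \<Longrightarrow> \<exists>s\<in>S. adist K X (const_class A s) < r"
      unfolding K.metric.metric_closure_of by auto
    have approx: "\<exists>s\<in>S. anorm K (X \<ominus>\<^bsub>K\<^esub> const_class A s) < e" if e: "0 < e" for e
    proof -
      obtain s where s: "s \<in> S" "adist K X (const_class A s) < e" using X(2)[OF e] by blast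
      have "const_class A s \<in> carrier K" using const_class_in_K s(1) S by blast
      with s X(1) show ?thesis by (auto simp: adist_def)
    qed
    obtain a where a: "cauchy_seq a" "\<forall>n. a n \<in> S"
      "(\<lambda>n::nat. anorm K (X \<ominus>\<^bsub>K\<^esub> seq_class a)) \<longlonglongrightarrow> 0"
      by (rule cauchy_approximation[OF K.cauchy_seq_const[OF X(1)] S approx])
    have lim: "seq_class a \<in> carrier K" by (rule seq_class_in_K[OF a(1)])
    have "anorm K (X \<ominus>\<^bsub>K\<^esub> seq_class a) = 0" using LIMSEQ_unique[OF a(3) tendsto_const] by simp
    then have "X = seq_class a" using K.norm_diff_eq_zero[OF X(1) lim] by simp
    then show "X \<in> {seq_class a |a. cauchy_seq a \<and> (\<forall>n. a n \<in> S)}" using a(1,2) by blast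
  next
    fix X assume "X \<in> {seq_class a |a. cauchy_seq a \<and> (\<forall>n. a n \<in> S)}"
    then obtain a where a: "cauchy_seq a" "\<And>n. a n \<in> S" "X = seq_class a" by blast
    have X: "X \<in> carrier K" using a seq_class_in_K by simp
    show "X \<in> atopology K closure_of (const_class A ` S)"
      unfolding K.metric.metric_closure_of
    proof (intro CollectI conjI X allI impI)
      fix r :: real assume "0 < r"
      from LIMSEQ_D[OF const_class_tendsto[OF a(1)] this]
      obtain n where "norm (anorm K (X \<ominus>\<^bsub>K\<^esub> const_class A (a n)) - 0) < r" using a(3) by blast
      then have "anorm K (X \<ominus>\<^bsub>K\<^esub> const_class A (a n)) < r" by simp
      then show "\<exists>y\<in>const_class A ` S. y \<in> K.metric.mball X r"
        using a X const_class_in_K[OF cauchy_seqD[OF a(1)]] by (auto simp: adist_def)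
    qed
  qed
qed

subsection \<open>Subspaces and gradings of the completion\<close>

definition linear_subspace :: "'a set \<Rightarrow> bool"
  where "linear_subspace S \<longleftrightarrow> S \<subseteq> carrier A \<and> \<zero> \<in> S \<and> (\<forall>x\<in>S. \<forall>y\<in>S. x \<oplus> y \<in> S) \<and>
    (\<forall>k. \<forall>x\<in>S. ascale A k x \<in> S)"

lemma linear_subspaceD:
  assumes "linear_subspace S"
  shows "S \<subseteq> carrier A" "\<zero> \<in> S" "x \<in> S \<Longrightarrow> y \<in> S \<Longrightarrow> x \<oplus> y \<in> S"
    "x \<in> S \<Longrightarrow> ascale A k x \<in> S" "x \<in> S \<Longrightarrow> x \<in> carrier A"
  using assms unfolding linear_subspace_def by auto

lemma linear_subspace_additive_subgroup:
  assumes S: "linear_subspace S"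
  shows "additive_subgroup S A"
proof (intro additive_subgroup.intro subgroup.intro)
  show "inv\<^bsub>add_monoid A\<^esub> x \<in> S" if "x \<in> S" for x
    using linear_subspaceD[OF S] that scale_minus_one[of x] by (metis a_inv_def)
qed (use linear_subspaceD[OF S] in auto)

lemma linear_subspace_finsum:
  assumes S: "linear_subspace S" and f: "f \<in> F \<rightarrow> S"
  shows "(\<Oplus>i\<in>F. f i) \<in> S"
  using f
proof (induction F rule: infinite_finite_induct)
  case (insert i F)
  then have "f i \<in> S" "f \<in> F \<rightarrow> S" by auto
  then show ?case
    using insert linear_subspaceD[OF S] by (subst finsum_insert) auto
qed (use linear_subspaceD[OF S] finsum_infinite in auto)

lemma linear_subspace_aspan:
  assumes S: "linear_subspace S" and X: "X \<subseteq> S"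
  shows "aspan A X \<subseteq> S"
  unfolding aspan_def using X linear_subspaceD(4)[OF S]
  by (auto intro!: linear_subspace_finsum[OF S])

abbreviation closure_class :: "'a set \<Rightarrow> (nat \<Rightarrow> 'a) set set"
  where "closure_class S \<equiv> atopology K closure_of (const_class A ` S)"

lemma closure_classE:
  assumes "S \<subseteq> carrier A" "X \<in> closure_class S"
  obtains a where "cauchy_seq a" "\<And>n. a n \<in> S" "X = seq_class a"
  using assms unfolding closure_const_class[OF assms(1)] by blast

lemma closure_classI:
  assumes "S \<subseteq> carrier A" "cauchy_seq a" "\<And>n. a n \<in> S"
  shows "seq_class a \<in> closure_class S"
  using assms unfolding closure_const_class[OF assms(1)] by blast

lemma finsum_K:
  assumes "finite F" "\<And>i. i \<in> F \<Longrightarrow> cauchy_seq (x i)"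
  shows "cauchy_seq (\<lambda>n. \<Oplus>i\<in>F. x i n)"
    and "(\<Oplus>\<^bsub>K\<^esub>i\<in>F. seq_class (x i)) = seq_class (\<lambda>n. \<Oplus>i\<in>F. x i n)"
proof -
  interpret K: pre_cstar_algebra K by (rule pre_cstar_K)
  have "cauchy_seq (\<lambda>n. \<Oplus>i\<in>F. x i n) \<and>
      (\<Oplus>\<^bsub>K\<^esub>i\<in>F. seq_class (x i)) = seq_class (\<lambda>n. \<Oplus>i\<in>F. x i n)"
    using assms
  proof (induction F)
    case empty
    then show ?case by (simp add: zero_K cauchy_seq_const)
  next
    case (insert i F)
    then have c: "cauchy_seq (x i)" "cauchy_seq (\<lambda>n. \<Oplus>i\<in>F. x i n)" by auto
    have "(\<Oplus>i\<in>insert i F. x i n) = x i n \<oplus> (\<Oplus>i\<in>F. x i n)" for n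
      using insert by (intro finsum_insert) (auto intro: cauchy_seqD)
    moreover have "(\<Oplus>\<^bsub>K\<^esub>i\<in>insert i F. seq_class (x i)) =
        seq_class (x i) \<oplus>\<^bsub>K\<^esub> (\<Oplus>\<^bsub>K\<^esub>i\<in>F. seq_class (x i))"
      using insert by (intro K.finsum_insert) (auto intro: seq_class_in_K)
    ultimately show ?case using insert c by (simp add: add_K cauchy_seq_add)
  qed
  then show "cauchy_seq (\<lambda>n. \<Oplus>i\<in>F. x i n)"
    "(\<Oplus>\<^bsub>K\<^esub>i\<in>F. seq_class (x i)) = seq_class (\<lambda>n. \<Oplus>i\<in>F. x i n)" by auto
qed

lemma closure_class_linear_subspace:
  assumes S: "linear_subspace S"
  shows "pre_cstar_algebra.linear_subspace K (closure_class S)"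
proof -
  interpret K: pre_cstar_algebra K by (rule pre_cstar_K)
  note SA = linear_subspaceD(1)[OF S]
  show ?thesis
    unfolding K.linear_subspace_def
  proof (intro conjI ballI allI)
    show "closure_class S \<subseteq> carrier K"
      using closure_of_subset_topspace[of "atopology K"] by simp
    show "\<zero>\<^bsub>K\<^esub> \<in> closure_class S"
      unfolding zero_K
      by (rule closure_classI[OF SA cauchy_seq_const]) (use linear_subspaceD[OF S] in auto)
  next
    fix X Y assume "X \<in> closure_class S" "Y \<in> closure_class S"
    then obtain x y where "cauchy_seq x" "\<And>n. x n \<in> S" "X = seq_class x"
      "cauchy_seq y" "\<And>n. y n \<in> S" "Y = seq_class y" by (metis closure_classE[OF SA])
    then show "X \<oplus>\<^bsub>K\<^esub> Y \<in> closure_class S"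
      by (simp add: add_K closure_classI[OF SA] cauchy_seq_add linear_subspaceD(3)[OF S])
  next
    fix k X assume "X \<in> closure_class S"
    then obtain x where "cauchy_seq x" "\<And>n. x n \<in> S" "X = seq_class x"
      by (metis closure_classE[OF SA])
    then show "ascale K k X \<in> closure_class S"
      by (simp add: scale_K closure_classI[OF SA] cauchy_seq_scale linear_subspaceD(4)[OF S])
  qed
qed

lemma closure_class_mult:
  assumes "linear_subspace S" "linear_subspace T" "linear_subspace U"
    and "\<And>x y. x \<in> S \<Longrightarrow> y \<in> T \<Longrightarrow> x \<otimes> y \<in> U"
  shows "span_mult K (closure_class S) (closure_class T) \<subseteq> closure_class U"
proof -
  interpret K: pre_cstar_algebra K by (rule pre_cstar_K)
  note sub = linear_subspaceD(1)[OF assms(1)] linear_subspaceD(1)[OF assms(2)]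
    linear_subspaceD(1)[OF assms(3)]
  show ?thesis
    unfolding span_mult_def
  proof (rule K.linear_subspace_aspan[OF closure_class_linear_subspace[OF assms(3)]], clarify)
    fix X Y assume "X \<in> closure_class S" "Y \<in> closure_class T"
    then obtain x y where "cauchy_seq x" "\<And>n. x n \<in> S" "X = seq_class x"
      "cauchy_seq y" "\<And>n. y n \<in> T" "Y = seq_class y"
      by (metis closure_classE[OF sub(1)] closure_classE[OF sub(2)])
    then show "X \<otimes>\<^bsub>K\<^esub> Y \<in> closure_class U"
      by (simp add: mult_K closure_classI[OF sub(3)] cauchy_seq_mult assms(4))
  qed
qed

text \<open>The last hypothesis is independence of the closures, expressed by representatives: it does not
  follow from independence of the subspaces \<open>T \<gamma>\<close>.\<close>

lemma graded_completion:
  fixes \<Gamma> :: "('k, 'n) monoid_scheme"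
  assumes \<Gamma>: "group \<Gamma>"
    and T: "\<And>\<gamma>. \<gamma> \<in> carrier \<Gamma> \<Longrightarrow> linear_subspace (T \<gamma>)"
    and mult: "\<And>\<alpha> \<beta> x y. \<alpha> \<in> carrier \<Gamma> \<Longrightarrow> \<beta> \<in> carrier \<Gamma> \<Longrightarrow> x \<in> T \<alpha> \<Longrightarrow> y \<in> T \<beta> \<Longrightarrow>
      x \<otimes> y \<in> T (\<alpha> \<otimes>\<^bsub>\<Gamma>\<^esub> \<beta>)"
    and star: "\<And>\<alpha> x. \<alpha> \<in> carrier \<Gamma> \<Longrightarrow> x \<in> T \<alpha> \<Longrightarrow> astar A x \<in> T (inv\<^bsub>\<Gamma>\<^esub> \<alpha>)"
    and dense: "\<And>a e. a \<in> carrier A \<Longrightarrow> 0 < e \<Longrightarrow>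
      \<exists>b\<in>component_sums A (carrier \<Gamma>) T. anorm A (a \<ominus> b) < e"
    and indep: "\<And>F x. finite F \<Longrightarrow> F \<subseteq> carrier \<Gamma> \<Longrightarrow>
      (\<And>i. i \<in> F \<Longrightarrow> cauchy_seq (x i) \<and> (\<forall>n. x i n \<in> T i)) \<Longrightarrow>
      (\<lambda>n. anorm A (\<Oplus>i\<in>F. x i n)) \<longlonglongrightarrow> 0 \<Longrightarrow> \<forall>i\<in>F. (\<lambda>n. anorm A (x i n)) \<longlonglongrightarrow> 0"
  shows "graded_cstar_algebra \<Gamma> K (\<lambda>\<gamma>. closure_class (T \<gamma>))"
proof -
  interpret K: pre_cstar_algebra K by (rule pre_cstar_K)
  note sub = linear_subspaceD(1)[OF T]
  show ?thesis
  proof (intro graded_cstar_algebra.intro graded_cstar_algebra_axioms.intro cstar_algebra_completion \<Gamma>)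
    fix \<gamma> assume \<gamma>: "\<gamma> \<in> carrier \<Gamma>"
    note lin = closure_class_linear_subspace[OF T[OF \<gamma>]]
    show "closed_subspace K (closure_class (T \<gamma>))"
      unfolding closed_subspace_def
      using K.linear_subspace_additive_subgroup[OF lin] K.linear_subspaceD(4)[OF lin]
        closedin_closure_of by blast
    show "astar K ` closure_class (T \<gamma>) \<subseteq> closure_class (T (inv\<^bsub>\<Gamma>\<^esub> \<gamma>))"
    proof clarify
      fix X assume "X \<in> closure_class (T \<gamma>)"
      then obtain x where x: "cauchy_seq x" "\<And>n. x n \<in> T \<gamma>" "X = seq_class x"
        by (metis closure_classE[OF sub[OF \<gamma>]])
      then show "astar K X \<in> closure_class (T (inv\<^bsub>\<Gamma>\<^esub> \<gamma>))"
        using closure_classI[OF sub[OF group.inv_closed[OF \<Gamma> \<gamma>]] cauchy_seq_star[OF x(1)]] star[OF \<gamma>]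
        by (simp add: star_K)
    qed
    fix \<beta> assume \<beta>: "\<beta> \<in> carrier \<Gamma>"
    have \<gamma>\<beta>: "\<gamma> \<otimes>\<^bsub>\<Gamma>\<^esub> \<beta> \<in> carrier \<Gamma>"
      using \<Gamma> \<gamma> \<beta> by (simp add: group.is_monoid monoid.m_closed)
    show "span_mult K (closure_class (T \<gamma>)) (closure_class (T \<beta>)) \<subseteq> closure_class (T (\<gamma> \<otimes>\<^bsub>\<Gamma>\<^esub> \<beta>))"
      by (rule closure_class_mult[OF T[OF \<gamma>] T[OF \<beta>] T[OF \<gamma>\<beta>] mult[OF \<gamma> \<beta>]])
  next
    show "independent_components K (carrier \<Gamma>) (\<lambda>\<gamma>. closure_class (T \<gamma>))"
      unfolding independent_components_def
    proof (intro allI impI, elim conjE)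
      fix F X
      assume F: "finite F" "F \<subseteq> carrier \<Gamma>" and X: "X \<in> (\<Pi> \<gamma>\<in>F. closure_class (T \<gamma>))"
        and sum: "(\<Oplus>\<^bsub>K\<^esub>i\<in>F. X i) = \<zero>\<^bsub>K\<^esub>"
      have "\<exists>x. cauchy_seq x \<and> (\<forall>n. x n \<in> T i) \<and> X i = seq_class x" if "i \<in> F" for i
      proof -
        have "i \<in> carrier \<Gamma>" "X i \<in> closure_class (T i)" using that F X by auto
        then show ?thesis by (meson closure_classE[OF sub])
      qed
      then obtain x where x: "\<And>i. i \<in> F \<Longrightarrow> cauchy_seq (x i)" "\<And>i n. i \<in> F \<Longrightarrow> x i n \<in> T i"
        "\<And>i. i \<in> F \<Longrightarrow> X i = seq_class (x i)" by metis
      have "(\<Oplus>\<^bsub>K\<^esub>i\<in>F. X i) = (\<Oplus>\<^bsub>K\<^esub>i\<in>F. seq_class (x i))"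
        using x by (intro K.finsum_cong') (auto intro: seq_class_in_K)
      then have "seq_class (\<lambda>n. \<Oplus>i\<in>F. x i n) = seq_class (\<lambda>n. \<zero>)"
        using sum finsum_K(2)[of F x, OF F(1) x(1)] by (simp add: zero_K)
      then have "(\<lambda>n. anorm A ((\<Oplus>i\<in>F. x i n) \<ominus> \<zero>)) \<longlonglongrightarrow> 0"
        using seq_class_eq_iff[OF finsum_K(1)[of F x, OF F(1) x(1)] cauchy_seq_const[of \<zero>]] by simp
      moreover have "(\<Oplus>i\<in>F. x i n) \<in> carrier A" for n
        using x(1) by (intro finsum_closed) (auto intro: cauchy_seqD)
      ultimately have "(\<lambda>n. anorm A (\<Oplus>i\<in>F. x i n)) \<longlonglongrightarrow> 0"
        by simp
      then have "\<forall>i\<in>F. (\<lambda>n. anorm A (x i n)) \<longlonglongrightarrow> 0" using indep[OF F] x by blast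
      moreover have "x i n \<ominus> \<zero> = x i n" if "i \<in> F" for i n
        using cauchy_seqD[OF x(1)[OF that]] by simp
      ultimately show "\<forall>i\<in>F. X i = \<zero>\<^bsub>K\<^esub>"
        using seq_class_eq_iff[OF x(1) cauchy_seq_const[of \<zero>]] x(3) by (simp add: zero_K)
    qed
    have comp: "closure_class (T \<gamma>) \<subseteq> carrier K" if "\<gamma> \<in> carrier \<Gamma>" for \<gamma>
      using K.linear_subspaceD(1)[OF closure_class_linear_subspace[OF T[OF that]]] .
    have const: "const_class A b \<in> component_sums K (carrier \<Gamma>) (\<lambda>\<gamma>. closure_class (T \<gamma>))"
      if "b \<in> component_sums A (carrier \<Gamma>) T" for b
    proof -
      obtain F a where b: "b = (\<Oplus>i\<in>F. a i)" "finite F" "F \<subseteq> carrier \<Gamma>" "a \<in> Pi F T"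
        using \<open>b \<in> component_sums A (carrier \<Gamma>) T\<close> unfolding component_sums_def by blast
      have aA: "a i \<in> carrier A" "const_class A (a i) \<in> closure_class (T i)" if "i \<in> F" for i
        using b sub that closure_classI[OF sub, of i "\<lambda>n. a i"] cauchy_seq_const
        by (auto simp: const_class_eq)
      have "const_class A b = (\<Oplus>\<^bsub>K\<^esub>i\<in>F. const_class A (a i))"
        using finsum_K(2)[of F "\<lambda>i n. a i"] b(2) aA cauchy_seq_const unfolding b(1) const_class_eq by simp
      then show ?thesis
        unfolding component_sums_def using b(2,3) aA(2)
        by (intro CollectI exI[of _ F] exI[of _ "\<lambda>i. const_class A (a i)"]) auto
    qed
    define C where "C = component_sums K (carrier \<Gamma>) (\<lambda>\<gamma>. closure_class (T \<gamma>))"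
    have "atopology K closure_of C = carrier K"
    proof (intro equalityI subsetI)
      fix X assume "X \<in> atopology K closure_of C"
      then show "X \<in> carrier K"
        using closure_of_subset_topspace[of "atopology K"] by auto
    next
      fix X assume X: "X \<in> carrier K"
      then obtain x where x: "cauchy_seq x" "X = seq_class x" by (metis carrier_KE)
      show "X \<in> atopology K closure_of C"
        unfolding K.metric.metric_closure_of
      proof (intro CollectI conjI X allI impI)
        fix r :: real assume "0 < r"
        then have r2: "0 < r / 2" by simp
        from LIMSEQ_D[OF const_class_tendsto[OF x(1)] r2]
        obtain n where "norm (anorm K (X \<ominus>\<^bsub>K\<^esub> const_class A (x n)) - 0) < r / 2" using x(2) by blast
        then have n: "anorm K (X \<ominus>\<^bsub>K\<^esub> const_class A (x n)) < r / 2" by simp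
        have xn: "x n \<in> carrier A" by (rule cauchy_seqD[OF x(1)])
        obtain b where b: "b \<in> component_sums A (carrier \<Gamma>) T" "anorm A (x n \<ominus> b) < r / 2"
          using dense[OF xn r2] by blast
        have bA: "b \<in> carrier A"
          using b(1) sub unfolding component_sums_def by (auto intro!: finsum_closed)
        have "anorm K (X \<ominus>\<^bsub>K\<^esub> const_class A b) < r"
          using K.norm_diff_triangle[OF X const_class_in_K[OF xn] const_class_in_K[OF bA]] n b(2)
          by (simp add: norm_diff_const_K xn bA)
        then show "\<exists>Y\<in>C. Y \<in> K.metric.mball X r"
          using const[OF b(1), folded C_def] X const_class_in_K[OF bA] by (auto simp: adist_def)
      qed
    qed
    then show "atopology K closure_of component_sums K (carrier \<Gamma>) (\<lambda>\<gamma>. closure_class (T \<gamma>)) = carrier K"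
      unfolding C_def .
  qed
qed

text \<open>Products of elements of \<open>S\<close> and \<open>T\<close> fill \<open>U\<close> before any closure is taken, and \<open>U\<close> is dense in its closure.\<close>

lemma span_mult_dense:
  assumes lin: "linear_subspace S" "linear_subspace T" "linear_subspace U"
    and U: "product_sums A S T = U"
  shows "atopology K closure_of span_mult K (closure_class S) (closure_class T) = closure_class U"
proof (rule antisym)
  interpret K: pre_cstar_algebra K by (rule pre_cstar_K)
  note sub = linear_subspaceD(1)[OF lin(1)] linear_subspaceD(1)[OF lin(2)]
  have "x \<otimes> y \<in> U" if xy: "x \<in> S" "y \<in> T" for x y
  proof -
    have "x \<otimes> y = (\<Oplus>i\<in>{..<Suc 0}. x \<otimes> y)"
      using xy subsetD[OF sub(1)] subsetD[OF sub(2)] by (subst lessThan_Suc, subst finsum_insert) auto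
    moreover have "(\<Oplus>i\<in>{..<Suc 0}. x \<otimes> y) \<in> product_sums A S T"
      unfolding product_sums_def using xy
      by (intro CollectI exI[of _ "Suc 0"] exI[of _ "\<lambda>i. x"] exI[of _ "\<lambda>i. y"]) auto
    ultimately show ?thesis using U by simp
  qed
  then have "span_mult K (closure_class S) (closure_class T) \<subseteq> closure_class U"
    using closure_class_mult[OF lin] by blast
  then show "atopology K closure_of span_mult K (closure_class S) (closure_class T) \<subseteq> closure_class U"
    by (rule closure_of_minimal) simp
  have "const_class A ` U \<subseteq> span_mult K (closure_class S) (closure_class T)"
  proof clarify
    fix u assume "u \<in> U"
    then obtain n :: nat and a b where u: "u = (\<Oplus>i\<in>{..<n}. a i \<otimes> b i)"
      "a \<in> {..<n} \<rightarrow> S" "b \<in> {..<n} \<rightarrow> T"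
      unfolding U[symmetric] product_sums_def by blast
    have A: "a i \<in> carrier A" "b i \<in> carrier A" "a i \<in> S" "b i \<in> T" if "i \<in> {..<n}" for i
      using u sub that by blast+
    have "const_class A u = (\<Oplus>\<^bsub>K\<^esub>i\<in>{..<n}. const_class A (a i \<otimes> b i))"
      using finsum_K(2)[of "{..<n}" "\<lambda>i m. a i \<otimes> b i"] A cauchy_seq_const unfolding u(1) const_class_eq
      by simp
    also have "\<dots> = (\<Oplus>\<^bsub>K\<^esub>i\<in>{..<n}. ascale K 1 (const_class A (a i) \<otimes>\<^bsub>K\<^esub> const_class A (b i)))"
      using A by (intro K.finsum_cong' refl)
        (auto simp: const_class_eq mult_K cauchy_seq_const scale_K scale_one intro!: seq_class_in_K)
    also have "\<dots> \<in> span_mult K (closure_class S) (closure_class T)"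
    proof -
      have "const_class A (a i) \<in> closure_class S" "const_class A (b i) \<in> closure_class T"
        if "i \<in> {..<n}" for i
        using closure_classI[OF sub(1), of "\<lambda>m. a i"] closure_classI[OF sub(2), of "\<lambda>m. b i"] A[OF that]
        by (simp_all add: const_class_eq cauchy_seq_const)
      then show ?thesis
        unfolding span_mult_def aspan_def
        by (intro CollectI exI[of _ n] exI[of _ "\<lambda>i. 1"]
            exI[of _ "\<lambda>i. const_class A (a i) \<otimes>\<^bsub>K\<^esub> const_class A (b i)"]) blast
    qed
    finally show "const_class A u \<in> span_mult K (closure_class S) (closure_class T)" .
  qed
  then show "closure_class U \<subseteq> atopology K closure_of span_mult K (closure_class S) (closure_class T)"
    by (rule closure_of_mono)
qed

text \<open>Products of limits are limits of products, so density in the completion can be tested inside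
  the algebra that is completed.\<close>

lemma span_mult_approximation:
  assumes sub: "S \<subseteq> carrier A" "T \<subseteq> carrier A"
    and u: "u \<in> carrier A"
      "const_class A u \<in> atopology K closure_of span_mult K (closure_class S) (closure_class T)"
    and e: "0 < e"
  obtains n :: nat and k a b where "a \<in> {..<n} \<rightarrow> S" "b \<in> {..<n} \<rightarrow> T"
    "anorm A (u \<ominus> (\<Oplus>i\<in>{..<n}. ascale A (k i) (a i \<otimes> b i))) < e"
proof -
  interpret K: pre_cstar_algebra K by (rule pre_cstar_K)
  obtain Y where Y: "Y \<in> span_mult K (closure_class S) (closure_class T)" "Y \<in> carrier K"
    "anorm K (const_class A u \<ominus>\<^bsub>K\<^esub> Y) < e"
    using u(2) e unfolding K.metric.metric_closure_of by (auto simp: adist_def)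
  obtain n :: nat and k v where v: "Y = (\<Oplus>\<^bsub>K\<^esub>i\<in>{..<n}. ascale K (k i) (v i))"
    "v \<in> {..<n} \<rightarrow> {X \<otimes>\<^bsub>K\<^esub> Y |X Y. X \<in> closure_class S \<and> Y \<in> closure_class T}"
    using Y(1) unfolding span_mult_def aspan_def by blast
  define rep where "rep i p \<longleftrightarrow> cauchy_seq (fst p) \<and> (\<forall>m. fst p m \<in> S) \<and>
      cauchy_seq (snd p) \<and> (\<forall>m. snd p m \<in> T) \<and> v i = seq_class (fst p) \<otimes>\<^bsub>K\<^esub> seq_class (snd p)" for i p
  have "\<exists>p. rep i p" if "i < n" for i
  proof -
    have "v i \<in> {X \<otimes>\<^bsub>K\<^esub> Y |X Y. X \<in> closure_class S \<and> Y \<in> closure_class T}"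
      using funcset_mem[OF v(2)] that by simp
    then obtain X Y where "v i = X \<otimes>\<^bsub>K\<^esub> Y" "X \<in> closure_class S" "Y \<in> closure_class T"
      by blast
    moreover obtain x where "cauchy_seq x" "\<And>m. x m \<in> S" "X = seq_class x"
      using closure_classE[OF sub(1) \<open>X \<in> closure_class S\<close>] by blast
    moreover obtain y where "cauchy_seq y" "\<And>m. y m \<in> T" "Y = seq_class y"
      using closure_classE[OF sub(2) \<open>Y \<in> closure_class T\<close>] by blast
    ultimately show ?thesis unfolding rep_def by (intro exI[of _ "(x, y)"]) simp
  qed
  then obtain p where p: "\<And>i. i < n \<Longrightarrow> rep i (p i)" by metis
  define x y where "x i = fst (p i)" and "y i = snd (p i)" for i
  have xy: "\<And>i. i < n \<Longrightarrow> cauchy_seq (x i)" "\<And>i m. i < n \<Longrightarrow> x i m \<in> S"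
    "\<And>i. i < n \<Longrightarrow> cauchy_seq (y i)" "\<And>i m. i < n \<Longrightarrow> y i m \<in> T"
    "\<And>i. i < n \<Longrightarrow> v i = seq_class (x i) \<otimes>\<^bsub>K\<^esub> seq_class (y i)"
    using p by (simp_all add: rep_def x_def y_def)
  define z where "z i m = ascale A (k i) (x i m \<otimes> y i m)" for i m
  have z: "cauchy_seq (z i)" if "i \<in> {..<n}" for i
    using that xy unfolding z_def by (simp add: cauchy_seq_scale cauchy_seq_mult)
  have "Y = (\<Oplus>\<^bsub>K\<^esub>i\<in>{..<n}. seq_class (z i))"
    unfolding v(1) using xy z
    by (intro K.finsum_cong') (auto simp: z_def[abs_def] mult_K scale_K cauchy_seq_mult cauchy_seq_scale intro: seq_class_in_K)
  then have Yz: "Y = seq_class (\<lambda>m. \<Oplus>i\<in>{..<n}. z i m)"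
    using finsum_K(2)[of "{..<n}" z, OF _ z] by simp
  have zc: "cauchy_seq (\<lambda>m. \<Oplus>i\<in>{..<n}. z i m)" using finsum_K(1)[of "{..<n}" z, OF _ z] by simp
  have "(\<lambda>m. anorm A (u \<ominus> (\<Oplus>i\<in>{..<n}. z i m))) \<longlonglongrightarrow> anorm K (const_class A u \<ominus>\<^bsub>K\<^esub> Y)"
    unfolding Yz const_class_eq by (rule norm_diff_K[OF cauchy_seq_const[OF u(1)] zc])
  from order_tendstoD(2)[OF this Y(3)]
  obtain m where m: "anorm A (u \<ominus> (\<Oplus>i\<in>{..<n}. z i m)) < e"
    using eventually_happens'[OF sequentially_bot] by blast
  show ?thesis
    by (rule that[of "\<lambda>i. x i m" n "\<lambda>i. y i m" k]) (use xy m in \<open>auto simp: z_def\<close>)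
qed

end

section \<open>Compact open bisections\<close>

context topological_groupoid
begin

lemma continuous_mul_map:
  assumes "continuous_map X (gtop G) f" "continuous_map X (gtop G) g"
    and "\<And>x. x \<in> topspace X \<Longrightarrow> gsrc G (f x) = gran G (g x)"
  shows "continuous_map X (gtop G) (\<lambda>x. gmul G (f x) (g x))"
proof -
  have fg: "f x \<in> elts G" "g x \<in> elts G" if "x \<in> topspace X" for x
    using assms that by (auto simp: continuous_map_def)
  have "continuous_map X (subtopology (prod_topology (gtop G) (gtop G)) (composable G)) (\<lambda>x. (f x, g x))"
    by (rule continuous_map_into_subtopology) (use assms fg in \<open>auto simp: continuous_map_paired\<close>)
  from continuous_map_compose[OF this continuous_mul] show ?thesis by (simp add: o_def)
qed

lemma continuous_inv_map:
  "continuous_map X (gtop G) f \<Longrightarrow> continuous_map X (gtop G) (\<lambda>x. ginv G (f x))"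
  using continuous_map_compose[OF _ continuous_inv, of X f] by (simp add: o_def)

lemma continuous_ran: "continuous_map (gtop G) (gtop G) (gran G)"
  by (rule continuous_map_eq[OF continuous_mul_map[of "gtop G" "\<lambda>x. x" "ginv G"]])
    (auto simp: continuous_inv continuous_map_id[unfolded id_def])

lemma continuous_src: "continuous_map (gtop G) (gtop G) (gsrc G)"
  by (rule continuous_map_eq[OF continuous_mul_map[of "gtop G" "ginv G" "\<lambda>x. x"]])
    (auto simp: continuous_inv continuous_map_id[unfolded id_def])

end

locale hausdorff_ample_groupoid = ample_groupoid G
  for G :: "('g, 'x) tgroupoid_scheme" +
  assumes hausdorff_units: "Hausdorff_space (unit_topology G)"
begin

lemma bisection_openin: "open_bisection G B \<Longrightarrow> openin (gtop G) B"
  by (simp add: open_bisection_def)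

lemma bisection_subset: "open_bisection G B \<Longrightarrow> B \<subseteq> elts G"
  using bisection_openin openin_subset by blast

lemma bisection_inj:
  assumes "open_bisection G B"
  shows "inj_on (gran G) B" "inj_on (gsrc G) B"
proof -
  have "homeomorphic_map (subtopology (gtop G) B) (subtopology (unit_topology G) (p ` B)) p"
    if "p \<in> {gran G, gsrc G}" for p
    using assms that unfolding open_bisection_def by blast
  from homeomorphic_imp_injective_map[OF this] have "inj_on p B" if "p \<in> {gran G, gsrc G}" for p
    using that by (simp add: Int_absorb1[OF bisection_subset[OF assms]])
  then show "inj_on (gran G) B" "inj_on (gsrc G) B" by auto
qed

lemma compact_open_bisectionD:
  assumes "compact_open_bisection G B"
  shows "open_bisection G B" "openin (gtop G) B" "compactin (gtop G) B" "B \<subseteq> elts G"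
    "inj_on (gran G) B" "inj_on (gsrc G) B"
  using assms bisection_openin bisection_subset bisection_inj
  unfolding compact_open_bisection_def by blast+

lemma gunits_subset: "gunits G \<subseteq> elts G"
  by auto

text \<open>If \<open>B\<close> is a bisection and \<open>x\<close> and \<open>r(x)\<close> both lie in \<open>B\<close>, then \<open>x = r(x)\<close>,
  since the two have the same range.\<close>

lemma openin_gunits: "openin (gtop G) (gunits G)"
proof (subst openin_subopen, intro ballI)
  fix u assume u: "u \<in> gunits G"
  then obtain B where B: "compact_open_bisection G B" "u \<in> B"
    using ample_basis[OF openin_topspace unit_simps(1)[OF u]] by blast
  note BD = compact_open_bisectionD[OF B(1)]
  have "openin (gtop G) {x \<in> B. gran G x \<in> B}"
    by (rule openin_continuous_map_preimage_gen[OF continuous_ran]) (use BD in auto)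
  moreover have "u \<in> {x \<in> B. gran G x \<in> B}" using u B by simp
  moreover have "{x \<in> B. gran G x \<in> B} \<subseteq> gunits G"
  proof clarify
    fix x assume x: "x \<in> B" "gran G x \<in> B"
    then have e: "x \<in> elts G" using BD by blast
    have "gran G x = x" by (rule inj_onD[OF BD(5)]) (use x e in auto)
    then show "x \<in> gunits G" using ran_in_gunits[OF e] by simp
  qed
  ultimately show "\<exists>T. openin (gtop G) T \<and> u \<in> T \<and> T \<subseteq> gunits G" by blast
qed

lemma openin_unit_topology: "openin (unit_topology G) W \<longleftrightarrow> openin (gtop G) W \<and> W \<subseteq> gunits G"
  unfolding unit_topology_def by (rule openin_open_subtopology[OF openin_gunits])

lemma
  assumes W: "openin (gtop G) W"
  shows openin_range_image: "openin (gtop G) (gran G ` W)"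
    and openin_source_image: "openin (gtop G) (gsrc G ` W)"
proof -
  have "openin (gtop G) (p ` W)" if p: "p \<in> {gran G, gsrc G}" for p
  proof (subst openin_subopen, intro ballI)
    fix y assume "y \<in> p ` W"
    then obtain x where x: "x \<in> W" "y = p x" by blast
    obtain B where B: "compact_open_bisection G B" "x \<in> B" "B \<subseteq> W"
      using ample_basis[OF W x(1)] by blast
    have "openin (unit_topology G) (p ` B)"
      using compact_open_bisectionD(1)[OF B(1)] p unfolding open_bisection_def by blast
    then show "\<exists>T. openin (gtop G) T \<and> y \<in> T \<and> T \<subseteq> p ` W"
      using B x openin_unit_topology by blast
  qed
  then show "openin (gtop G) (gran G ` W)" "openin (gtop G) (gsrc G ` W)" by auto
qed

text \<open>Range and source are open maps here, so that a bisection is just an open set on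
  which they are injective.\<close>

lemma open_bisectionI:
  assumes B: "openin (gtop G) B" "inj_on (gran G) B" "inj_on (gsrc G) B"
  shows "open_bisection G B"
  unfolding open_bisection_def
proof (intro conjI ballI B(1))
  fix p assume p: "p \<in> {gran G, gsrc G}"
  have BG: "B \<subseteq> elts G" using B openin_subset by blast
  have units: "p ` B \<subseteq> gunits G" using p BG by auto
  have op0: "openin (gtop G) (p ` V)" if "openin (gtop G) V" for V
    using that p openin_range_image openin_source_image by (metis insertE singletonD)
  have op: "openin (unit_topology G) (p ` V)" if "openin (gtop G) V" "V \<subseteq> B" for V
    unfolding openin_unit_topology using op0[OF that(1)] that(2) units by blast
  show "openin (unit_topology G) (p ` B)" by (rule op[OF B(1) subset_refl])
  have sub: "subtopology (unit_topology G) (p ` B) = subtopology (gtop G) (p ` B)"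
    unfolding unit_topology_def subtopology_subtopology using units by (simp add: Int_absorb1)
  have top: "topspace (subtopology (gtop G) B) = B" "topspace (subtopology (gtop G) (p ` B)) = p ` B"
    using BG units gunits_subset by (auto simp: topspace_subtopology)
  show "homeomorphic_map (subtopology (gtop G) B) (subtopology (unit_topology G) (p ` B)) p"
  proof (rule bijective_open_imp_homeomorphic_map)
    have "continuous_map (gtop G) (gtop G) p" using p continuous_ran continuous_src by blast
    then show "continuous_map (subtopology (gtop G) B) (subtopology (unit_topology G) (p ` B)) p"
      unfolding sub
      by (intro continuous_map_into_subtopology continuous_map_from_subtopology) (auto simp: top)
    show "open_map (subtopology (gtop G) B) (subtopology (unit_topology G) (p ` B)) p"
      unfolding open_map_def
    proof (intro allI impI)
      fix V assume "openin (subtopology (gtop G) B) V"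
      then have V: "openin (gtop G) V" "V \<subseteq> B" using openin_open_subtopology[OF B(1)] by auto
      have "openin (unit_topology G) (p ` V)" by (rule op[OF V])
      then show "openin (subtopology (unit_topology G) (p ` B)) (p ` V)"
        using V op[OF B(1)] by (simp add: openin_open_subtopology image_mono)
    qed
    show "p ` topspace (subtopology (gtop G) B) = topspace (subtopology (unit_topology G) (p ` B))"
      by (simp only: top sub)
    show "inj_on p (topspace (subtopology (gtop G) B))"
      unfolding top using p B by blast
  qed
qed

lemma open_sub_bisection:
  assumes "open_bisection G B" "openin (gtop G) V" "V \<subseteq> B"
  shows "open_bisection G V"
  using assms bisection_inj inj_on_subset by (blast intro: open_bisectionI)

lemma bisection_section:
  assumes B: "open_bisection G B" and p: "p \<in> {gran G, gsrc G}"
  obtains \<sigma> where "continuous_map (subtopology (gtop G) (p ` B)) (gtop G) \<sigma>"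
    "\<And>x. x \<in> B \<Longrightarrow> \<sigma> (p x) = x"
proof -
  have BG: "B \<subseteq> elts G" by (rule bisection_subset[OF B])
  have units: "p ` B \<subseteq> gunits G" using p BG by auto
  have sub: "subtopology (unit_topology G) (p ` B) = subtopology (gtop G) (p ` B)"
    unfolding unit_topology_def subtopology_subtopology using units by (simp add: Int_absorb1)
  obtain \<sigma> where "homeomorphic_maps (subtopology (gtop G) B) (subtopology (gtop G) (p ` B)) p \<sigma>"
    using B p unfolding open_bisection_def homeomorphic_map_maps sub[symmetric] by blast
  then have "continuous_map (subtopology (gtop G) (p ` B)) (subtopology (gtop G) B) \<sigma>"
    "\<And>x. x \<in> B \<Longrightarrow> \<sigma> (p x) = x"
    using BG unfolding homeomorphic_maps_def by (auto simp: topspace_subtopology)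
  then show ?thesis using that continuous_map_into_fulltopology by blast
qed

text \<open>Left translation by the inverse of a bisection: each \<open>x\<close> with \<open>r(x) \<in> r(B)\<close> factors uniquely as
  \<open>\<sigma>(x) \<cdot> (\<sigma>(x)\<^sup>-\<^sup>1 x)\<close> with \<open>\<sigma>(x) \<in> B\<close>, and both factors depend continuously on \<open>x\<close>.\<close>

lemma bisection_factor:
  assumes B: "open_bisection G B"
  defines "W \<equiv> {x \<in> elts G. gran G x \<in> gran G ` B}"
  obtains \<sigma> where "openin (gtop G) W" "continuous_map (subtopology (gtop G) W) (gtop G) \<sigma>"
    "\<And>x. x \<in> W \<Longrightarrow> \<sigma> x \<in> B \<and> gran G (\<sigma> x) = gran G x"
    "continuous_map (subtopology (gtop G) W) (gtop G) (\<lambda>x. gmul G (ginv G (\<sigma> x)) x)"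
proof -
  obtain \<tau> where \<tau>: "continuous_map (subtopology (gtop G) (gran G ` B)) (gtop G) \<tau>"
    "\<And>x. x \<in> B \<Longrightarrow> \<tau> (gran G x) = x"
    using bisection_section[OF B, of "gran G"] by blast
  have W: "openin (gtop G) W"
    unfolding W_def
    by (rule openin_continuous_map_preimage[OF continuous_ran openin_range_image[OF bisection_openin[OF B]]])
  have top: "topspace (subtopology (gtop G) W) = W" using W openin_subset by (auto simp: topspace_subtopology)
  have fac: "\<tau> (gran G x) \<in> B \<and> gran G (\<tau> (gran G x)) = gran G x" if "x \<in> W" for x
    using that \<tau>(2) unfolding W_def by auto
  have "continuous_map (subtopology (gtop G) W) (subtopology (gtop G) (gran G ` B)) (gran G)"
    by (intro continuous_map_into_subtopology continuous_map_from_subtopology continuous_ran)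
      (auto simp: W_def)
  from continuous_map_compose[OF this \<tau>(1)]
  have c: "continuous_map (subtopology (gtop G) W) (gtop G) (\<lambda>x. \<tau> (gran G x))" by (simp add: o_def)
  have "continuous_map (subtopology (gtop G) W) (gtop G) (\<lambda>x. x)"
    using continuous_map_from_subtopology[OF continuous_map_id, of "gtop G" W] by (simp add: id_def)
  then have "continuous_map (subtopology (gtop G) W) (gtop G) (\<lambda>x. gmul G (ginv G (\<tau> (gran G x))) x)"
    by (rule continuous_mul_map[OF continuous_inv_map[OF c]])
      (use fac bisection_subset[OF B] in \<open>auto simp: top subset_iff\<close>)
  then show ?thesis using that W c fac by blast
qed

lemma set_mul_bisection_eq:
  assumes B: "open_bisection G B" "D \<subseteq> elts G"
    and \<sigma>: "\<And>x. x \<in> elts G \<Longrightarrow> gran G x \<in> gran G ` B \<Longrightarrow> \<sigma> x \<in> B \<and> gran G (\<sigma> x) = gran G x"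
  shows "set_mul G B D = {x \<in> elts G. gran G x \<in> gran G ` B \<and> gmul G (ginv G (\<sigma> x)) x \<in> D}"
proof (intro equalityI subsetI)
  note BG = bisection_subset[OF B(1)]
  fix x assume "x \<in> set_mul G B D"
  then obtain b d where x: "b \<in> B" "d \<in> D" "gsrc G b = gran G d" "x = gmul G b d"
    unfolding set_mul_def by blast
  then have e: "b \<in> elts G" "d \<in> elts G" using BG B(2) by auto
  then have xe: "x \<in> elts G" "gran G x = gran G b" using x by auto
  then have "\<sigma> x = b"
    using \<sigma>[of x] x(1) inj_onD[OF bisection_inj(1)[OF B(1)], of "\<sigma> x" b] by auto
  then show "x \<in> {x \<in> elts G. gran G x \<in> gran G ` B \<and> gmul G (ginv G (\<sigma> x)) x \<in> D}"
    using x e xe by simp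
next
  note BG = bisection_subset[OF B(1)]
  fix x assume x: "x \<in> {x \<in> elts G. gran G x \<in> gran G ` B \<and> gmul G (ginv G (\<sigma> x)) x \<in> D}"
  then have b: "\<sigma> x \<in> B" "gran G (\<sigma> x) = gran G x" "x \<in> elts G" using \<sigma> by auto
  then have be: "\<sigma> x \<in> elts G" using BG by auto
  have "x = gmul G (\<sigma> x) (gmul G (ginv G (\<sigma> x)) x)" using b be by simp
  moreover have "gsrc G (\<sigma> x) = gran G (gmul G (ginv G (\<sigma> x)) x)" using b be by simp
  ultimately show "x \<in> set_mul G B D" unfolding set_mul_def using x b by blast
qed

text \<open>By the factorization along \<open>B\<close>, the product \<open>B D\<close> is the preimage of \<open>D\<close> under a continuous map.\<close>

lemma open_bisection_set_mul:
  assumes B: "open_bisection G B" and D: "open_bisection G D"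
  shows "open_bisection G (set_mul G B D)"
proof (rule open_bisectionI)
  note sub = bisection_subset[OF B] bisection_subset[OF D]
  let ?W = "{x \<in> elts G. gran G x \<in> gran G ` B}"
  obtain \<sigma> where \<sigma>: "openin (gtop G) ?W"
    "\<And>x. x \<in> ?W \<Longrightarrow> \<sigma> x \<in> B \<and> gran G (\<sigma> x) = gran G x"
    "continuous_map (subtopology (gtop G) ?W) (gtop G) (\<lambda>x. gmul G (ginv G (\<sigma> x)) x)"
    by (rule bisection_factor[OF B]) blast
  have "openin (subtopology (gtop G) ?W)
      {x \<in> topspace (subtopology (gtop G) ?W). gmul G (ginv G (\<sigma> x)) x \<in> D}"
    by (rule openin_continuous_map_preimage[OF \<sigma>(3) bisection_openin[OF D]])
  moreover have "{x \<in> topspace (subtopology (gtop G) ?W). gmul G (ginv G (\<sigma> x)) x \<in> D} = set_mul G B D"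
    using set_mul_bisection_eq[OF B sub(2), of \<sigma>] \<sigma>(2) by (auto simp: topspace_subtopology)
  ultimately show "openin (gtop G) (set_mul G B D)" using openin_trans_full \<sigma>(1) by metis
  have dec: "\<exists>b d. b \<in> B \<and> d \<in> D \<and> b \<in> elts G \<and> d \<in> elts G \<and> gsrc G b = gran G d \<and> x = gmul G b d"
    if "x \<in> set_mul G B D" for x using that sub unfolding set_mul_def by blast
  show "inj_on (gran G) (set_mul G B D)"
  proof (rule inj_onI)
    fix x y assume "x \<in> set_mul G B D" "y \<in> set_mul G B D" and eq: "gran G x = gran G y"
    then obtain b d b' d' where x: "b \<in> B" "d \<in> D" "b \<in> elts G" "d \<in> elts G" "gsrc G b = gran G d"
      "x = gmul G b d" and y: "b' \<in> B" "d' \<in> D" "b' \<in> elts G" "d' \<in> elts G" "gsrc G b' = gran G d'"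
      "y = gmul G b' d'" using dec by meson
    have "b = b'" by (rule inj_onD[OF bisection_inj(1)[OF B]]) (use x y eq in auto)
    moreover have "d = d'"
      by (rule inj_onD[OF bisection_inj(1)[OF D]]) (use x y calculation in auto)
    ultimately show "x = y" using x y by simp
  qed
  show "inj_on (gsrc G) (set_mul G B D)"
  proof (rule inj_onI)
    fix x y assume "x \<in> set_mul G B D" "y \<in> set_mul G B D" and eq: "gsrc G x = gsrc G y"
    then obtain b d b' d' where x: "b \<in> B" "d \<in> D" "b \<in> elts G" "d \<in> elts G" "gsrc G b = gran G d"
      "x = gmul G b d" and y: "b' \<in> B" "d' \<in> D" "b' \<in> elts G" "d' \<in> elts G" "gsrc G b' = gran G d'"
      "y = gmul G b' d'" using dec by meson
    have "d = d'" by (rule inj_onD[OF bisection_inj(2)[OF D]]) (use x y eq in auto)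
    moreover have "b = b'"
      by (rule inj_onD[OF bisection_inj(2)[OF B]]) (use x y calculation in auto)
    ultimately show "x = y" using x y by simp
  qed
qed

text \<open>A bisection embeds into the Hausdorff unit space, although \<open>G\<close> itself need not be Hausdorff.\<close>

lemma hausdorff_bisection:
  assumes B: "open_bisection G B"
  shows "Hausdorff_space (subtopology (gtop G) B)"
proof (rule Hausdorff_space_injective_preimage[OF hausdorff_units])
  show "continuous_map (subtopology (gtop G) B) (unit_topology G) (gran G)"
    unfolding unit_topology_def
    by (intro continuous_map_into_subtopology continuous_map_from_subtopology continuous_ran)
      (auto simp: topspace_subtopology)
  show "inj_on (gran G) (topspace (subtopology (gtop G) B))"
    using bisection_inj(1)[OF B] by (auto simp: inj_on_def)
qed

lemma compact_sub_bisection: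
  assumes B: "compact_open_bisection G B" and V: "openin (gtop G) V" "closedin (subtopology (gtop G) B) V"
  shows "compact_open_bisection G V"
proof -
  have VB: "V \<subseteq> B" using closedin_subset[OF V(2)] by auto
  have "compactin (subtopology (gtop G) B) V"
    by (rule closedin_compact_space[OF compact_space_subtopology V(2)])
      (rule compact_open_bisectionD(3)[OF B])
  then show ?thesis
    using open_sub_bisection[OF compact_open_bisectionD(1)[OF B] V(1) VB]
    unfolding compact_open_bisection_def by (simp add: compactin_subtopology)
qed

lemma compact_closedin_bisection:
  assumes B: "open_bisection G B" and V: "compactin (gtop G) V" "V \<subseteq> B"
  shows "closedin (subtopology (gtop G) B) V"
  by (rule compactin_imp_closedin[OF hausdorff_bisection[OF B]]) (use V in \<open>simp add: compactin_subtopology\<close>)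

text \<open>In a space that is not Hausdorff the intersection of two compact open sets need not be compact. It is
  when both lie in one bisection, which is Hausdorff.\<close>

lemma compact_open_bisection_Int_Diff:
  assumes B: "open_bisection G B" and D: "compact_open_bisection G D" "D \<subseteq> B"
    and E: "compact_open_bisection G E" "E \<subseteq> B"
  shows "compact_open_bisection G (E \<inter> D)" "compact_open_bisection G (E - D)"
proof -
  note DD = compact_open_bisectionD[OF D(1)] and ED = compact_open_bisectionD[OF E(1)]
  have cD: "closedin (subtopology (gtop G) B) D" and cE: "closedin (subtopology (gtop G) B) E"
    using compact_closedin_bisection[OF B] DD ED D E by auto
  have top: "topspace (subtopology (gtop G) E) = E" using ED by (auto simp: topspace_subtopology)
  have "closedin (subtopology (gtop G) B) (E \<inter> D)" using cD cE by (rule closedin_Int[rotated])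
  then have "closedin (subtopology (gtop G) E) (E \<inter> D)"
    using closedin_subset_topspace[of "subtopology (gtop G) B" "E \<inter> D" E] E(2)
    by (simp add: subtopology_subtopology Int_absorb1)
  then show i: "compact_open_bisection G (E \<inter> D)"
    by (intro compact_sub_bisection[OF E(1)] openin_Int DD ED)
  have oD: "openin (subtopology (gtop G) E) (E \<inter> D)"
    by (rule openin_subtopology_Int2[OF DD(2)])
  have "closedin (subtopology (gtop G) E) (E - E \<inter> D)"
    using closedin_diff[OF closedin_topspace oD] unfolding top .
  moreover have "openin (gtop G) (E - E \<inter> D)"
  proof (rule openin_trans_full[OF _ ED(2)])
    have "closedin (subtopology (gtop G) E) (E \<inter> D)" by fact
    from openin_diff[OF openin_topspace this] show "openin (subtopology (gtop G) E) (E - E \<inter> D)"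
      unfolding top .
  qed
  ultimately have "compact_open_bisection G (E - E \<inter> D)" by (intro compact_sub_bisection[OF E(1)])
  then show "compact_open_bisection G (E - D)" by (simp add: Diff_Int)
qed

lemma compact_open_bisection_inverse:
  assumes B: "compact_open_bisection G B"
  shows "compact_open_bisection G (ginv G ` B)"
proof -
  note BD = compact_open_bisectionD[OF B]
  have eq: "ginv G ` B = {x \<in> elts G. ginv G x \<in> B}"
    using BD(4) by (force simp: image_iff)
  have "openin (gtop G) (ginv G ` B)"
    unfolding eq by (rule openin_continuous_map_preimage[OF continuous_inv BD(2)])
  moreover have "inj_on (gran G \<circ> ginv G) B \<longleftrightarrow> inj_on (gsrc G) B"
    "inj_on (gsrc G \<circ> ginv G) B \<longleftrightarrow> inj_on (gran G) B"
    by (rule inj_on_cong; use BD(4) in force)+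
  then have "inj_on (gran G) (ginv G ` B)" "inj_on (gsrc G) (ginv G ` B)"
    using BD(5,6) inj_on_imageI by blast+
  moreover have "compactin (gtop G) (ginv G ` B)"
    by (rule image_compactin[OF BD(3) continuous_inv])
  ultimately show ?thesis
    unfolding compact_open_bisection_def by (blast intro: open_bisectionI)
qed

text \<open>For compactness the set of composable pairs in \<open>B \<times> D\<close> is replaced by the part of \<open>D\<close> whose
  range lies in \<open>s(B)\<close>. It is closed in \<open>D\<close> because \<open>s(B)\<close> is compact in the Hausdorff unit space.\<close>

lemma compact_open_bisection_set_mul:
  assumes B: "compact_open_bisection G B" and D: "compact_open_bisection G D"
  shows "compact_open_bisection G (set_mul G B D)"
proof -
  note BD = compact_open_bisectionD[OF B] and DD = compact_open_bisectionD[OF D]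
  let ?D = "{d \<in> D. gran G d \<in> gsrc G ` B}"
  obtain \<sigma> where \<sigma>: "continuous_map (subtopology (gtop G) (gsrc G ` B)) (gtop G) \<sigma>"
    "\<And>x. x \<in> B \<Longrightarrow> \<sigma> (gsrc G x) = x"
    using bisection_section[OF BD(1), of "gsrc G"] by blast
  have "compactin (unit_topology G) (gsrc G ` B)"
    using image_compactin[OF BD(3) continuous_src] BD(4)
    unfolding unit_topology_def compactin_subtopology by auto
  then have closed: "closedin (unit_topology G) (gsrc G ` B)"
    by (rule compactin_imp_closedin[OF hausdorff_units])
  have cont: "continuous_map (subtopology (gtop G) D) (unit_topology G) (gran G)"
    unfolding unit_topology_def
    by (intro continuous_map_into_subtopology continuous_map_from_subtopology continuous_ran)
      (auto simp: topspace_subtopology)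
  have "{x \<in> topspace (subtopology (gtop G) D). gran G x \<in> gsrc G ` B} = ?D"
    using DD(4) by (auto simp: topspace_subtopology)
  with closedin_continuous_map_preimage[OF cont closed]
  have "closedin (subtopology (gtop G) D) ?D" by simp
  then have "compactin (subtopology (gtop G) D) ?D"
    by (rule closedin_compact_space[OF compact_space_subtopology[OF DD(3)]])
  then have comp: "compactin (subtopology (gtop G) ?D) ?D" by (simp add: compactin_subtopology)
  have top: "topspace (subtopology (gtop G) ?D) = ?D" using DD(4) by (auto simp: topspace_subtopology)
  have "continuous_map (subtopology (gtop G) ?D) (subtopology (gtop G) (gsrc G ` B)) (gran G)"
    by (intro continuous_map_into_subtopology continuous_map_from_subtopology continuous_ran)
      (auto simp: topspace_subtopology)
  from continuous_map_compose[OF this \<sigma>(1)]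
  have c: "continuous_map (subtopology (gtop G) ?D) (gtop G) (\<lambda>x. \<sigma> (gran G x))" by (simp add: o_def)
  have i: "continuous_map (subtopology (gtop G) ?D) (gtop G) (\<lambda>x. x)"
    using continuous_map_from_subtopology[OF continuous_map_id, of "gtop G" ?D] by (simp add: id_def)
  have m: "continuous_map (subtopology (gtop G) ?D) (gtop G) (\<lambda>x. gmul G (\<sigma> (gran G x)) x)"
    by (rule continuous_mul_map[OF c i]) (use \<sigma>(2) in \<open>auto simp: top\<close>)
  have "(\<lambda>x. gmul G (\<sigma> (gran G x)) x) ` ?D = set_mul G B D"
  proof (intro equalityI subsetI)
    fix x assume "x \<in> (\<lambda>x. gmul G (\<sigma> (gran G x)) x) ` ?D"
    then obtain d b where "d \<in> D" "b \<in> B" "gran G d = gsrc G b" "x = gmul G (\<sigma> (gran G d)) d" by blast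
    then show "x \<in> set_mul G B D" using \<sigma>(2) unfolding set_mul_def by force
  next
    fix x assume "x \<in> set_mul G B D"
    then obtain b d where x: "b \<in> B" "d \<in> D" "gsrc G b = gran G d" "x = gmul G b d"
      unfolding set_mul_def by blast
    then have "x = gmul G (\<sigma> (gran G d)) d" "d \<in> ?D" using \<sigma>(2)[OF x(1)] by (auto simp: x(3)[symmetric])
    then show "x \<in> (\<lambda>x. gmul G (\<sigma> (gran G x)) x) ` ?D" by blast
  qed
  with image_compactin[OF comp m] have "compactin (gtop G) (set_mul G B D)" by simp
  then show ?thesis
    using open_bisection_set_mul[OF BD(1) DD(1)] unfolding compact_open_bisection_def by blast
qed

text \<open>A compact open bisection is a finite disjoint union of arbitrarily small ones. So a property that
  holds locally and is inherited by disjoint unions holds globally.\<close>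

lemma compact_open_induct:
  assumes B: "compact_open_bisection G B"
    and empty: "P {}"
    and loc: "\<And>x. x \<in> B \<Longrightarrow> \<exists>D. compact_open_bisection G D \<and> x \<in> D \<and> D \<subseteq> B \<and>
      (\<forall>E. compact_open_bisection G E \<longrightarrow> E \<subseteq> D \<longrightarrow> P E)"
    and union: "\<And>D E. compact_open_bisection G D \<Longrightarrow> compact_open_bisection G E \<Longrightarrow> D \<inter> E = {} \<Longrightarrow>
      D \<union> E \<subseteq> B \<Longrightarrow> P D \<Longrightarrow> P E \<Longrightarrow> P (D \<union> E)"
  shows "P B"
proof -
  note BD = compact_open_bisectionD[OF B]
  let ?\<U> = "{D. compact_open_bisection G D \<and> D \<subseteq> B \<and> (\<forall>E. compact_open_bisection G E \<longrightarrow> E \<subseteq> D \<longrightarrow> P E)}"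
  have "\<exists>\<F>. finite \<F> \<and> \<F> \<subseteq> ?\<U> \<and> B \<subseteq> \<Union>\<F>"
  proof (rule compactinD[OF BD(3)])
    show "openin (gtop G) U" if "U \<in> ?\<U>" for U using that compact_open_bisectionD(2) by blast
    show "B \<subseteq> \<Union>?\<U>" using loc by blast
  qed
  then obtain \<F> where \<F>: "finite \<F>" "\<F> \<subseteq> ?\<U>" "B \<subseteq> \<Union>\<F>" by blast
  have "P E" if "E \<subseteq> \<Union>\<F>" "compact_open_bisection G E" "E \<subseteq> B" for E
    using \<F>(1,2) that
  proof (induction \<F> arbitrary: E)
    case empty
    then show ?case using assms(2) by simp
  next
    case (insert D \<F>)
    then have D: "compact_open_bisection G D" "D \<subseteq> B"
      "\<And>E. compact_open_bisection G E \<Longrightarrow> E \<subseteq> D \<Longrightarrow> P E" by auto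
    note ID = compact_open_bisection_Int_Diff[OF BD(1) D(1,2) insert.prems(3,4)]
    have "P ((E \<inter> D) \<union> (E - D))"
    proof (rule union[OF ID])
      show "P (E \<inter> D)" using D(3) ID by blast
      show "P (E - D)" using insert.IH[of "E - D"] insert.prems ID by auto
    qed (use insert.prems in auto)
    then show ?case by (simp add: Un_Diff_Int Int_Diff_Un)
  qed
  then show ?thesis using \<F> B by blast
qed

end

section \<open>Functions on compact open bisections\<close>

definition pointwise_subspace :: "('a \<Rightarrow> complex) set \<Rightarrow> bool"
  where "pointwise_subspace V \<longleftrightarrow> (\<lambda>x. 0) \<in> V \<and> (\<forall>f\<in>V. \<forall>g\<in>V. (\<lambda>x. f x + g x) \<in> V) \<and>
    (\<forall>k. \<forall>f\<in>V. (\<lambda>x. k * f x) \<in> V)"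

lemma pointwise_subspaceD:
  assumes "pointwise_subspace V"
  shows "(\<lambda>x. 0) \<in> V" "f \<in> V \<Longrightarrow> g \<in> V \<Longrightarrow> (\<lambda>x. f x + g x) \<in> V" "f \<in> V \<Longrightarrow> (\<lambda>x. k * f x) \<in> V"
  using assms unfolding pointwise_subspace_def by auto

lemma fun_span_base: "f \<in> X \<Longrightarrow> f \<in> fun_span X"
  unfolding fun_span_def by (intro CollectI exI[of _ "{f}"] exI[of _ "\<lambda>f. 1"]) auto

lemma fun_span_subspace: "pointwise_subspace (fun_span X)"
  unfolding pointwise_subspace_def
proof (intro conjI ballI allI)
  show "(\<lambda>x. 0) \<in> fun_span X"
    unfolding fun_span_def by (intro CollectI exI[of _ "{}"]) auto
next
  fix f g assume "f \<in> fun_span X" "g \<in> fun_span X"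
  then obtain F k F' l where f: "f = (\<lambda>x. \<Sum>h\<in>F. k h * h x)" "finite F" "F \<subseteq> X"
    and g: "g = (\<lambda>x. \<Sum>h\<in>F'. l h * h x)" "finite F'" "F' \<subseteq> X"
    unfolding fun_span_def by blast
  define m where "m h = (if h \<in> F then k h else 0) + (if h \<in> F' then l h else 0)" for h
  have "f x + g x = (\<Sum>h\<in>F \<union> F'. m h * h x)" for x
  proof -
    have "f x = (\<Sum>h\<in>F \<union> F'. (if h \<in> F then k h else 0) * h x)"
      unfolding f(1) by (rule sum.mono_neutral_cong_left) (use f g in auto)
    moreover have "g x = (\<Sum>h\<in>F \<union> F'. (if h \<in> F' then l h else 0) * h x)"
      unfolding g(1) by (rule sum.mono_neutral_cong_left) (use f g in auto)
    ultimately show ?thesis by (simp add: m_def distrib_right sum.distrib)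
  qed
  then show "(\<lambda>x. f x + g x) \<in> fun_span X"
    unfolding fun_span_def using f g by (intro CollectI exI[of _ "F \<union> F'"] exI[of _ m]) auto
next
  fix f k assume "f \<in> fun_span X"
  then obtain F l where "f = (\<lambda>x. \<Sum>h\<in>F. l h * h x)" "finite F" "F \<subseteq> X"
    unfolding fun_span_def by blast
  then show "(\<lambda>x. k * f x) \<in> fun_span X"
    unfolding fun_span_def
    by (intro CollectI exI[of _ F] exI[of _ "\<lambda>h. k * l h"]) (auto simp: sum_distrib_left mult.assoc)
qed

lemma pointwise_subspace_sum:
  assumes V: "pointwise_subspace V" and f: "\<And>i. i \<in> F \<Longrightarrow> f i \<in> V"
  shows "(\<lambda>x. \<Sum>i\<in>F. f i x) \<in> V"
  using f
proof (induction F rule: infinite_finite_induct)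
  case (insert i F)
  then show ?case using pointwise_subspaceD(2)[OF V, of "f i"] by simp
qed (use pointwise_subspaceD(1)[OF V] in auto)

lemma fun_span_least:
  assumes V: "pointwise_subspace V" and X: "X \<subseteq> V"
  shows "fun_span X \<subseteq> V"
  unfolding fun_span_def
proof clarify
  fix F k assume "finite F" "F \<subseteq> X"
  then show "(\<lambda>x. \<Sum>f\<in>F. k f * f x) \<in> V"
    using X by (intro pointwise_subspace_sum[OF V] pointwise_subspaceD(3)[OF V]) auto
qed

context algebraic_groupoid
begin

lemma convolver_subspace: "pointwise_subspace {f. convolver f}"
  unfolding pointwise_subspace_def by (simp add: convolver_zero convolver_add convolver_scale)

lemma convolution_fun_span:
  assumes V: "pointwise_subspace V"
    and X: "\<And>f. f \<in> X \<Longrightarrow> fibre_finite f"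
    and XY: "\<And>f g. f \<in> X \<Longrightarrow> g \<in> Y \<Longrightarrow> convolution G f g \<in> V"
    and f: "f \<in> fun_span X" and g: "g \<in> fun_span Y"
  shows "convolution G f g \<in> V"
proof -
  have left: "pointwise_subspace {f. fibre_finite f \<and> convolution G f h \<in> V}" for h
    unfolding pointwise_subspace_def using V
    by (auto simp: fibre_finite_zero fibre_finite_add fibre_finite_scale convolution_add_left
        convolution_scale_left pointwise_subspaceD)
  have fX: "fibre_finite f \<and> convolution G f h \<in> V" if "h \<in> Y" for h
    using fun_span_least[OF left, of X h] X XY that f by blast
  have ff: "fibre_finite f"
    using fun_span_least[of "{f. fibre_finite f}" X] X f
    by (auto simp: pointwise_subspace_def fibre_finite_zero fibre_finite_add fibre_finite_scale)
  have "pointwise_subspace {g. convolution G f g \<in> V}"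
    unfolding pointwise_subspace_def using V
    by (auto simp: convolution_add_right[OF ff] convolution_scale_right pointwise_subspaceD)
  from fun_span_least[OF this, of Y] fX g show ?thesis by blast
qed

text \<open>Only one factorization of \<open>x\<close> has its first entry in \<open>B\<close>.\<close>

lemma bisection_convolution:
  assumes B: "inj_on (gran G) B" "\<And>x. x \<notin> B \<Longrightarrow> f x = 0"
    and y: "y \<in> B" "y \<in> elts G" "x \<in> elts G" "gran G y = gran G x"
  shows "convolution G f g x = f y * g (gmul G (ginv G y) x)"
proof -
  have "f y' = 0" if "gran G y' = gran G x" "y' \<noteq> y" for y'
    using inj_onD[OF B(1), of y' y] B(2)[of y'] y that by auto
  then have "convolution G f g x = (\<Sum>y\<in>{y}. f y * g (gmul G (ginv G y) x))"
    by (intro convolution_range_sum) (use y in auto)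
  then show ?thesis by simp
qed

end

context hausdorff_ample_groupoid
begin

definition compact_bisection_function :: "('g \<Rightarrow> complex) \<Rightarrow> bool"
  where "compact_bisection_function f \<longleftrightarrow> (\<exists>B. compact_open_bisection G B \<and>
    (\<forall>x. x \<notin> B \<longrightarrow> f x = 0) \<and> continuous_map (subtopology (gtop G) B) euclidean f)"

lemma compact_open_between:
  assumes U: "open_bisection G U" and K: "compactin (gtop G) K" "K \<subseteq> U"
  obtains B where "compact_open_bisection G B" "K \<subseteq> B" "B \<subseteq> U"
proof -
  let ?\<U> = "{D. compact_open_bisection G D \<and> D \<subseteq> U}"
  have "\<exists>\<F>. finite \<F> \<and> \<F> \<subseteq> ?\<U> \<and> K \<subseteq> \<Union>\<F>"
  proof (rule compactinD[OF K(1)])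
    show "openin (gtop G) D" if "D \<in> ?\<U>" for D using that compact_open_bisectionD(2) by blast
    show "K \<subseteq> \<Union>?\<U>" using ample_basis[OF bisection_openin[OF U]] K(2) by blast
  qed
  then obtain \<F> where \<F>: "finite \<F>" "\<F> \<subseteq> ?\<U>" "K \<subseteq> \<Union>\<F>" by blast
  have op: "openin (gtop G) (\<Union>\<F>)"
    by (rule openin_Union) (use \<F> compact_open_bisectionD(2) in blast)
  have "compactin (gtop G) (\<Union>\<F>)"
    by (rule compactin_Union[OF \<F>(1)]) (use \<F> compact_open_bisectionD(3) in blast)
  moreover have "open_bisection G (\<Union>\<F>)"
    by (rule open_sub_bisection[OF U op]) (use \<F> in blast)
  ultimately show ?thesis
    using that[of "\<Union>\<F>"] \<F> unfolding compact_open_bisection_def by blast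
qed

text \<open>The compact support of a function on a bisection \<open>U\<close> lies in a compact open subset of \<open>U\<close>. This
  removes supports and closures from all arguments about \<open>C\<^sub>c(G)\<close>.\<close>

lemma bisection_function_iff: "bisection_function G f \<longleftrightarrow> compact_bisection_function f"
proof
  assume "bisection_function G f"
  then obtain U where U: "open_bisection G U" "\<And>x. x \<notin> U \<Longrightarrow> f x = 0"
    "continuous_map (subtopology (gtop G) U) euclidean f"
    "compactin (gtop G) (subtopology (gtop G) U closure_of {x \<in> U. f x \<noteq> 0})"
    unfolding bisection_function_def by blast
  let ?K = "subtopology (gtop G) U closure_of {x \<in> U. f x \<noteq> 0}"
  have top: "topspace (subtopology (gtop G) U) = U"
    using bisection_subset[OF U(1)] by (auto simp: topspace_subtopology)
  have KU: "?K \<subseteq> U" using closure_of_subset_topspace[of "subtopology (gtop G) U"] unfolding top .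
  have sup: "{x \<in> U. f x \<noteq> 0} \<subseteq> ?K" by (rule closure_of_subset) (auto simp only: top)
  obtain B where B: "compact_open_bisection G B" "?K \<subseteq> B" "B \<subseteq> U"
    using compact_open_between[OF U(1,4) KU] by blast
  have "f x = 0" if "x \<notin> B" for x using that U(2) sup B(2) by blast
  then show "compact_bisection_function f"
    unfolding compact_bisection_function_def
    using B continuous_map_from_subtopology_mono[OF U(3) B(3)] by blast
next
  assume "compact_bisection_function f"
  then obtain B where B: "compact_open_bisection G B" "\<forall>x. x \<notin> B \<longrightarrow> f x = 0"
    "continuous_map (subtopology (gtop G) B) euclidean f"
    unfolding compact_bisection_function_def by blast
  note BD = compact_open_bisectionD[OF B(1)]
  have "compactin (subtopology (gtop G) B) (subtopology (gtop G) B closure_of {x \<in> B. f x \<noteq> 0})"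
    by (rule closedin_compact_space[OF compact_space_subtopology[OF BD(3)] closedin_closure_of])
  then show "bisection_function G f"
    unfolding bisection_function_def using B BD(1) by (auto simp: compactin_subtopology)
qed

lemma Cc_eq: "Cc G = fun_span {f. compact_bisection_function f}"
  by (simp add: Cc_def bisection_function_iff)

lemma compact_bisection_function_convolver:
  assumes "compact_bisection_function f"
  shows "convolver f"
proof -
  obtain B where B: "compact_open_bisection G B" "\<And>x. x \<notin> B \<Longrightarrow> f x = 0"
    "continuous_map (subtopology (gtop G) B) euclidean f"
    using assms unfolding compact_bisection_function_def by blast
  note BD = compact_open_bisectionD[OF B(1)]
  have "compactin (subtopology (gtop G) B) B" using BD(3) by simp
  from image_compactin[OF this B(3)] have "compact (f ` B)" by simp
  from compact_imp_bounded[OF this]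
  obtain M where M: "0 < M" "\<And>x. x \<in> B \<Longrightarrow> cmod (f x) \<le> M"
    unfolding bounded_pos by blast
  have "cmod (f x) \<le> M" for x using M B(2)[of x] by (cases "x \<in> B") auto
  from bisection_opbound[where B = B and f = f, OF BD(4,5,6) B(2) this less_imp_le[OF M(1)]]
  show ?thesis unfolding convolver_def by blast
qed

lemma Cc_convolver: "f \<in> Cc G \<Longrightarrow> convolver f"
  unfolding Cc_eq
  using fun_span_least[OF convolver_subspace, of "{f. compact_bisection_function f}"]
    compact_bisection_function_convolver by blast

lemma Cc_fibre_finite: "f \<in> Cc G \<Longrightarrow> fibre_finite f"
  by (intro convolver_fibre_finite Cc_convolver)

lemma Cc_subspace: "pointwise_subspace (Cc G)"
  unfolding Cc_eq by (rule fun_span_subspace)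

lemma compact_bisection_function_indicator:
  assumes "compact_open_bisection G B"
  shows "compact_bisection_function (indicator B)"
proof -
  have "continuous_map (subtopology (gtop G) B) euclidean (indicator B :: 'g \<Rightarrow> complex)"
    by (rule continuous_map_eq[where f = "\<lambda>x. 1"]) (auto simp: topspace_subtopology)
  then show ?thesis unfolding compact_bisection_function_def using assms by auto
qed

lemma steinberg_subspace: "pointwise_subspace (steinberg G)"
  unfolding steinberg_def by (rule fun_span_subspace)

lemma steinberg_indicator: "compact_open_bisection G B \<Longrightarrow> indicator B \<in> steinberg G"
  unfolding steinberg_def by (rule fun_span_base) blast

lemma steinberg_least:
  assumes "pointwise_subspace V" "\<And>B. compact_open_bisection G B \<Longrightarrow> indicator B \<in> V"
  shows "f \<in> steinberg G \<Longrightarrow> f \<in> V"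
  using fun_span_least[OF assms(1), of "{indicator B |B. compact_open_bisection G B}"] assms(2)
  unfolding steinberg_def by blast

lemma steinberg_Cc: "f \<in> steinberg G \<Longrightarrow> f \<in> Cc G"
  by (rule steinberg_least[OF Cc_subspace])
    (auto simp: Cc_eq intro: fun_span_base compact_bisection_function_indicator)

lemma convolution_outside_product:
  assumes "\<And>x. x \<notin> B \<Longrightarrow> f x = 0" "\<And>x. x \<notin> D \<Longrightarrow> g x = 0" "x \<notin> set_mul G B D"
  shows "convolution G f g x = 0"
proof (rule ccontr)
  assume "convolution G f g x \<noteq> 0"
  then obtain y z where "gsrc G y = gran G z" "x = gmul G y z" "f y \<noteq> 0" "g z \<noteq> 0"
    by (elim convolution_nonzeroE)
  then show False using assms unfolding set_mul_def by blast
qed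

text \<open>On the bisection \<open>B D\<close> the convolution is \<open>f(\<sigma>(x)) g(\<sigma>(x)\<^sup>-\<^sup>1 x)\<close> with the continuous factorization
  of \<open>x\<close> along \<open>B\<close>.\<close>

lemma compact_bisection_function_convolution:
  assumes "compact_bisection_function f" "compact_bisection_function g"
  shows "compact_bisection_function (convolution G f g)"
proof -
  obtain B where B: "compact_open_bisection G B" "\<And>x. x \<notin> B \<Longrightarrow> f x = 0"
    "continuous_map (subtopology (gtop G) B) euclidean f"
    using assms(1) unfolding compact_bisection_function_def by blast
  obtain D where D: "compact_open_bisection G D" "\<And>x. x \<notin> D \<Longrightarrow> g x = 0"
    "continuous_map (subtopology (gtop G) D) euclidean g"
    using assms(2) unfolding compact_bisection_function_def by blast
  note BD = compact_open_bisectionD[OF B(1)] and DD = compact_open_bisectionD[OF D(1)]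
  let ?P = "set_mul G B D"
  have P: "compact_open_bisection G ?P" by (rule compact_open_bisection_set_mul[OF B(1) D(1)])
  define W where "W = {x \<in> elts G. gran G x \<in> gran G ` B}"
  obtain \<sigma> where \<sigma>: "continuous_map (subtopology (gtop G) W) (gtop G) \<sigma>"
    "\<And>x. x \<in> W \<Longrightarrow> \<sigma> x \<in> B \<and> gran G (\<sigma> x) = gran G x"
    "continuous_map (subtopology (gtop G) W) (gtop G) (\<lambda>x. gmul G (ginv G (\<sigma> x)) x)"
    unfolding W_def by (rule bisection_factor[OF BD(1)]) blast
  have PD: "gmul G (ginv G (\<sigma> x)) x \<in> D" if "x \<in> ?P" for x
    using set_mul_bisection_eq[OF BD(1) DD(4), of \<sigma>] \<sigma>(2) that unfolding W_def by auto
  have PW: "?P \<subseteq> W"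
    using set_mul_bisection_eq[OF BD(1) DD(4), of \<sigma>] \<sigma>(2) unfolding W_def by auto
  have s1: "continuous_map (subtopology (gtop G) ?P) (subtopology (gtop G) B) \<sigma>"
    by (rule continuous_map_into_subtopology[OF continuous_map_from_subtopology_mono[OF \<sigma>(1) PW]])
      (use PW \<sigma>(2) in \<open>auto simp: topspace_subtopology\<close>)
  have s2: "continuous_map (subtopology (gtop G) ?P) (subtopology (gtop G) D)
      (\<lambda>x. gmul G (ginv G (\<sigma> x)) x)"
    by (rule continuous_map_into_subtopology[OF continuous_map_from_subtopology_mono[OF \<sigma>(3) PW]])
      (use PD in \<open>auto simp: topspace_subtopology\<close>)
  have "continuous_map (subtopology (gtop G) ?P) euclidean
      (\<lambda>x. f (\<sigma> x) * g (gmul G (ginv G (\<sigma> x)) x))"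
    using continuous_map_compose[OF s1 B(3)] continuous_map_compose[OF s2 D(3)]
    by (simp add: continuous_map_atin o_def tendsto_mult)
  then have "continuous_map (subtopology (gtop G) ?P) euclidean (convolution G f g)"
  proof (rule continuous_map_eq)
    fix x assume "x \<in> topspace (subtopology (gtop G) ?P)"
    then have x: "x \<in> W" "x \<in> elts G" using PW by (auto simp: topspace_subtopology)
    show "f (\<sigma> x) * g (gmul G (ginv G (\<sigma> x)) x) = convolution G f g x"
      by (rule bisection_convolution[where B = B and f = f, OF BD(5) B(2), symmetric]) (use x \<sigma>(2)[OF x(1)] BD(4) in blast)+
  qed
  moreover have "\<forall>x. x \<notin> ?P \<longrightarrow> convolution G f g x = 0"
    using convolution_outside_product[where f = f and g = g, OF B(2) D(2)] by blast
  ultimately show ?thesis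
    unfolding compact_bisection_function_def using P by blast
qed

lemma convolution_indicator_bisections:
  assumes B: "open_bisection G B" and D: "open_bisection G D"
  shows "convolution G (indicator B) (indicator D) = indicator (set_mul G B D)"
proof
  fix x
  show "convolution G (indicator B) (indicator D) x = indicator (set_mul G B D) x"
  proof (cases "x \<in> set_mul G B D")
    case True
    then obtain b d where x: "b \<in> B" "d \<in> D" "gsrc G b = gran G d" "x = gmul G b d"
      unfolding set_mul_def by blast
    then have e: "b \<in> elts G" "d \<in> elts G" using bisection_subset[OF B] bisection_subset[OF D] by auto
    have "convolution G (indicator B) (indicator D) x
        = indicator B b * indicator D (gmul G (ginv G b) x)"
      by (rule bisection_convolution[where f = "indicator B", OF bisection_inj(1)[OF B]]) (use x e in auto)
    then show ?thesis using True x e by simp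
  next
    case False
    then show ?thesis using convolution_outside_product[of B "indicator B" D "indicator D"] by simp
  qed
qed

lemma compact_bisection_function_involution:
  assumes "compact_bisection_function f"
  shows "compact_bisection_function (involution G f)"
proof -
  obtain B where B: "compact_open_bisection G B" "\<And>x. x \<notin> B \<Longrightarrow> f x = 0"
    "continuous_map (subtopology (gtop G) B) euclidean f"
    using assms unfolding compact_bisection_function_def by blast
  note BD = compact_open_bisectionD[OF B(1)]
  let ?I = "ginv G ` B"
  have "continuous_map (subtopology (gtop G) ?I) (subtopology (gtop G) B) (ginv G)"
    by (intro continuous_map_into_subtopology continuous_map_from_subtopology continuous_inv)
      (use BD(4) in \<open>auto simp: topspace_subtopology subset_iff\<close>)
  from continuous_map_compose[OF this B(3)]
  have "continuous_map (subtopology (gtop G) ?I) euclidean (\<lambda>x. cnj (f (ginv G x)))"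
    by (simp add: continuous_map_atin o_def tendsto_cnj)
  then have "continuous_map (subtopology (gtop G) ?I) euclidean (involution G f)"
    by (rule continuous_map_eq) (auto simp: involution_def topspace_subtopology)
  moreover have "\<forall>x. x \<notin> ?I \<longrightarrow> involution G f x = 0"
  proof (intro allI impI)
    fix x assume x: "x \<notin> ?I"
    have "x \<in> ?I" if "x \<in> elts G" "ginv G x \<in> B"
      using that inv_inv[OF that(1)] by (metis imageI)
    then show "involution G f x = 0" using x B(2) by (auto simp: involution_def)
  qed
  ultimately show ?thesis
    unfolding compact_bisection_function_def using compact_open_bisection_inverse[OF B(1)] by blast
qed

lemma involution_indicator:
  assumes "B \<subseteq> elts G"
  shows "involution G (indicator B) = indicator (ginv G ` B)"
proof
  fix x
  have "ginv G x \<in> B \<longleftrightarrow> x \<in> ginv G ` B" if x: "x \<in> elts G"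
  proof
    assume "ginv G x \<in> B"
    then have "ginv G (ginv G x) \<in> ginv G ` B" by (rule imageI)
    then show "x \<in> ginv G ` B" by (simp only: inv_inv[OF x])
  qed (use assms in auto)
  moreover have "x \<in> elts G" if "x \<in> ginv G ` B" using that assms by auto
  ultimately show "involution G (indicator B) x = indicator (ginv G ` B) x"
    by (auto simp: involution_def indicator_def)
qed

lemma involution_subspace:
  assumes "pointwise_subspace V"
  shows "pointwise_subspace {f. involution G f \<in> V}"
proof -
  have "involution G (\<lambda>x. 0) = (\<lambda>x. 0)" by (auto simp: involution_def)
  then show ?thesis
    using assms unfolding pointwise_subspace_def by (simp add: involution_add involution_scale)
qed

lemma Cc_convolution: "f \<in> Cc G \<Longrightarrow> g \<in> Cc G \<Longrightarrow> convolution G f g \<in> Cc G"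
  unfolding Cc_eq
  by (rule convolution_fun_span[OF fun_span_subspace])
    (auto intro: fun_span_base compact_bisection_function_convolution convolver_fibre_finite
      compact_bisection_function_convolver)

lemma Cc_involution:
  assumes "f \<in> Cc G"
  shows "involution G f \<in> Cc G"
proof -
  have "fun_span {f. compact_bisection_function f} \<subseteq> {f. involution G f \<in> Cc G}"
    by (rule fun_span_least[OF involution_subspace[OF Cc_subspace]])
      (auto simp: Cc_eq intro: fun_span_base compact_bisection_function_involution)
  then show ?thesis using assms unfolding Cc_eq by blast
qed

lemma steinberg_convolution:
  assumes "f \<in> steinberg G" "g \<in> steinberg G"
  shows "convolution G f g \<in> steinberg G"
proof (rule convolution_fun_span[OF steinberg_subspace])
  let ?X = "{indicator B |B. compact_open_bisection G B} :: ('g \<Rightarrow> complex) set"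
  show "f \<in> fun_span ?X" "g \<in> fun_span ?X" using assms unfolding steinberg_def by auto
  show "fibre_finite h" if "h \<in> ?X" for h
    using that steinberg_indicator steinberg_Cc Cc_fibre_finite by blast
  show "convolution G h h' \<in> steinberg G" if "h \<in> ?X" "h' \<in> ?X" for h h'
    using that compact_open_bisectionD(1)
    by (auto simp: convolution_indicator_bisections intro!: steinberg_indicator compact_open_bisection_set_mul)
qed

lemma steinberg_involution: "f \<in> steinberg G \<Longrightarrow> involution G f \<in> steinberg G"
  using steinberg_least[OF involution_subspace[OF steinberg_subspace]]
  by (simp add: steinberg_indicator compact_open_bisection_inverse involution_indicator
      compact_open_bisectionD(4))

text \<open>A continuous function on a compact open bisection is a uniform limit of functions that are
  locally constant there, and on a bisection the reduced norm is at most the supremum norm.\<close>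

lemma steinberg_dense:
  assumes "f \<in> Cc G" "0 < e"
  shows "\<exists>g\<in>steinberg G. reduced_norm G (\<lambda>x. f x + - 1 * g x) < e"
proof -
  have base: "\<exists>g\<in>steinberg G. reduced_norm G (\<lambda>x. f x + - 1 * g x) < e"
    if f: "compact_bisection_function f" and e: "0 < e" for f e
  proof -
    obtain B where B: "compact_open_bisection G B" "\<And>x. x \<notin> B \<Longrightarrow> f x = 0"
      "continuous_map (subtopology (gtop G) B) euclidean f"
      using f unfolding compact_bisection_function_def by blast
    note BD = compact_open_bisectionD[OF B(1)]
    have top: "topspace (subtopology (gtop G) B) = B" using BD by (auto simp: topspace_subtopology)
    define P where "P D \<longleftrightarrow> (\<exists>g\<in>steinberg G. (\<forall>x. x \<notin> D \<longrightarrow> g x = 0) \<and>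
      (\<forall>x\<in>D. cmod (f x + - 1 * g x) \<le> e / 2))" for D
    have "P B"
    proof (rule compact_open_induct[OF B(1)])
      show "P {}" unfolding P_def using pointwise_subspaceD(1)[OF steinberg_subspace] by auto
    next
      fix x assume x: "x \<in> B"
      have "openin (subtopology (gtop G) B) {y \<in> topspace (subtopology (gtop G) B). f y \<in> ball (f x) (e / 2)}"
        by (rule openin_continuous_map_preimage[OF B(3)]) simp
      then have "openin (gtop G) {y \<in> B. f y \<in> ball (f x) (e / 2)}"
        unfolding top by (rule openin_trans_full[OF _ BD(2)])
      moreover have "x \<in> {y \<in> B. f y \<in> ball (f x) (e / 2)}" using x e by simp
      ultimately obtain D where D: "compact_open_bisection G D" "x \<in> D"
        "D \<subseteq> {y \<in> B. f y \<in> ball (f x) (e / 2)}" using ample_basis by blast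
      have "P E" if E: "compact_open_bisection G E" "E \<subseteq> D" for E
        unfolding P_def
      proof (intro bexI conjI allI impI ballI)
        show "(\<lambda>y. f x * indicator E y) \<in> steinberg G"
          by (rule pointwise_subspaceD(3)[OF steinberg_subspace steinberg_indicator[OF E(1)]])
        show "cmod (f y + - 1 * (f x * indicator E y)) \<le> e / 2" if "y \<in> E" for y
        proof -
          have "dist (f x) (f y) < e / 2" using that E(2) D(3) by auto
          then show ?thesis using that by (simp add: dist_norm norm_minus_commute)
        qed
      qed auto
      then show "\<exists>D. compact_open_bisection G D \<and> x \<in> D \<and> D \<subseteq> B \<and>
          (\<forall>E. compact_open_bisection G E \<longrightarrow> E \<subseteq> D \<longrightarrow> P E)" using D by blast
    next
      fix D E assume disj: "D \<inter> E = {}" and "P D" "P E"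
      then obtain g h where g: "g \<in> steinberg G" "\<And>x. x \<notin> D \<Longrightarrow> g x = 0"
        "\<And>x. x \<in> D \<Longrightarrow> cmod (f x + - 1 * g x) \<le> e / 2"
        and h: "h \<in> steinberg G" "\<And>x. x \<notin> E \<Longrightarrow> h x = 0"
        "\<And>x. x \<in> E \<Longrightarrow> cmod (f x + - 1 * h x) \<le> e / 2" unfolding P_def by meson
      show "P (D \<union> E)"
        unfolding P_def
      proof (intro bexI conjI allI impI ballI)
        show "(\<lambda>x. g x + h x) \<in> steinberg G" by (rule pointwise_subspaceD(2)[OF steinberg_subspace g(1) h(1)])
        show "cmod (f x + - 1 * (g x + h x)) \<le> e / 2" if "x \<in> D \<union> E" for x
        proof (cases "x \<in> D")
          case True
          then have "h x = 0" using disj h(2) by blast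
          then show ?thesis using g(3)[OF True] by simp
        next
          case False
          then show ?thesis using g(2)[OF False] h(3)[of x] that by simp
        qed
      qed (use g h in auto)
    qed
    then obtain g where g: "g \<in> steinberg G" "\<And>x. x \<notin> B \<Longrightarrow> g x = 0"
      "\<And>x. x \<in> B \<Longrightarrow> cmod (f x + - 1 * g x) \<le> e / 2" unfolding P_def by blast
    have out: "f x + - 1 * g x = 0" if "x \<notin> B" for x using that B(2) g(2) by simp
    have le: "cmod (f x + - 1 * g x) \<le> e / 2" for x
      using g(3)[of x] out[of x] e by (cases "x \<in> B") auto
    have e2: "0 \<le> e / 2" using e by simp
    have op: "opbound (\<lambda>x. f x + - 1 * g x) (e / 2)"
      by (rule bisection_opbound(2)[where B = B, OF BD(4,5,6) _ le e2]) (rule out)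
    have "convolver (\<lambda>x. f x + - 1 * g x)"
      by (intro convolver_add convolver_scale compact_bisection_function_convolver[OF f]
          Cc_convolver[OF steinberg_Cc[OF g(1)]])
    from reduced_norm_least[OF this op] show ?thesis using g(1) e by force
  qed
  let ?V = "{f \<in> Cc G. \<forall>e>0. \<exists>g\<in>steinberg G. reduced_norm G (\<lambda>x. f x + - 1 * g x) < e}"
  have dc: "convolver (\<lambda>x. f x + - 1 * g x)" if "f \<in> Cc G" "g \<in> steinberg G" for f g
    by (rule convolver_add[OF Cc_convolver[OF that(1)]
          convolver_scale[OF Cc_convolver[OF steinberg_Cc[OF that(2)]]]])
  have "pointwise_subspace ?V"
    unfolding pointwise_subspace_def
  proof (intro conjI ballI allI)
    have "reduced_norm G (\<lambda>x. 0 + - 1 * (0::complex)) = 0" by (simp add: reduced_norm_zero)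
    then show "(\<lambda>x. 0) \<in> ?V"
      using pointwise_subspaceD(1)[OF Cc_subspace] pointwise_subspaceD(1)[OF steinberg_subspace] by force
  next
    fix f f' assume f: "f \<in> ?V" and f': "f' \<in> ?V"
    have "\<exists>h\<in>steinberg G. reduced_norm G (\<lambda>x. f x + f' x + - 1 * h x) < e" if "0 < e" for e
    proof -
      have "0 < e / 2" using that by simp
      then obtain g g' where g: "g \<in> steinberg G" "reduced_norm G (\<lambda>x. f x + - 1 * g x) < e / 2"
        and g': "g' \<in> steinberg G" "reduced_norm G (\<lambda>x. f' x + - 1 * g' x) < e / 2"
        using f f' by blast
      have eq: "(\<lambda>x. f x + f' x + - 1 * (g x + g' x)) = (\<lambda>x. (f x + - 1 * g x) + (f' x + - 1 * g' x))"
        by (simp add: algebra_simps)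
      have conv: "convolver (\<lambda>x. f x + - 1 * g x)" "convolver (\<lambda>x. f' x + - 1 * g' x)"
        using f f' g(1) g'(1) dc by blast+
      have "reduced_norm G (\<lambda>x. f x + f' x + - 1 * (g x + g' x)) < e"
        unfolding eq using reduced_norm_add[OF conv] g(2) g'(2) by linarith
      then show ?thesis
        by (rule bexI[where x = "\<lambda>x. g x + g' x"])
          (rule pointwise_subspaceD(2)[OF steinberg_subspace g(1) g'(1)])
    qed
    then show "(\<lambda>x. f x + f' x) \<in> ?V" using f f' pointwise_subspaceD(2)[OF Cc_subspace] by blast
  next
    fix k f assume f: "f \<in> ?V"
    have "\<exists>h\<in>steinberg G. reduced_norm G (\<lambda>x. k * f x + - 1 * h x) < e" if "0 < e" for e
    proof -
      have "0 < e / (cmod k + 1)" using that by (simp add: add_nonneg_pos)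
      then obtain g where g: "g \<in> steinberg G" "reduced_norm G (\<lambda>x. f x + - 1 * g x) < e / (cmod k + 1)"
        using f by blast
      have conv: "convolver (\<lambda>x. f x + - 1 * g x)"
        using f g(1) dc by blast
      have eq: "(\<lambda>x. k * f x + - 1 * (k * g x)) = (\<lambda>x. k * (f x + - 1 * g x))"
        by (simp add: algebra_simps)
      have "cmod k * reduced_norm G (\<lambda>x. f x + - 1 * g x)
          \<le> (cmod k + 1) * reduced_norm G (\<lambda>x. f x + - 1 * g x)"
        by (intro mult_right_mono reduced_norm_nonneg conv) simp
      also have "\<dots> < e" using g(2) by (simp add: add_nonneg_pos pos_less_divide_eq mult.commute)
      finally have "reduced_norm G (\<lambda>x. k * f x + - 1 * (k * g x)) < e"
        unfolding eq reduced_norm_scale[OF conv] .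
      then show ?thesis
        by (rule bexI[where x = "\<lambda>x. k * g x"]) (rule pointwise_subspaceD(3)[OF steinberg_subspace g(1)])
    qed
    then show "(\<lambda>x. k * f x) \<in> ?V" using f pointwise_subspaceD(3)[OF Cc_subspace] by blast
  qed
  moreover have "{f. compact_bisection_function f} \<subseteq> ?V"
    using base fun_span_base unfolding Cc_eq by blast
  ultimately have "Cc G \<subseteq> ?V" using fun_span_least unfolding Cc_eq by blast
  then show ?thesis using assms by blast
qed

section \<open>The algebras \<open>A(G)\<close> and \<open>C\<^sub>c(G)\<close>\<close>

lemma Cc_algebra_simps [simp]:
  "carrier (Cc_algebra G) = Cc G" "mult (Cc_algebra G) = convolution G"
  "add (Cc_algebra G) = (\<lambda>f g x. f x + g x)" "zero (Cc_algebra G) = (\<lambda>x. 0)"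
  "ascale (Cc_algebra G) = (\<lambda>k f x. k * f x)" "astar (Cc_algebra G) = involution G"
  "anorm (Cc_algebra G) = reduced_norm G"
  by (simp_all add: Cc_algebra_def)

lemma steinberg_ring_simps [simp]:
  "carrier (steinberg_ring G) = steinberg G" "mult (steinberg_ring G) = convolution G"
  "add (steinberg_ring G) = (\<lambda>f g x. f x + g x)" "zero (steinberg_ring G) = (\<lambda>x. 0)"
  by (simp_all add: steinberg_ring_def)

text \<open>Serves both \<open>A(G)\<close> and \<open>C\<^sub>c(G)\<close>, which are records of different types.\<close>

lemma pointwise_nonunital_ring:
  fixes R :: "('g \<Rightarrow> complex, 'm) ring_scheme"
  assumes R: "add R = (\<lambda>f g x. f x + g x)" "zero R = (\<lambda>x. 0)" "mult R = convolution G"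
    and V: "pointwise_subspace (carrier R)" "carrier R \<subseteq> Cc G"
    and mult: "\<And>f g. f \<in> carrier R \<Longrightarrow> g \<in> carrier R \<Longrightarrow> convolution G f g \<in> carrier R"
  shows "nonunital_ring R"
proof (intro nonunital_ring.intro nonunital_ring_axioms.intro abelian_groupI)
  note ff = Cc_fibre_finite[OF subsetD[OF V(2)]]
  fix f assume f: "f \<in> carrier R"
  have "(\<lambda>x. - 1 * f x) \<oplus>\<^bsub>R\<^esub> f = \<zero>\<^bsub>R\<^esub>" by (simp add: R)
  then show "\<exists>y\<in>carrier R. y \<oplus>\<^bsub>R\<^esub> f = \<zero>\<^bsub>R\<^esub>" using pointwise_subspaceD(3)[OF V(1) f] by blast
  fix g h assume g: "g \<in> carrier R" and h: "h \<in> carrier R"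
  show "f \<otimes>\<^bsub>R\<^esub> g \<otimes>\<^bsub>R\<^esub> h = f \<otimes>\<^bsub>R\<^esub> (g \<otimes>\<^bsub>R\<^esub> h)"
    unfolding R by (rule convolution_assoc[OF ff[OF f] ff[OF g]])
  show "(f \<oplus>\<^bsub>R\<^esub> g) \<otimes>\<^bsub>R\<^esub> h = f \<otimes>\<^bsub>R\<^esub> h \<oplus>\<^bsub>R\<^esub> g \<otimes>\<^bsub>R\<^esub> h"
    unfolding R by (rule convolution_add_left[OF ff[OF f] ff[OF g]])
  show "h \<otimes>\<^bsub>R\<^esub> (f \<oplus>\<^bsub>R\<^esub> g) = h \<otimes>\<^bsub>R\<^esub> f \<oplus>\<^bsub>R\<^esub> h \<otimes>\<^bsub>R\<^esub> g"
    unfolding R by (rule convolution_add_right[OF ff[OF h]])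
qed (use R V mult pointwise_subspaceD in \<open>auto simp: add.assoc add.commute\<close>)

lemma nonunital_ring_Cc: "nonunital_ring (Cc_algebra G)"
  by (rule pointwise_nonunital_ring) (auto simp: Cc_subspace Cc_convolution)

lemma nonunital_ring_steinberg: "nonunital_ring (steinberg_ring G)"
  by (rule pointwise_nonunital_ring) (auto simp: steinberg_subspace steinberg_convolution steinberg_Cc)

lemma pre_cstar_Cc: "pre_cstar_algebra (Cc_algebra G)"
proof (intro pre_cstar_algebra.intro nonunital_ring_Cc pre_cstar_algebra_axioms.intro)
  fix f assume "f \<in> carrier (Cc_algebra G)"
  then have f: "f \<in> Cc G" "convolver f" by (auto intro: Cc_convolver)
  show "astar (Cc_algebra G) (astar (Cc_algebra G) f) = f"
    using fibre_finiteD(1)[OF Cc_fibre_finite[OF f(1)]] by (simp add: involution_involution)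
  show "anorm (Cc_algebra G) (astar (Cc_algebra G) f \<otimes>\<^bsub>Cc_algebra G\<^esub> f) = (anorm (Cc_algebra G) f)\<^sup>2"
    using reduced_norm_cstar[OF f(2)] by simp
qed (auto simp: pointwise_subspaceD[OF Cc_subspace] Cc_involution involution_add involution_scale
    involution_convolution reduced_norm_nonneg reduced_norm_eq_0_iff reduced_norm_add reduced_norm_scale
    reduced_norm_convolution Cc_convolver convolution_scale_left convolution_scale_right distrib_left
    distrib_right mult.assoc)

lemma pointwise_finsum:
  fixes R :: "('g \<Rightarrow> complex, 'm) ring_scheme"
  assumes "abelian_monoid R" "add R = (\<lambda>f g x. f x + g x)" "zero R = (\<lambda>x. 0)"
    and "finite F" "\<And>i. i \<in> F \<Longrightarrow> a i \<in> carrier R"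
  shows "finsum R a F = (\<lambda>x. \<Sum>i\<in>F. a i x)"
  using assms(4,5)
proof (induction F)
  case empty
  then show ?case using abelian_monoid.finsum_empty[OF assms(1)] assms(3) by simp
next
  case (insert i F)
  then have "finsum R a (insert i F) = a i \<oplus>\<^bsub>R\<^esub> finsum R a F"
    by (intro abelian_monoid.finsum_insert[OF assms(1)]) auto
  then show ?case using insert by (simp add: assms(2))
qed

lemmas abelian_monoid_Cc = abelian_group.axioms(1)[OF nonunital_ring.axioms(1)[OF nonunital_ring_Cc]]
  and abelian_monoid_steinberg =
    abelian_group.axioms(1)[OF nonunital_ring.axioms(1)[OF nonunital_ring_steinberg]]

lemmas finsum_Cc = pointwise_finsum[OF abelian_monoid_Cc, simplified]
  and finsum_steinberg = pointwise_finsum[OF abelian_monoid_steinberg, simplified]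

lemma diff_Cc:
  assumes "f \<in> Cc G" "g \<in> Cc G"
  shows "f \<ominus>\<^bsub>Cc_algebra G\<^esub> g = (\<lambda>x. f x + - 1 * g x)"
  using pre_cstar_algebra.diff_eq[OF pre_cstar_Cc, of f g] assms by simp

end

section \<open>The grading defined by a cocycle\<close>

context nonunital_ring
begin

lemma product_sums_zero: "\<zero> \<in> product_sums R X Y"
  unfolding product_sums_def by (intro CollectI exI[of _ 0]) auto

lemma product_sums_snoc:
  assumes XY: "X \<subseteq> carrier R" "Y \<subseteq> carrier R"
    and s: "s \<in> product_sums R X Y" and x: "x \<in> X" and y: "y \<in> Y"
  shows "x \<otimes> y \<oplus> s \<in> product_sums R X Y"
proof -
  obtain n :: nat and a b where s: "s = (\<Oplus>i\<in>{..<n}. a i \<otimes> b i)" "a \<in> {..<n} \<rightarrow> X" "b \<in> {..<n} \<rightarrow> Y"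
    using s unfolding product_sums_def by blast
  define a' b' where "a' = a(n := x)" and "b' = b(n := y)"
  have ab: "a i \<in> carrier R" "b i \<in> carrier R" if "i < n" for i
    using s(2,3) XY that by (auto simp: Pi_iff)
  have "(\<Oplus>i\<in>{..<Suc n}. a' i \<otimes> b' i) = a' n \<otimes> b' n \<oplus> (\<Oplus>i\<in>{..<n}. a' i \<otimes> b' i)"
    unfolding lessThan_Suc a'_def b'_def
    by (rule finsum_insert) (use ab x y XY in \<open>auto intro: mult_closed\<close>)
  also have "(\<Oplus>i\<in>{..<n}. a' i \<otimes> b' i) = s"
    unfolding s(1) a'_def b'_def by (rule finsum_cong') (use ab in \<open>auto intro: mult_closed\<close>)
  finally have "x \<otimes> y \<oplus> s = (\<Oplus>i\<in>{..<Suc n}. a' i \<otimes> b' i)" by (simp add: a'_def b'_def)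
  moreover have "a' \<in> {..<Suc n} \<rightarrow> X" "b' \<in> {..<Suc n} \<rightarrow> Y"
    using s x y by (auto simp: a'_def b'_def less_Suc_eq)
  ultimately show ?thesis unfolding product_sums_def by blast
qed

lemma product_sums_add:
  assumes XY: "X \<subseteq> carrier R" "Y \<subseteq> carrier R"
    and s: "s \<in> product_sums R X Y" and t: "t \<in> product_sums R X Y"
  shows "s \<oplus> t \<in> product_sums R X Y"
proof -
  obtain n :: nat and a b where s: "s = (\<Oplus>i\<in>{..<n}. a i \<otimes> b i)" "a \<in> {..<n} \<rightarrow> X" "b \<in> {..<n} \<rightarrow> Y"
    using s unfolding product_sums_def by blast
  have ab: "a i \<in> X" "b i \<in> Y" "a i \<otimes> b i \<in> carrier R" if "i < n" for i
    using s(2,3) XY that by (auto simp: Pi_iff intro!: mult_closed)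
  have tR: "t \<in> carrier R"
    using t XY unfolding product_sums_def by (auto intro!: finsum_closed mult_closed simp: Pi_iff)
  \<comment> \<open>Add the products that make up \<open>s\<close> to \<open>t\<close> one at a time.\<close>
  have "(\<Oplus>i\<in>{..<m}. a i \<otimes> b i) \<oplus> t \<in> product_sums R X Y" if "m \<le> n" for m
    using that
  proof (induction m)
    case 0
    then show ?case using t tR by simp
  next
    case (Suc m)
    let ?u = "\<Oplus>i\<in>{..<m}. a i \<otimes> b i"
    have u: "?u \<in> carrier R" using Suc.prems ab(3) by (intro finsum_closed) auto
    have "(\<Oplus>i\<in>{..<Suc m}. a i \<otimes> b i) = a m \<otimes> b m \<oplus> ?u"
      unfolding lessThan_Suc by (rule finsum_insert) (use Suc.prems ab(3) in auto)
    then have "(\<Oplus>i\<in>{..<Suc m}. a i \<otimes> b i) \<oplus> t = a m \<otimes> b m \<oplus> (?u \<oplus> t)"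
      using u tR ab(3)[of m] Suc.prems by (simp add: a_assoc)
    then show ?case
      using product_sums_snoc[OF XY Suc.IH ab(1,2)] Suc.prems by simp
  qed
  from this[of n] show ?thesis unfolding s(1) by simp
qed

end

locale cocycle_groupoid = hausdorff_ample_groupoid G + grading: group \<Gamma>
  for G :: "('g, 'x) tgroupoid_scheme" and \<Gamma> :: "('k, 'm) monoid_scheme" +
  fixes c :: "'g \<Rightarrow> 'k"
  assumes cocycle: "continuous_cocycle G \<Gamma> c"
begin

abbreviation "component \<equiv> groupoid_component G c"

abbreviation "graded_part \<equiv> steinberg_component G c"

lemma continuous_c: "continuous_map (gtop G) (discrete_topology (carrier \<Gamma>)) c"
  using cocycle unfolding continuous_cocycle_def by blast

lemma c_closed: "x \<in> elts G \<Longrightarrow> c x \<in> carrier \<Gamma>"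
  using continuous_c by (auto simp: continuous_map_def)

lemma c_mul: "x \<in> elts G \<Longrightarrow> y \<in> elts G \<Longrightarrow> gsrc G x = gran G y \<Longrightarrow> c (gmul G x y) = c x \<otimes>\<^bsub>\<Gamma>\<^esub> c y"
  using cocycle unfolding continuous_cocycle_def by auto

lemma c_unit:
  assumes "u \<in> gunits G"
  shows "c u = \<one>\<^bsub>\<Gamma>\<^esub>"
proof -
  have "gmul G u u = u" using assms ran_unit[of u] by simp
  then have "c u \<otimes>\<^bsub>\<Gamma>\<^esub> c u = c u" using c_mul[of u u] assms by simp
  then show ?thesis using c_closed[of u] assms by (simp add: grading.r_cancel_one)
qed

lemma c_inv:
  assumes "x \<in> elts G"
  shows "c (ginv G x) = inv\<^bsub>\<Gamma>\<^esub> (c x)"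
proof -
  have "c (ginv G x) \<otimes>\<^bsub>\<Gamma>\<^esub> c x = \<one>\<^bsub>\<Gamma>\<^esub>"
    using c_mul[of "ginv G x" x] c_unit[of "gsrc G x"] assms by simp
  then show ?thesis using grading.inv_equality c_closed assms by simp
qed

lemma component_iff: "x \<in> component \<gamma> \<longleftrightarrow> x \<in> elts G \<and> c x = \<gamma>"
  by (simp add: groupoid_component_def)

lemma component_clopen:
  assumes "\<gamma> \<in> carrier \<Gamma>"
  shows "openin (gtop G) (component \<gamma>)" "closedin (gtop G) (component \<gamma>)"
proof -
  have eq: "component \<gamma> = {x \<in> elts G. c x \<in> {\<gamma>}}" by (auto simp: component_iff)
  show "openin (gtop G) (component \<gamma>)"
    unfolding eq by (rule openin_continuous_map_preimage[OF continuous_c]) (use assms in simp)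
  show "closedin (gtop G) (component \<gamma>)"
    unfolding eq by (rule closedin_continuous_map_preimage[OF continuous_c]) (use assms in simp)
qed

lemma compact_open_bisection_component:
  assumes B: "compact_open_bisection G B" and \<gamma>: "\<gamma> \<in> carrier \<Gamma>"
  shows "compact_open_bisection G (B \<inter> component \<gamma>)"
proof (rule compact_sub_bisection[OF B])
  show "openin (gtop G) (B \<inter> component \<gamma>)"
    by (rule openin_Int[OF compact_open_bisectionD(2)[OF B] component_clopen(1)[OF \<gamma>]])
  show "closedin (subtopology (gtop G) B) (B \<inter> component \<gamma>)"
    by (rule closedin_subtopology_Int_closed[OF component_clopen(2)[OF \<gamma>]])
qed

lemma graded_partD:
  assumes "f \<in> graded_part \<gamma>"
  shows "f \<in> steinberg G" "f \<in> Cc G" "f x \<noteq> 0 \<Longrightarrow> x \<in> elts G" "f x \<noteq> 0 \<Longrightarrow> c x = \<gamma>"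
  using assms steinberg_Cc unfolding steinberg_component_def by (auto simp: component_iff)

lemma graded_part_subspace: "pointwise_subspace (graded_part \<gamma>)"
  unfolding pointwise_subspace_def
proof (intro conjI ballI allI)
  show "(\<lambda>x. 0) \<in> graded_part \<gamma>"
    using pointwise_subspaceD(1)[OF steinberg_subspace] by (simp add: steinberg_component_def)
  show "(\<lambda>x. f x + g x) \<in> graded_part \<gamma>" if "f \<in> graded_part \<gamma>" "g \<in> graded_part \<gamma>" for f g
  proof -
    have "x \<in> component \<gamma>" if "f x + g x \<noteq> 0" for x
    proof -
      have "f x \<noteq> 0 \<or> g x \<noteq> 0" using that by auto
      then show ?thesis
        using \<open>f \<in> graded_part \<gamma>\<close> \<open>g \<in> graded_part \<gamma>\<close> unfolding steinberg_component_def by blast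
    qed
    then show ?thesis
      using that pointwise_subspaceD(2)[OF steinberg_subspace] unfolding steinberg_component_def by blast
  qed
  show "(\<lambda>x. k * f x) \<in> graded_part \<gamma>" if "f \<in> graded_part \<gamma>" for k f
    using that pointwise_subspaceD(3)[OF steinberg_subspace] unfolding steinberg_component_def by auto
qed

lemma graded_part_convolution:
  assumes "f \<in> graded_part \<alpha>" "g \<in> graded_part \<beta>"
  shows "convolution G f g \<in> graded_part (\<alpha> \<otimes>\<^bsub>\<Gamma>\<^esub> \<beta>)"
proof -
  have "x \<in> component (\<alpha> \<otimes>\<^bsub>\<Gamma>\<^esub> \<beta>)" if "convolution G f g x \<noteq> 0" for x
  proof -
    obtain y z where x: "y \<in> elts G" "z \<in> elts G" "gsrc G y = gran G z" "x = gmul G y z"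
      "f y \<noteq> 0" "g z \<noteq> 0" using \<open>convolution G f g x \<noteq> 0\<close> by (elim convolution_nonzeroE)
    then show ?thesis
      using graded_partD(4)[OF assms(1)] graded_partD(4)[OF assms(2)] by (simp add: component_iff c_mul)
  qed
  then show ?thesis
    using steinberg_convolution[OF graded_partD(1)[OF assms(1)] graded_partD(1)[OF assms(2)]]
    unfolding steinberg_component_def by blast
qed

lemma graded_part_involution:
  assumes f: "f \<in> graded_part \<gamma>"
  shows "involution G f \<in> graded_part (inv\<^bsub>\<Gamma>\<^esub> \<gamma>)"
proof -
  have "x \<in> component (inv\<^bsub>\<Gamma>\<^esub> \<gamma>)" if "involution G f x \<noteq> 0" for x
  proof -
    have x: "x \<in> elts G" "f (ginv G x) \<noteq> 0" using that by (auto simp: involution_def split: if_splits)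
    then have "inv\<^bsub>\<Gamma>\<^esub> (c x) = \<gamma>" using graded_partD(4)[OF f x(2)] c_inv by simp
    then have "inv\<^bsub>\<Gamma>\<^esub> \<gamma> = c x" using grading.inv_inv[OF c_closed[OF x(1)]] by simp
    then show ?thesis using x(1) by (simp add: component_iff)
  qed
  then show ?thesis
    using steinberg_involution[OF graded_partD(1)[OF f]] unfolding steinberg_component_def by blast
qed

subsection \<open>Homogeneous parts of a function\<close>

definition part :: "'k \<Rightarrow> ('g \<Rightarrow> complex) \<Rightarrow> 'g \<Rightarrow> complex"
  where "part \<gamma> f x = indicator (component \<gamma>) x * f x"

lemma part_subspace: "pointwise_subspace V \<Longrightarrow> pointwise_subspace {f. part \<gamma> f \<in> V}"
  unfolding pointwise_subspace_def part_def[abs_def]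
  by (auto simp: distrib_left mult.left_commute)

lemma part_indicator: "part \<gamma> (indicator B) = indicator (B \<inter> component \<gamma>)"
  by (auto simp: part_def indicator_def fun_eq_iff)

lemma part_graded_part:
  assumes "f \<in> steinberg G" "\<gamma> \<in> carrier \<Gamma>"
  shows "part \<gamma> f \<in> graded_part \<gamma>"
proof -
  have "f \<in> {f. part \<gamma> f \<in> steinberg G}"
    by (rule steinberg_least[OF part_subspace[OF steinberg_subspace] _ assms(1)])
      (simp add: part_indicator steinberg_indicator compact_open_bisection_component assms(2))
  then show ?thesis by (auto simp: steinberg_component_def part_def indicator_def split: if_splits)
qed

text \<open>Taking the part of degree \<open>\<gamma>\<close> is linear and sends \<open>1\<^sub>B\<close> to the indicator of \<open>B \<inter> G\<^sub>\<gamma>\<close>. Hence a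
  homogeneous function is a combination of indicators that are themselves homogeneous.\<close>

lemma graded_part_span:
  assumes \<gamma>: "\<gamma> \<in> carrier \<Gamma>" and V: "pointwise_subspace V"
    and ind: "\<And>B. compact_open_bisection G B \<Longrightarrow> B \<subseteq> component \<gamma> \<Longrightarrow> indicator B \<in> V"
    and f: "f \<in> graded_part \<gamma>"
  shows "f \<in> V"
proof -
  have "f \<in> {f. part \<gamma> f \<in> V}"
    by (rule steinberg_least[OF part_subspace[OF V] _ graded_partD(1)[OF f]])
      (simp add: part_indicator ind compact_open_bisection_component \<gamma>)
  moreover have "part \<gamma> f = f"
    using f by (auto simp: part_def steinberg_component_def indicator_def fun_eq_iff)
  ultimately show ?thesis by simp
qed

text \<open>The continuous cocycle takes only finitely many values on a compact set.\<close>

lemma steinberg_finite_degrees: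
  assumes "f \<in> steinberg G"
  shows "\<exists>F. finite F \<and> F \<subseteq> carrier \<Gamma> \<and> (\<forall>x. f x \<noteq> 0 \<longrightarrow> x \<in> elts G \<and> c x \<in> F)"
proof -
  let ?V = "{f. \<exists>F. finite F \<and> F \<subseteq> carrier \<Gamma> \<and> (\<forall>x. f x \<noteq> (0::complex) \<longrightarrow> x \<in> elts G \<and> c x \<in> F)}"
  have "pointwise_subspace ?V"
    unfolding pointwise_subspace_def
  proof (intro conjI ballI allI)
    fix f g assume "f \<in> ?V" "g \<in> ?V"
    then obtain F F' where F: "finite F" "F \<subseteq> carrier \<Gamma>" "\<And>x. f x \<noteq> 0 \<Longrightarrow> x \<in> elts G \<and> c x \<in> F"
      and F': "finite F'" "F' \<subseteq> carrier \<Gamma>" "\<And>x. g x \<noteq> 0 \<Longrightarrow> x \<in> elts G \<and> c x \<in> F'" by blast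
    have "x \<in> elts G \<and> c x \<in> F \<union> F'" if "f x + g x \<noteq> 0" for x
      using that F(3)[of x] F'(3)[of x] by (cases "f x = 0") auto
    then show "(\<lambda>x. f x + g x) \<in> ?V"
      using F(1,2) F'(1,2) by (intro CollectI exI[of _ "F \<union> F'"]) auto
  qed auto
  then have "f \<in> ?V"
  proof (rule steinberg_least[OF _ _ assms])
    fix B assume "compact_open_bisection G B"
    note BD = compact_open_bisectionD[OF this]
    have "compactin (discrete_topology (carrier \<Gamma>)) (c ` B)"
      by (rule image_compactin[OF BD(3) continuous_c])
    then show "indicator B \<in> ?V"
      using BD(4) unfolding compactin_discrete_topology
      by (intro CollectI exI[of _ "c ` B"]) (auto simp: indicator_def)
  qed
  then show ?thesis by blast
qed

lemma steinberg_decomposition: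
  assumes f: "f \<in> steinberg G"
  obtains F a where "finite F" "F \<subseteq> carrier \<Gamma>" "a \<in> Pi F graded_part" "f = (\<lambda>x. \<Sum>i\<in>F. a i x)"
proof -
  obtain F where F: "finite F" "F \<subseteq> carrier \<Gamma>" "\<And>x. f x \<noteq> 0 \<Longrightarrow> x \<in> elts G \<and> c x \<in> F"
    using steinberg_finite_degrees[OF f] by blast
  have "f x = (\<Sum>i\<in>F. part i f x)" for x
  proof (cases "f x = 0")
    case False
    then have x: "x \<in> elts G" "c x \<in> F" using F(3) by auto
    have "(\<Sum>i\<in>F. part i f x) = (\<Sum>i\<in>F. if i = c x then f x else 0)"
      using x by (intro sum.cong) (auto simp: part_def component_iff indicator_def)
    then show ?thesis using x F(1) by simp
  qed (simp add: part_def)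
  moreover have "(\<lambda>i. part i f) \<in> Pi F graded_part" using F(2) part_graded_part[OF f] by auto
  ultimately show ?thesis using that[of F "\<lambda>i. part i f"] F by blast
qed

lemma homogeneous_sum:
  assumes "finite F" "\<And>i. i \<in> F \<Longrightarrow> a i \<in> graded_part i" "i \<in> F" "c x = i"
  shows "(\<Sum>j\<in>F. a j x) = a i x"
proof -
  have "a j x = (if j = i then a i x else 0)" if "j \<in> F" for j
    using graded_partD(4)[OF assms(2)[OF that], of x] assms(4) by auto
  then have "(\<Sum>j\<in>F. a j x) = (\<Sum>j\<in>F. if j = i then a i x else 0)" by (intro sum.cong) auto
  then show ?thesis using assms by simp
qed

lemma product_sums_pointwise:
  assumes R: "abelian_monoid R" "add R = (\<lambda>f g x. f x + g x)" "zero R = (\<lambda>x. 0)" "mult R = convolution G"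
    and sub: "\<And>f. f \<in> steinberg G \<Longrightarrow> f \<in> carrier R"
  shows "product_sums R (graded_part \<alpha>) (graded_part \<beta>) =
    {(\<lambda>x. \<Sum>i<n. convolution G (a i) (b i) x) |(n::nat) a b.
      a \<in> {..<n} \<rightarrow> graded_part \<alpha> \<and> b \<in> {..<n} \<rightarrow> graded_part \<beta>}"
proof -
  have eq: "finsum R (\<lambda>i. a i \<otimes>\<^bsub>R\<^esub> b i) {..<n} = (\<lambda>x. \<Sum>i<n. convolution G (a i) (b i) x)"
    if "a \<in> {..<n} \<rightarrow> graded_part \<alpha>" "b \<in> {..<n} \<rightarrow> graded_part \<beta>" for a b and n :: nat
    unfolding R(4)
    by (rule pointwise_finsum[OF R(1-3)])
      (use that in \<open>auto intro!: sub steinberg_convolution dest!: graded_partD(1) simp: Pi_iff\<close>)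
  show ?thesis
    unfolding product_sums_def by (intro Collect_cong ex_cong1) (use eq in auto)
qed

lemma product_sums_steinberg:
  "product_sums (steinberg_ring G) (graded_part \<alpha>) (graded_part \<beta>) =
    {(\<lambda>x. \<Sum>i<n. convolution G (a i) (b i) x) |(n::nat) a b.
      a \<in> {..<n} \<rightarrow> graded_part \<alpha> \<and> b \<in> {..<n} \<rightarrow> graded_part \<beta>}"
  by (rule product_sums_pointwise[OF abelian_monoid_steinberg]) auto

lemma product_sums_Cc:
  "product_sums (Cc_algebra G) (graded_part \<alpha>) (graded_part \<beta>) =
    product_sums (steinberg_ring G) (graded_part \<alpha>) (graded_part \<beta>)"
  unfolding product_sums_steinberg
  by (rule product_sums_pointwise[OF abelian_monoid_Cc]) (auto intro: steinberg_Cc)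

lemma graded_part_steinberg: "graded_part \<gamma> \<subseteq> steinberg G"
  by (auto simp: steinberg_component_def)

lemma product_sums_subset:
  "product_sums (steinberg_ring G) (graded_part \<alpha>) (graded_part \<beta>) \<subseteq> graded_part (\<alpha> \<otimes>\<^bsub>\<Gamma>\<^esub> \<beta>)"
  unfolding product_sums_steinberg
  by (auto intro!: pointwise_subspace_sum[OF graded_part_subspace] graded_part_convolution simp: Pi_iff)

lemma graded_ring_steinberg: "graded_ring \<Gamma> (steinberg_ring G) graded_part"
proof (intro graded_ring.intro graded_ring_axioms.intro nonunital_ring_steinberg grading.group_axioms
    product_sums_subset)
  interpret R: nonunital_ring "steinberg_ring G" by (rule nonunital_ring_steinberg)
  fix \<gamma>
  show "additive_subgroup (graded_part \<gamma>) (steinberg_ring G)"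
  proof (intro additive_subgroup.intro subgroup.intro)
    fix f assume f: "f \<in> graded_part \<gamma>"
    have m: "(\<lambda>x. - 1 * f x) \<in> graded_part \<gamma>" by (rule pointwise_subspaceD(3)[OF graded_part_subspace f])
    have "\<ominus>\<^bsub>steinberg_ring G\<^esub> f = (\<lambda>x. - 1 * f x)"
      by (rule R.minus_equality) (use f m graded_partD(1) in auto)
    then show "inv\<^bsub>add_monoid (steinberg_ring G)\<^esub> f \<in> graded_part \<gamma>" using m by (simp add: a_inv_def)
  qed (use graded_part_steinberg pointwise_subspaceD[OF graded_part_subspace] in auto)
next
  show "independent_components (steinberg_ring G) (carrier \<Gamma>) graded_part"
    unfolding independent_components_def
  proof (intro allI impI ballI, elim conjE)
    fix F a i
    assume F: "finite F" "a \<in> Pi F graded_part" "i \<in> F"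
      and sum: "(\<Oplus>\<^bsub>steinberg_ring G\<^esub>i\<in>F. a i) = \<zero>\<^bsub>steinberg_ring G\<^esub>"
    have a: "a i \<in> graded_part i" if "i \<in> F" for i using F that by auto
    then have "(\<Oplus>\<^bsub>steinberg_ring G\<^esub>i\<in>F. a i) = (\<lambda>x. \<Sum>i\<in>F. a i x)"
      using F graded_partD(1) by (intro finsum_steinberg) auto
    then have zero: "(\<Sum>i\<in>F. a i x) = 0" for x using sum by (simp add: fun_eq_iff)
    have "a i x = 0" for x
      using graded_partD(4)[OF a[OF F(3)], of x] homogeneous_sum[OF F(1) a F(3), of x] zero[of x] by auto
    then show "a i = \<zero>\<^bsub>steinberg_ring G\<^esub>" by (simp add: fun_eq_iff)
  qed
next
  show "component_sums (steinberg_ring G) (carrier \<Gamma>) graded_part = carrier (steinberg_ring G)"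
  proof (intro equalityI subsetI)
    fix f assume "f \<in> carrier (steinberg_ring G)"
    then have "f \<in> steinberg G" by simp
    then obtain F a where F: "finite F" "F \<subseteq> carrier \<Gamma>" "a \<in> Pi F graded_part" "f = (\<lambda>x. \<Sum>i\<in>F. a i x)"
      by (rule steinberg_decomposition)
    then have "f = (\<Oplus>\<^bsub>steinberg_ring G\<^esub>i\<in>F. a i)"
      using graded_part_steinberg by (subst finsum_steinberg) auto
    then show "f \<in> component_sums (steinberg_ring G) (carrier \<Gamma>) graded_part"
      unfolding component_sums_def using F by blast
  next
    interpret R: nonunital_ring "steinberg_ring G" by (rule nonunital_ring_steinberg)
    fix f assume "f \<in> component_sums (steinberg_ring G) (carrier \<Gamma>) graded_part"
    then obtain F a where "f = (\<Oplus>\<^bsub>steinberg_ring G\<^esub>i\<in>F. a i)" "a \<in> Pi F graded_part"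
      unfolding component_sums_def by blast
    then show "f \<in> carrier (steinberg_ring G)"
      using R.finsum_closed[of a F] graded_part_steinberg by auto
  qed
qed

lemma strongly_graded_ring_iff:
  "strongly_graded_ring \<Gamma> (steinberg_ring G) graded_part \<longleftrightarrow>
    (\<forall>\<alpha>\<in>carrier \<Gamma>. \<forall>\<beta>\<in>carrier \<Gamma>. graded_part (\<alpha> \<otimes>\<^bsub>\<Gamma>\<^esub> \<beta>) \<subseteq>
      product_sums (steinberg_ring G) (graded_part \<alpha>) (graded_part \<beta>))"
  unfolding strongly_graded_ring_def strongly_graded_ring_axioms_def
  using graded_ring_steinberg product_sums_subset by blast

section \<open>Strongly graded groupoids and algebras\<close>

lemma set_mul_component_subset:
  "set_mul G (component \<alpha>) (component \<beta>) \<subseteq> component (\<alpha> \<otimes>\<^bsub>\<Gamma>\<^esub> \<beta>)"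
  unfolding set_mul_def by (auto simp: component_iff c_mul)

lemma strongly_graded_groupoid_iff:
  "strongly_graded_groupoid \<Gamma> G c \<longleftrightarrow>
    (\<forall>\<alpha>\<in>carrier \<Gamma>. \<forall>\<beta>\<in>carrier \<Gamma>. component (\<alpha> \<otimes>\<^bsub>\<Gamma>\<^esub> \<beta>) \<subseteq> set_mul G (component \<alpha>) (component \<beta>))"
  unfolding strongly_graded_groupoid_def using set_mul_component_subset by blast

text \<open>If \<open>Y \<subseteq> G\<^sub>\<alpha>\<close> and \<open>B \<subseteq> G\<^sub>\<alpha>\<^sub>\<beta>\<close> are compact open bisections with \<open>r(B) \<subseteq> r(Y)\<close>, then
  \<open>B = Y (Y\<^sup>-\<^sup>1 B)\<close> with \<open>Y\<^sup>-\<^sup>1 B \<subseteq> G\<^sub>\<beta>\<close>, so that \<open>1\<^sub>B\<close> is a single product. Strong grading says that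
  the ranges of such sets \<open>Y\<close> cover all units.\<close>

lemma indicator_product:
  assumes \<alpha>\<beta>: "\<alpha> \<in> carrier \<Gamma>" "\<beta> \<in> carrier \<Gamma>"
    and Y: "compact_open_bisection G Y" "Y \<subseteq> component \<alpha>"
    and B: "compact_open_bisection G B" "B \<subseteq> component (\<alpha> \<otimes>\<^bsub>\<Gamma>\<^esub> \<beta>)"
    and ran: "gran G ` B \<subseteq> gran G ` Y"
  shows "indicator Y \<in> graded_part \<alpha>" "indicator (set_mul G (ginv G ` Y) B) \<in> graded_part \<beta>"
    "convolution G (indicator Y) (indicator (set_mul G (ginv G ` Y) B)) = indicator B"
proof -
  let ?Z = "set_mul G (ginv G ` Y) B"
  note YD = compact_open_bisectionD[OF Y(1)] and BD = compact_open_bisectionD[OF B(1)]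
  have Z: "compact_open_bisection G ?Z"
    by (rule compact_open_bisection_set_mul[OF compact_open_bisection_inverse[OF Y(1)] B(1)])
  have ZE: "\<exists>y b. y \<in> Y \<and> b \<in> B \<and> y \<in> elts G \<and> b \<in> elts G \<and> gran G y = gran G b \<and>
      z = gmul G (ginv G y) b" if z: "z \<in> ?Z" for z
  proof -
    obtain y b where "y \<in> Y" "b \<in> B" "gsrc G (ginv G y) = gran G b" "z = gmul G (ginv G y) b"
      using z unfolding set_mul_def by blast
    moreover from this have "y \<in> elts G" "b \<in> elts G" using YD(4) BD(4) by auto
    ultimately show ?thesis by auto
  qed
  have "?Z \<subseteq> component \<beta>"
  proof
    fix z assume "z \<in> ?Z"
    then obtain y b where z: "y \<in> Y" "b \<in> B" "y \<in> elts G" "b \<in> elts G" "gran G y = gran G b"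
      "z = gmul G (ginv G y) b" using ZE by meson
    then have "c y = \<alpha>" "c b = \<alpha> \<otimes>\<^bsub>\<Gamma>\<^esub> \<beta>" using Y(2) B(2) by (auto simp: component_iff subset_iff)
    then have "c z = inv\<^bsub>\<Gamma>\<^esub> \<alpha> \<otimes>\<^bsub>\<Gamma>\<^esub> (\<alpha> \<otimes>\<^bsub>\<Gamma>\<^esub> \<beta>)"
      using z by (simp add: c_mul c_inv)
    also have "\<dots> = \<beta>" using \<alpha>\<beta> by (simp flip: grading.m_assoc)
    finally show "z \<in> component \<beta>" using z by (simp add: component_iff)
  qed
  then show "indicator ?Z \<in> graded_part \<beta>" "indicator Y \<in> graded_part \<alpha>"
    using steinberg_indicator[OF Z] steinberg_indicator[OF Y(1)] Y(2)
    by (auto simp: steinberg_component_def indicator_def split: if_splits)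
  have "set_mul G Y ?Z = B"
  proof (intro equalityI subsetI)
    fix x assume "x \<in> set_mul G Y ?Z"
    then obtain y' z where x: "y' \<in> Y" "z \<in> ?Z" "gsrc G y' = gran G z" "x = gmul G y' z"
      unfolding set_mul_def by blast
    obtain y b where z: "y \<in> Y" "b \<in> B" "y \<in> elts G" "b \<in> elts G" "gran G y = gran G b"
      "z = gmul G (ginv G y) b" using ZE[OF x(2)] by blast
    have "y' = y" by (rule inj_onD[OF YD(6)]) (use x z in auto)
    then have "x = b" using x(4) z by simp
    then show "x \<in> B" using z by simp
  next
    fix b assume b: "b \<in> B"
    then obtain y where y: "y \<in> Y" "gran G y = gran G b" using ran by force
    have e: "y \<in> elts G" "b \<in> elts G" using y b YD(4) BD(4) by auto
    have "gmul G (ginv G y) b \<in> ?Z"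
      unfolding set_mul_def using y b e by (intro CollectI exI[of _ "ginv G y"] exI[of _ b]) auto
    moreover have "b = gmul G y (gmul G (ginv G y) b)" "gsrc G y = gran G (gmul G (ginv G y) b)"
      using e y by auto
    ultimately show "b \<in> set_mul G Y ?Z" unfolding set_mul_def using y by blast
  qed
  then show "convolution G (indicator Y) (indicator ?Z) = indicator B"
    using convolution_indicator_bisections[OF YD(1) compact_open_bisectionD(1)[OF Z]] by simp
qed

text \<open>For \<open>x \<in> G\<^sub>\<alpha>\<^sub>\<beta>\<close> the unit \<open>r(x)\<close> has degree \<open>\<alpha> \<alpha>\<^sup>-\<^sup>1\<close>, so strong grading makes it the range of some
  \<open>y \<in> G\<^sub>\<alpha>\<close>. A bisection around \<open>y\<close> splits the indicators of all small bisections around \<open>x\<close>.\<close>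

lemma strongly_graded_groupoid_imp_ring:
  assumes strong: "strongly_graded_groupoid \<Gamma> G c"
  shows "strongly_graded_ring \<Gamma> (steinberg_ring G) graded_part"
  unfolding strongly_graded_ring_iff
proof (intro ballI subsetI)
  fix \<alpha> \<beta> f
  assume \<alpha>: "\<alpha> \<in> carrier \<Gamma>" and \<beta>: "\<beta> \<in> carrier \<Gamma>" and f: "f \<in> graded_part (\<alpha> \<otimes>\<^bsub>\<Gamma>\<^esub> \<beta>)"
  interpret R: nonunital_ring "steinberg_ring G" by (rule nonunital_ring_steinberg)
  let ?P = "product_sums (steinberg_ring G) (graded_part \<alpha>) (graded_part \<beta>)"
  have sub: "graded_part \<alpha> \<subseteq> carrier (steinberg_ring G)" "graded_part \<beta> \<subseteq> carrier (steinberg_ring G)"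
    using graded_part_steinberg by auto
  have zero: "(\<lambda>x. 0) \<in> ?P" using R.product_sums_zero[of "graded_part \<alpha>" "graded_part \<beta>"] by simp
  have add: "(\<lambda>x. f x + g x) \<in> ?P" if "f \<in> ?P" "g \<in> ?P" for f g
    using R.product_sums_add[OF sub that] by simp
  have scale: "(\<lambda>x. k * f x) \<in> ?P" if fP: "f \<in> ?P" for k f
  proof -
    obtain n :: nat and a b where n: "f = (\<lambda>x. \<Sum>i<n. convolution G (a i) (b i) x)"
      "a \<in> {..<n} \<rightarrow> graded_part \<alpha>" "b \<in> {..<n} \<rightarrow> graded_part \<beta>"
      using fP unfolding product_sums_steinberg by blast
    have "(\<lambda>x. k * f x) = (\<lambda>x. \<Sum>i<n. convolution G (\<lambda>x. k * a i x) (b i) x)"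
      unfolding n(1) by (simp add: convolution_scale_left sum_distrib_left)
    moreover have "(\<lambda>i x. k * a i x) \<in> {..<n} \<rightarrow> graded_part \<alpha>"
      using n(2) pointwise_subspaceD(3)[OF graded_part_subspace] by auto
    ultimately show ?thesis
      unfolding product_sums_steinberg using n(3)
      by (intro CollectI exI[of _ n] exI[of _ "\<lambda>i x. k * a i x"] exI[of _ b]) blast
  qed
  have V: "pointwise_subspace ?P" unfolding pointwise_subspace_def using zero add scale by blast
  show "f \<in> ?P"
  proof (rule graded_part_span[OF _ V _ f])
    show "\<alpha> \<otimes>\<^bsub>\<Gamma>\<^esub> \<beta> \<in> carrier \<Gamma>" using \<alpha> \<beta> by simp
    fix B assume B: "compact_open_bisection G B" "B \<subseteq> component (\<alpha> \<otimes>\<^bsub>\<Gamma>\<^esub> \<beta>)"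
    note BD = compact_open_bisectionD[OF B(1)]
    show "indicator B \<in> ?P"
    proof (rule compact_open_induct[OF B(1)])
      have "(indicator {} :: 'g \<Rightarrow> complex) = (\<lambda>x. 0)" by auto
      then show "indicator {} \<in> ?P" using zero by simp
    next
      fix D E assume "D \<inter> E = {}" and DE: "indicator D \<in> ?P" "indicator E \<in> ?P"
      then have "(indicator (D \<union> E) :: 'g \<Rightarrow> complex) = (\<lambda>x. indicator D x + indicator E x)"
        by (auto simp: fun_eq_iff indicator_def)
      then show "indicator (D \<union> E) \<in> ?P" using add[OF DE] by simp
    next
      fix x assume x: "x \<in> B"
      then have xe: "x \<in> elts G" using BD by blast
      have "gran G x \<in> component (\<alpha> \<otimes>\<^bsub>\<Gamma>\<^esub> inv\<^bsub>\<Gamma>\<^esub> \<alpha>)"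
        using xe \<alpha> by (simp add: component_iff c_unit)
      also have "\<dots> \<subseteq> set_mul G (component \<alpha>) (component (inv\<^bsub>\<Gamma>\<^esub> \<alpha>))"
        using strong \<alpha> grading.inv_closed[OF \<alpha>] unfolding strongly_graded_groupoid_iff by blast
      finally obtain y z where yz: "y \<in> component \<alpha>" "z \<in> elts G" "gsrc G y = gran G z"
        "gran G x = gmul G y z"
        unfolding set_mul_def by (auto simp: component_iff)
      then have ye: "y \<in> elts G" by (simp add: component_iff)
      have "gran G (gran G x) = gran G y" unfolding yz(4) using ye yz by simp
      then have y: "gran G y = gran G x" using xe by simp
      obtain Y where Y: "compact_open_bisection G Y" "y \<in> Y" "Y \<subseteq> component \<alpha>"
        using ample_basis[OF component_clopen(1)[OF \<alpha>] yz(1)] by blast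
      have "openin (gtop G) {x \<in> B. gran G x \<in> gran G ` Y}"
        by (rule openin_continuous_map_preimage_gen[OF continuous_ran BD(2)
              openin_range_image[OF compact_open_bisectionD(2)[OF Y(1)]]])
      moreover have "x \<in> {x \<in> B. gran G x \<in> gran G ` Y}" using x imageI[OF Y(2), of "gran G"] unfolding y by simp
      ultimately obtain D where D: "compact_open_bisection G D" "x \<in> D"
        "D \<subseteq> {x \<in> B. gran G x \<in> gran G ` Y}" using ample_basis by blast
      have "indicator E \<in> ?P" if E: "compact_open_bisection G E" "E \<subseteq> D" for E
      proof -
        have "E \<subseteq> component (\<alpha> \<otimes>\<^bsub>\<Gamma>\<^esub> \<beta>)" "gran G ` E \<subseteq> gran G ` Y" using E D(3) B(2) by auto
        note prod = indicator_product[OF \<alpha> \<beta> Y(1,3) E(1) this]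
        have "convolution G (indicator Y) (indicator (set_mul G (ginv G ` Y) E)) \<in> ?P"
          using R.product_sums_snoc[OF sub R.product_sums_zero prod(1,2)] by simp
        then show ?thesis unfolding prod(3) .
      qed
      then show "\<exists>D. compact_open_bisection G D \<and> x \<in> D \<and> D \<subseteq> B \<and>
          (\<forall>E. compact_open_bisection G E \<longrightarrow> E \<subseteq> D \<longrightarrow> indicator E \<in> ?P)" using D by blast
    qed
  qed
qed

text \<open>A nonzero value of a convolution at \<open>x\<close> comes from a factorization of \<open>x\<close> with factors in the supports.
  Both converses reduce to this: a sum of convolutions that approximates \<open>1\<^sub>B\<close> cannot vanish at \<open>x \<in> B\<close>.\<close>

lemma strongly_graded_groupoidI:
  assumes approx: "\<And>\<alpha> \<beta> B x. \<alpha> \<in> carrier \<Gamma> \<Longrightarrow> \<beta> \<in> carrier \<Gamma> \<Longrightarrow> compact_open_bisection G B \<Longrightarrow>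
      B \<subseteq> component (\<alpha> \<otimes>\<^bsub>\<Gamma>\<^esub> \<beta>) \<Longrightarrow> x \<in> B \<Longrightarrow>
      \<exists>f\<in>graded_part \<alpha>. \<exists>g\<in>graded_part \<beta>. convolution G f g x \<noteq> 0"
  shows "strongly_graded_groupoid \<Gamma> G c"
  unfolding strongly_graded_groupoid_iff
proof (intro ballI subsetI)
  fix \<alpha> \<beta> x
  assume \<alpha>: "\<alpha> \<in> carrier \<Gamma>" and \<beta>: "\<beta> \<in> carrier \<Gamma>" and x: "x \<in> component (\<alpha> \<otimes>\<^bsub>\<Gamma>\<^esub> \<beta>)"
  have "\<alpha> \<otimes>\<^bsub>\<Gamma>\<^esub> \<beta> \<in> carrier \<Gamma>" using \<alpha> \<beta> by simp
  then obtain B where B: "compact_open_bisection G B" "x \<in> B" "B \<subseteq> component (\<alpha> \<otimes>\<^bsub>\<Gamma>\<^esub> \<beta>)"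
    using ample_basis[OF component_clopen(1) x] by blast
  obtain f g where f: "f \<in> graded_part \<alpha>" and g: "g \<in> graded_part \<beta>" and "convolution G f g x \<noteq> 0"
    using approx[OF \<alpha> \<beta> B(1,3,2)] by blast
  then obtain y z where "gsrc G y = gran G z" "x = gmul G y z" "f y \<noteq> 0" "g z \<noteq> 0"
    by (elim convolution_nonzeroE)
  moreover from this have "y \<in> component \<alpha>" "z \<in> component \<beta>"
    using graded_partD(3,4)[OF f] graded_partD(3,4)[OF g] by (auto simp: component_iff)
  ultimately show "x \<in> set_mul G (component \<alpha>) (component \<beta>)" unfolding set_mul_def by blast
qed

lemma strongly_graded_ring_imp_groupoid:
  assumes strong: "strongly_graded_ring \<Gamma> (steinberg_ring G) graded_part"
  shows "strongly_graded_groupoid \<Gamma> G c"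
proof (rule strongly_graded_groupoidI)
  fix \<alpha> \<beta> B x
  assume \<alpha>\<beta>: "\<alpha> \<in> carrier \<Gamma>" "\<beta> \<in> carrier \<Gamma>"
    and B: "compact_open_bisection G B" "B \<subseteq> component (\<alpha> \<otimes>\<^bsub>\<Gamma>\<^esub> \<beta>)" and x: "x \<in> B"
  have "indicator B \<in> graded_part (\<alpha> \<otimes>\<^bsub>\<Gamma>\<^esub> \<beta>)"
    using steinberg_indicator[OF B(1)] B(2)
    by (auto simp: steinberg_component_def indicator_def split: if_splits)
  then have "indicator B \<in> product_sums (steinberg_ring G) (graded_part \<alpha>) (graded_part \<beta>)"
    using strong \<alpha>\<beta> unfolding strongly_graded_ring_iff by blast
  then obtain n :: nat and a b where n: "indicator B = (\<lambda>x. \<Sum>i<n. convolution G (a i) (b i) x)"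
    "a \<in> {..<n} \<rightarrow> graded_part \<alpha>" "b \<in> {..<n} \<rightarrow> graded_part \<beta>"
    unfolding product_sums_steinberg by blast
  have "(\<Sum>i<n. convolution G (a i) (b i) x) \<noteq> 0" using fun_cong[OF n(1), of x] x by simp
  then obtain i where "i \<in> {..<n}" "convolution G (a i) (b i) x \<noteq> 0" by (rule sum.not_neutral_contains_not_neutral)
  then show "\<exists>f\<in>graded_part \<alpha>. \<exists>g\<in>graded_part \<beta>. convolution G f g x \<noteq> 0" using n by blast
qed

lemma graded_part_linear_subspace: "pre_cstar_algebra.linear_subspace (Cc_algebra G) (graded_part \<gamma>)"
  unfolding pre_cstar_algebra.linear_subspace_def[OF pre_cstar_Cc]
  using pointwise_subspaceD[OF graded_part_subspace] graded_partD(2) by auto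

lemma reduced_component_eq:
  "reduced_component G c \<gamma> = atopology (star_completion (Cc_algebra G)) closure_of
    (const_class (Cc_algebra G) ` graded_part \<gamma>)"
  by (simp add: reduced_component_def reduced_cstar_def)

text \<open>The density of the sum is that of \<open>A(G)\<close> in \<open>C\<^sub>c(G)\<close>. For independence: if \<open>\<Sum>\<^sub>i x\<^sub>i\<^sub>n\<close> tends to 0 in
  norm with \<open>x\<^sub>i\<^sub>n\<close> supported in \<open>G\<^sub>i\<close>, it does so
  pointwise, hence so does each \<open>x\<^sub>i\<^sub>n\<close> because the sets \<open>G\<^sub>i\<close> are disjoint. A Cauchy sequence that is
  pointwise null is null in norm.\<close>

lemma graded_cstar_algebra_reduced:
  "graded_cstar_algebra \<Gamma> (reduced_cstar G) (reduced_component G c)"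
proof -
  interpret A: pre_cstar_algebra "Cc_algebra G" by (rule pre_cstar_Cc)
  have "graded_cstar_algebra \<Gamma> (star_completion (Cc_algebra G)) (\<lambda>\<gamma>. A.closure_class (graded_part \<gamma>))"
  proof (rule A.graded_completion[OF grading.group_axioms graded_part_linear_subspace])
    fix \<alpha> \<beta> f g assume "f \<in> graded_part \<alpha>" "g \<in> graded_part \<beta>"
    then show "f \<otimes>\<^bsub>Cc_algebra G\<^esub> g \<in> graded_part (\<alpha> \<otimes>\<^bsub>\<Gamma>\<^esub> \<beta>)" by (simp add: graded_part_convolution)
  next
    fix \<alpha> f assume "f \<in> graded_part \<alpha>"
    then show "astar (Cc_algebra G) f \<in> graded_part (inv\<^bsub>\<Gamma>\<^esub> \<alpha>)" by (simp add: graded_part_involution)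
  next
    fix f and e :: real assume "f \<in> carrier (Cc_algebra G)" "0 < e"
    then have f: "f \<in> Cc G" and e: "0 < e" by auto
    obtain g where g: "g \<in> steinberg G" "reduced_norm G (\<lambda>x. f x + - 1 * g x) < e"
      using steinberg_dense[OF f e] by blast
    obtain F a where F: "finite F" "F \<subseteq> carrier \<Gamma>" "a \<in> Pi F graded_part" "g = (\<lambda>x. \<Sum>i\<in>F. a i x)"
      by (rule steinberg_decomposition[OF g(1)])
    have "g = (\<Oplus>\<^bsub>Cc_algebra G\<^esub>i\<in>F. a i)"
      unfolding F(4) using F graded_partD(2) by (subst finsum_Cc) auto
    then have "g \<in> component_sums (Cc_algebra G) (carrier \<Gamma>) graded_part"
      unfolding component_sums_def using F by blast
    moreover have "anorm (Cc_algebra G) (f \<ominus>\<^bsub>Cc_algebra G\<^esub> g) < e"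
      unfolding diff_Cc[OF f steinberg_Cc[OF g(1)]] using g(2) by simp
    ultimately show "\<exists>b\<in>component_sums (Cc_algebra G) (carrier \<Gamma>) graded_part.
        anorm (Cc_algebra G) (f \<ominus>\<^bsub>Cc_algebra G\<^esub> b) < e" by blast
  next
    fix F x
    assume F: "finite F" "F \<subseteq> carrier \<Gamma>"
      and x: "\<And>i. i \<in> F \<Longrightarrow> A.cauchy_seq (x i) \<and> (\<forall>n. x i n \<in> graded_part i)"
      and lim: "(\<lambda>n. anorm (Cc_algebra G) (\<Oplus>\<^bsub>Cc_algebra G\<^esub>i\<in>F. x i n)) \<longlonglongrightarrow> 0"
    have gp: "x i n \<in> graded_part i" and Cc: "x i n \<in> Cc G" if "i \<in> F" for i n
      using x[OF that] graded_partD(2) by blast+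
    define s where "s n = (\<lambda>g. \<Sum>i\<in>F. x i n g)" for n
    have sum: "(\<Oplus>\<^bsub>Cc_algebra G\<^esub>i\<in>F. x i n) = s n" for n
      unfolding s_def using F Cc by (intro finsum_Cc) auto
    have s: "convolver (s n)" for n
      unfolding s_def by (intro Cc_convolver pointwise_subspace_sum[OF Cc_subspace] Cc)
    have s0: "(\<lambda>n. s n g) \<longlonglongrightarrow> 0" for g
    proof (rule Lim_null_comparison)
      show "\<forall>\<^sub>F n in sequentially. norm (s n g) \<le> reduced_norm G (s n)"
        using value_le_reduced_norm[OF s] by simp
      show "(\<lambda>n. reduced_norm G (s n)) \<longlonglongrightarrow> 0" using lim by (simp add: sum)
    qed
    show "\<forall>i\<in>F. (\<lambda>n. anorm (Cc_algebra G) (x i n)) \<longlonglongrightarrow> 0"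
    proof
      fix i assume i: "i \<in> F"
      have "(\<lambda>n. reduced_norm G (x i n)) \<longlonglongrightarrow> 0"
      proof (rule pointwise_null_imp_norm_null)
        show "convolver (x i n)" for n by (rule Cc_convolver[OF Cc[OF i]])
        show "\<exists>N. \<forall>m\<ge>N. \<forall>n\<ge>N. reduced_norm G (\<lambda>g. x i m g + - 1 * x i n g) < e" if "0 < e" for e
          using x[OF i] that unfolding A.cauchy_seq_iff diff_Cc[OF Cc[OF i] Cc[OF i]] by auto
        show "(\<lambda>n. x i n g) \<longlonglongrightarrow> 0" for g
        proof (cases "c g = i")
          case True
          have "s n g = x i n g" for n
            unfolding s_def by (rule homogeneous_sum[OF F(1) gp i True])
          then show ?thesis using s0[of g] by simp
        next
          case False
          then have "x i n g = 0" for n using graded_partD(4)[OF gp[OF i]] by blast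
          then show ?thesis by simp
        qed
      qed
      then show "(\<lambda>n. anorm (Cc_algebra G) (x i n)) \<longlonglongrightarrow> 0" by simp
    qed
  qed
  then show ?thesis by (simp add: reduced_cstar_def reduced_component_eq[abs_def])
qed

lemma strongly_graded_ring_imp_cstar:
  assumes strong: "strongly_graded_ring \<Gamma> (steinberg_ring G) graded_part"
  shows "strongly_graded_cstar_algebra \<Gamma> (reduced_cstar G) (reduced_component G c)"
proof (intro strongly_graded_cstar_algebra.intro strongly_graded_cstar_algebra_axioms.intro
    graded_cstar_algebra_reduced)
  interpret A: pre_cstar_algebra "Cc_algebra G" by (rule pre_cstar_Cc)
  fix \<alpha> \<beta> assume \<alpha>\<beta>: "\<alpha> \<in> carrier \<Gamma>" "\<beta> \<in> carrier \<Gamma>"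
  have "product_sums (steinberg_ring G) (graded_part \<alpha>) (graded_part \<beta>) = graded_part (\<alpha> \<otimes>\<^bsub>\<Gamma>\<^esub> \<beta>)"
    using strong \<alpha>\<beta> product_sums_subset unfolding strongly_graded_ring_iff by blast
  then show "atopology (reduced_cstar G) closure_of
      span_mult (reduced_cstar G) (reduced_component G c \<alpha>) (reduced_component G c \<beta>) =
      reduced_component G c (\<alpha> \<otimes>\<^bsub>\<Gamma>\<^esub> \<beta>)"
    unfolding reduced_component_eq reduced_cstar_def
    by (intro A.span_mult_dense graded_part_linear_subspace) (simp add: product_sums_Cc)
qed

text \<open>Evaluation at \<open>x\<close> is bounded by the reduced norm, so a sum of products at distance less than 1
  from \<open>1\<^sub>B\<close> is nonzero at \<open>x\<close>.\<close>

lemma strongly_graded_cstar_imp_groupoid: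
  assumes strong: "strongly_graded_cstar_algebra \<Gamma> (reduced_cstar G) (reduced_component G c)"
  shows "strongly_graded_groupoid \<Gamma> G c"
proof (rule strongly_graded_groupoidI)
  interpret A: pre_cstar_algebra "Cc_algebra G" by (rule pre_cstar_Cc)
  fix \<alpha> \<beta> B x
  assume \<alpha>\<beta>: "\<alpha> \<in> carrier \<Gamma>" "\<beta> \<in> carrier \<Gamma>"
    and B: "compact_open_bisection G B" "B \<subseteq> component (\<alpha> \<otimes>\<^bsub>\<Gamma>\<^esub> \<beta>)" and x: "x \<in> B"
  have 1: "indicator B \<in> graded_part (\<alpha> \<otimes>\<^bsub>\<Gamma>\<^esub> \<beta>)"
    using steinberg_indicator[OF B(1)] B(2)
    by (auto simp: steinberg_component_def indicator_def split: if_splits)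
  have BC: "indicator B \<in> carrier (Cc_algebra G)" using graded_partD(2)[OF 1] by simp
  have sub: "graded_part \<gamma> \<subseteq> carrier (Cc_algebra G)" for \<gamma> using graded_partD(2) by auto
  have "const_class (Cc_algebra G) (indicator B) \<in> reduced_component G c (\<alpha> \<otimes>\<^bsub>\<Gamma>\<^esub> \<beta>)"
    unfolding reduced_component_eq A.const_class_eq[of "indicator B"]
    by (rule A.closure_classI[OF sub A.cauchy_seq_const[OF BC] 1])
  also have "\<dots> = atopology (reduced_cstar G) closure_of
      span_mult (reduced_cstar G) (reduced_component G c \<alpha>) (reduced_component G c \<beta>)"
    using strongly_graded_cstar_algebra.component_mult_dense[OF strong \<alpha>\<beta>] by simp
  finally have dense: "const_class (Cc_algebra G) (indicator B) \<in>
      atopology (star_completion (Cc_algebra G)) closure_of span_mult (star_completion (Cc_algebra G))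
        (A.closure_class (graded_part \<alpha>)) (A.closure_class (graded_part \<beta>))"
    unfolding reduced_component_eq reduced_cstar_def .
  obtain n :: nat and k a b where n: "a \<in> {..<n} \<rightarrow> graded_part \<alpha>" "b \<in> {..<n} \<rightarrow> graded_part \<beta>"
    "anorm (Cc_algebra G) (indicator B \<ominus>\<^bsub>Cc_algebra G\<^esub> (\<Oplus>\<^bsub>Cc_algebra G\<^esub>i\<in>{..<n}.
      ascale (Cc_algebra G) (k i) (a i \<otimes>\<^bsub>Cc_algebra G\<^esub> b i))) < 1"
    by (rule A.span_mult_approximation[OF sub sub BC dense zero_less_one])
  have ab: "(\<lambda>x. k i * convolution G (a i) (b i) x) \<in> Cc G" if "i \<in> {..<n}" for i
    using that n(1,2) graded_partD(2)
    by (intro pointwise_subspaceD(3)[OF Cc_subspace] Cc_convolution) blast+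
  define s where "s x = (\<Sum>i\<in>{..<n}. k i * convolution G (a i) (b i) x)" for x
  have "(\<Oplus>\<^bsub>Cc_algebra G\<^esub>i\<in>{..<n}. ascale (Cc_algebra G) (k i) (a i \<otimes>\<^bsub>Cc_algebra G\<^esub> b i)) = s"
    unfolding s_def[abs_def] Cc_algebra_simps by (rule finsum_Cc) (use ab in auto)
  moreover have s: "s \<in> Cc G"
    unfolding s_def[abs_def] by (intro pointwise_subspace_sum[OF Cc_subspace] ab)
  ultimately have "reduced_norm G (\<lambda>x. indicator B x + - 1 * s x) < 1"
    using n(3) diff_Cc[OF _ s, of "indicator B"] BC by simp
  moreover have "convolver (\<lambda>x. indicator B x + - 1 * s x)"
    using BC s by (intro convolver_add convolver_scale Cc_convolver) auto
  ultimately have "cmod (indicator B x + - 1 * s x) < 1"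
    using value_le_reduced_norm[of "\<lambda>x. indicator B x + - 1 * s x" x] by simp
  then have "(\<Sum>i\<in>{..<n}. k i * convolution G (a i) (b i) x) \<noteq> 0" using x unfolding s_def by auto
  then obtain i where "i \<in> {..<n}" "k i * convolution G (a i) (b i) x \<noteq> 0"
    by (rule sum.not_neutral_contains_not_neutral)
  then show "\<exists>f\<in>graded_part \<alpha>. \<exists>g\<in>graded_part \<beta>. convolution G f g x \<noteq> 0" using n(1,2) by auto
qed

end

theorem theorem3:
  fixes G :: "('g, 'x) tgroupoid_scheme"
    and \<Gamma> :: "('k, 'm) monoid_scheme"
    and c :: "'g \<Rightarrow> 'k"
  assumes "ample_groupoid G"
    and "Hausdorff_space (unit_topology G)"
    and "group \<Gamma>"
    and "continuous_cocycle G \<Gamma> c"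
  shows "(strongly_graded_groupoid \<Gamma> G c \<longleftrightarrow>
            strongly_graded_ring \<Gamma> (steinberg_ring G) (steinberg_component G c))
       \<and> (strongly_graded_ring \<Gamma> (steinberg_ring G) (steinberg_component G c) \<longleftrightarrow>
            strongly_graded_cstar_algebra \<Gamma> (reduced_cstar G) (reduced_component G c))"
proof -
  interpret cocycle_groupoid G \<Gamma> c
    using assms
    by (intro cocycle_groupoid.intro hausdorff_ample_groupoid.intro hausdorff_ample_groupoid_axioms.intro
        cocycle_groupoid_axioms.intro)
  show ?thesis
    using strongly_graded_groupoid_imp_ring strongly_graded_ring_imp_groupoid
      strongly_graded_ring_imp_cstar strongly_graded_cstar_imp_groupoid by blast
qed

end
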